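(* Let $0<\beta<\infty$, $x_0\in\mathbb R^{N_0}$, $\kappa\in\mathbb R$, $c_{\mathrm{act}}>0$, and let the drift $b$ be either the ReLU drift or the smooth drift from the context. Then $$\partial_\tau\log Z^{(\tau)}_\beta(x_0,\kappa)\Big|_{\tau=0}=c_{\mathrm{act}}\,\Big\langle-\tfrac12 v^\top b(\Phi_0)v\Big\rangle+\Big\langle\tfrac1{4P}\big(v^\top\Phi_0v\big)^2\Big\rangle,$$ where $v=(p^\top,\kappa)^\top$ and $\langle\cdot\rangle$ is the Gaussian average over $p$ defined in the context.
   Context: Data $x_1,\dots,x_P\in\mathbb R^{N_0}$, $Y\in\mathbb R^P$, test input $x_0$, with $P<N_0$ and $\frac1{N_0}X^\top X\succ0$. Let $\Phi_0\in\mathbb R^{(P+1)\times(P+1)}$ be the Gram matrix $\frac1{N_0}\langle x_\alpha,x_{\alpha'}\rangle$ over $(x_1,\dots,x_P,x_0)$, written in blocks $\Phi_0=\begin{pmatrix}\Phi_{pp}&\Phi_{p\kappa}\\\Phi_{\kappa p}&\Phi_{\kappa\kappa}\end{pmatrix}$ with $\Phi_{pp}\in\mathbb R^{P\times P}$. Let $(\Phi_\tau)_{\tau\ge0}$ solve the (depth-time) Neural Covariance SDE $\mathrm d\Phi_\tau=c_{\mathrm{act}}b(\Phi_\tau)\mathrm d\tau+P^{-1/2}\Phi_\tau^{1/2}\mathrm dB_\tau\Phi_\tau^{1/2}$ started at $\Phi_0$, with $B_\tau=\frac1{\sqrt2}(\tilde B_\tau+\tilde B_\tau^\top)$, $\tilde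 B$ having i.i.d. standard Brownian entries (the solution is PSD and non-exploding). This corresponds to an MLP with shaping factor $s=\sqrt{c_{\mathrm{act}}^{-1}N/P}$ and $\tau=LP/N$. Define $Z^{(\tau)}_\beta(x_0,\kappa)=\int_{\mathbb R^P}\exp[-\frac1{2\beta}\|p\|^2+ip^\top Y]\,\mathbb E[\exp(-\frac12v^\top\Phi_\tau v)]\,\mathrm dp$. For a function $g$ of $p$ of polynomial growth, $\langle g\rangle=\frac{\int g(p)\exp[-\frac1{2\beta}\|p\|^2+ip^\top Y-\frac12v^\top\Phi_0v]\mathrm dp}{\int\exp[-\frac1{2\beta}\|p\|^2+ip^\top Y-\frac12v^\top\Phi_0v]\mathrm dp}$, i.e. the expectation under the (complex) Gaussian $p\sim\mathcal N\big((\Phi_{pp}+\beta^{-1}I)^{-1}(iY-\Phi_{p\kappa}\kappa),\,(\Phi_{pp}+\beta^{-1}I)^{-1}\big)$. Drifts: ReLU: $b(\Phi)=D^{1/2}\rho(D^{-1/2}\Phi D^{-1/2})D^{1/2}$, $D=\mathrm{diag}\Phi$, $\rho(x)=\frac{(c_+-c_-)^2}{2\pi}(\sqrt{1-x^2}-x\arccos x)$ entrywise; smooth: $b_{\alpha\beta}(\Phi)=\frac14\phi''(0)^2[\Phi_{\alpha\alpha}\Phi_{\beta\beta}+\Phi_{\alpha\beta}(2\Phi_{\alpha\beta}-3)]+\frac12\phi'''(0)\Phi_{\alpha\beta}(\Phi_{\alpha\alpha}+\Phi_{\beta\beta}-2)$ for $\phi\in C^4$ with $\phi(0)=0,\phi'(0)=1$,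 $|\phi^{(4)}(x)|\le C(1+|x|^C)$, $\frac34\phi''(0)^2+\phi'''(0)\le0$. *)

theory Defs
  imports "HOL-Probability.Probability"
begin

text \<open>Matrices indexed by a finite type are functions 'i => 'i => real.
  The P+1 inputs (x_1..x_P, x_0) are indexed by 'p option:
  Some i is the training point x_i, None is the test point x_0.\<close>

type_synonym 'i mat = "'i \<Rightarrow> 'i \<Rightarrow> real"

definition quad :: "('i::finite \<Rightarrow> real) \<Rightarrow> 'i mat \<Rightarrow> real" where
  "quad v A = (\<Sum>a\<in>UNIV. \<Sum>c\<in>UNIV. v a * A a c * v c)"

definition psd :: "('i::finite) mat \<Rightarrow> bool" where
  "psd A \<longleftrightarrow> (\<forall>a c. A a c = A c a) \<and> (\<forall>u. quad u A \<ge> 0)"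

definition psd_sqrt :: "('i::finite) mat \<Rightarrow> 'i mat" where
  "psd_sqrt A = (THE R. psd R \<and> (\<forall>a c. (\<Sum>k\<in>UNIV. R a k * R k c) = A a c))"

definition inputs :: "('p \<Rightarrow> real^'n) \<Rightarrow> real^'n \<Rightarrow> 'p option \<Rightarrow> real^'n" where
  "inputs x x0 a = (case a of None \<Rightarrow> x0 | Some i \<Rightarrow> x i)"

definition gram :: "('p \<Rightarrow> real^'n) \<Rightarrow> real^'n \<Rightarrow> ('p option) mat" where
  "gram x x0 a c = (inputs x x0 a \<bullet> inputs x x0 c) / real CARD('n)"

definition vvec :: "real^'p \<Rightarrow> real \<Rightarrow> 'p option \<Rightarrow> real" where
  "vvec p \<kappa> a = (case a of None \<Rightarrow> \<kappa> | Some i \<Rightarrow> p $ i)"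

text \<open>ReLU drift: b(Phi) = D^{1/2} rho(D^{-1/2} Phi D^{-1/2}) D^{1/2}, D = diag Phi.\<close>
definition relu_rho :: "real \<Rightarrow> real \<Rightarrow> real \<Rightarrow> real" where
  "relu_rho cp cm t = (cp - cm)^2 / (2*pi) * (sqrt (1 - t^2) - t * arccos t)"

definition relu_drift :: "real \<Rightarrow> real \<Rightarrow> ('i::finite) mat \<Rightarrow> 'i mat" where
  "relu_drift cp cm A a c =
     sqrt (A a a) * relu_rho cp cm (A a c / (sqrt (A a a) * sqrt (A c c))) * sqrt (A c c)"

text \<open>Smooth drift with d2 = phi''(0), d3 = phi'''(0).\<close>
definition smooth_drift :: "real \<Rightarrow> real \<Rightarrow> ('i::finite) mat \<Rightarrow> 'i mat" where
  "smooth_drift d2 d3 A a c =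
     1/4 * d2^2 * (A a a * A c c + A a c * (2 * A a c - 3))
     + 1/2 * d3 * A a c * (A a a + A c c - 2)"

definition smooth_activation :: "(real \<Rightarrow> real) \<Rightarrow> bool" where
  "smooth_activation \<phi> \<longleftrightarrow>
     (\<forall>k<4. \<forall>t. (((deriv ^^ k) \<phi>) has_real_derivative ((deriv ^^ Suc k) \<phi> t)) (at t))
     \<and> continuous_on UNIV ((deriv ^^ 4) \<phi>)
     \<and> \<phi> 0 = 0 \<and> deriv \<phi> 0 = 1
     \<and> (\<exists>C. \<forall>t. \<bar>(deriv ^^ 4) \<phi> t\<bar> \<le> C * (1 + \<bar>t\<bar> powr C))
     \<and> 3/4 * ((deriv ^^ 2) \<phi> 0)^2 + (deriv ^^ 3) \<phi> 0 \<le> 0"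

definition admissible_drift :: "(('i::finite) mat \<Rightarrow> 'i mat) \<Rightarrow> bool" where
  "admissible_drift b \<longleftrightarrow>
     (\<exists>cp cm. b = relu_drift cp cm) \<or>
     (\<exists>\<phi>. smooth_activation \<phi> \<and> b = smooth_drift ((deriv ^^ 2) \<phi> 0) ((deriv ^^ 3) \<phi> 0))"

definition is_filtration :: "'a measure \<Rightarrow> (real \<Rightarrow> 'a measure) \<Rightarrow> bool" where
  "is_filtration M F \<longleftrightarrow> (\<forall>t. subalgebra M (F t)) \<and>
     (\<forall>s t. s \<le> t \<longrightarrow> sets (F s) \<subseteq> sets (F t))"

definition brownian_matrix ::
  "'a measure \<Rightarrow> (real \<Rightarrow> 'a measure) \<Rightarrow> (real \<Rightarrow> 'a \<Rightarrow> ('i::finite) mat) \<Rightarrow> bool" where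
  "brownian_matrix M F Bt \<longleftrightarrow>
     (\<forall>w\<in>space M. Bt 0 w = (\<lambda>a c. 0) \<and>
        (\<forall>a c. continuous_on {0..} (\<lambda>t. Bt t w a c)))
   \<and> (\<forall>t\<ge>0. \<forall>a c. (\<lambda>w. Bt t w a c) \<in> borel_measurable (F t))
   \<and> (\<forall>s t. 0 \<le> s \<and> s < t \<longrightarrow>
        (\<forall>a c. distributed M lborel (\<lambda>w. Bt t w a c - Bt s w a c)
                  (normal_density 0 (sqrt (t - s))))
      \<and> prob_space.indep_sets M
          (\<lambda>k. case k of None \<Rightarrow> sets (F s)
                | Some (a, c) \<Rightarrow> {(\<lambda>w. Bt t w a c - Bt s w a c) -` A \<inter> space M | A. A \<in> sets borel})
          UNIV)"

definition sym_bm :: "(real \<Rightarrow> 'a \<Rightarrow> ('i::finite) mat) \<Rightarrow> real \<Rightarrow> 'a \<Rightarrow> 'i mat" where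
  "sym_bm Bt t w a c = (Bt t w a c + Bt t w c a) / sqrt 2"

definition ito_sum ::
  "(real \<Rightarrow> 'a \<Rightarrow> ('i::finite) mat) \<Rightarrow> (real \<Rightarrow> 'a \<Rightarrow> 'i mat) \<Rightarrow> nat \<Rightarrow> real \<Rightarrow> 'a \<Rightarrow> 'i mat" where
  "ito_sum \<Phi> Bt n t w a c =
    (\<Sum>k<2^n. let tk = real k * t / 2^n; tk' = real (Suc k) * t / 2^n;
                  R = psd_sqrt (\<Phi> tk w) in
       \<Sum>i\<in>UNIV. \<Sum>j\<in>UNIV. R a i * (sym_bm Bt tk' w i j - sym_bm Bt tk w i j) * R j c)"

text \<open>Strong solution of
  d Phi = c_act b(Phi) dtau + P^{-1/2} Phi^{1/2} dB Phi^{1/2},  Phi_0 given,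
  with P = CARD('p).  The Ito integral of the continuous adapted integrand is
  the limit in probability of left-point Riemann sums along dyadic partitions.\<close>
definition ncsde_solution ::
  "'a measure \<Rightarrow> (real \<Rightarrow> 'a measure) \<Rightarrow> (real \<Rightarrow> 'a \<Rightarrow> ('i::finite) mat) \<Rightarrow> real \<Rightarrow> real
    \<Rightarrow> ('i mat \<Rightarrow> 'i mat) \<Rightarrow> 'i mat \<Rightarrow> (real \<Rightarrow> 'a \<Rightarrow> 'i mat) \<Rightarrow> bool" where
  "ncsde_solution M F Bt P cact b \<Phi>0 \<Phi> \<longleftrightarrow>
     (\<forall>w\<in>space M. \<Phi> 0 w = \<Phi>0 \<and> (\<forall>t\<ge>0. psd (\<Phi> t w)) \<and>
        (\<forall>a c. continuous_on {0..} (\<lambda>t. \<Phi> t w a c)) \<and>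
        (\<forall>t\<ge>0. \<forall>a c. (\<lambda>s. b (\<Phi> s w) a c) integrable_on {0..t}))
   \<and> (\<forall>t\<ge>0. \<forall>a c. (\<lambda>w. \<Phi> t w a c) \<in> borel_measurable (F t))
   \<and> (\<forall>t\<ge>0. \<forall>a c. (\<lambda>w. integral {0..t} (\<lambda>s. b (\<Phi> s w) a c)) \<in> borel_measurable M)
   \<and> (\<forall>t\<ge>0. \<forall>a c. \<forall>\<epsilon>>0.
        (\<lambda>n. measure M {w\<in>space M.
            \<bar>ito_sum \<Phi> Bt n t w a c
              - sqrt P * (\<Phi> t w a c - \<Phi>0 a c - cact * integral {0..t} (\<lambda>s. b (\<Phi> s w) a c))\<bar>
            > \<epsilon>}) \<longlonglongrightarrow> 0)"

definition Zfun ::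
  "'a measure \<Rightarrow> (real \<Rightarrow> 'a \<Rightarrow> ('p::finite option) mat) \<Rightarrow> real \<Rightarrow> real^'p \<Rightarrow> real \<Rightarrow> real \<Rightarrow> complex" where
  "Zfun M \<Phi> \<beta> Y \<kappa> \<tau> =
     (LINT p|lborel.
        exp (complex_of_real (- (p \<bullet> p) / (2*\<beta>)) + \<i> * complex_of_real (p \<bullet> Y))
        * complex_of_real (LINT w|M. exp (- quad (vvec p \<kappa>) (\<Phi> \<tau> w) / 2)))"

definition gavg ::
  "(real^'p \<Rightarrow> complex) \<Rightarrow> ('p::finite option) mat \<Rightarrow> real \<Rightarrow> real^'p \<Rightarrow> real \<Rightarrow> complex" where
  "gavg g \<Phi>0 \<beta> Y \<kappa> =
     (let W = (\<lambda>p. exp (complex_of_real (- (p \<bullet> p) / (2*\<beta>)) + \<i> * complex_of_real (p \<bullet> Y)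
                        - complex_of_real (quad (vvec p \<kappa>) \<Phi>0 / 2)))
      in (LINT p|lborel. g p * W p) / (LINT p|lborel. W p))"

end

theory Submission
  imports Defs
begin

text \<open>For fixed \<open>p\<close> the functional \<open>exp (- quad v \<Phi> / 2)\<close> is bounded by one, so only its expectation up to
  \<open>o(\<tau>)\<close> matters and no Ito formula is needed. The discrete stochastic exponential of a predictable
  integrand against Gaussian increments has expectation exactly one. Applied to the Riemann
  sums that define the stochastic integral, truncated when \<open>\<Phi>\<close> leaves a \<open>\<delta>\<close>-ball around \<open>\<Phi>\<^sub>0\<close>, this identity
  yields exponential bounds for the exit probability and, through an exponential change of
  measure, the estimate \<open>exp (- quad v \<Phi>\<^sub>0 / 2) * exp (\<tau> * (rate v \<plusminus> \<zeta>))\<close> for the expectation,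
  with \<open>\<zeta>\<close> small as \<open>\<delta>\<close> is small. When \<open>\<tau> * |v|^4\<close> is not small, the trivial bound by one dominates
  the difference quotient by a quartic polynomial in \<open>p\<close>, and dominated convergence against the Gaussian
  weight finishes the proof.\<close>

section \<open>Square roots of positive semidefinite matrices\<close>

text \<open>The hypothesis on the stochastic integral is weak: at each fixed time the dyadic sums
  converge in probability, with no uniformity in time. Hence every probabilistic estimate is made
  for a finite sum at one dyadic level, and the equation is invoked at finitely many deterministic
  times before the level tends to infinity. The sums contain \<open>psd_sqrt\<close>, which is only
  a definite description; its continuity and measurability, also at singular matrices, come from a
  binomial series that converges absolutely even on the boundary of its disc. The exponent
  \<open>- quad v \<Phi> / 2\<close> has a martingale part with bracket (quad v \<Phi>)^2 / (2 P)
  per unit time; half of it is the term with 1 / (4 P) in the theorem. In the lower estimate the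
  tilted mass of a bad event must be controlled. A weighted square with weight \<tau>^2 does this at
  the cost of \<tau>^2 times the second moment of the stochastic exponential plus prob / \<tau>^2,
  up to constants; this is why exit probabilities are needed to order \<tau>^4. That Z does not
  vanish at time 0 needs its own argument, since its integrand is complex.\<close>

definition mmul :: "('i::finite) mat \<Rightarrow> 'i mat \<Rightarrow> 'i mat" where
  "mmul A B a c = (\<Sum>k\<in>UNIV. A a k * B k c)"

definition mid :: "'i mat" where
  "mid a c = (if a = c then 1 else 0)"

primrec mpow :: "('i::finite) mat \<Rightarrow> nat \<Rightarrow> 'i mat" where
  "mpow B 0 = mid"
| "mpow B (Suc k) = mmul B (mpow B k)"

definition mvec :: "('i::finite) mat \<Rightarrow> ('i \<Rightarrow> real) \<Rightarrow> 'i \<Rightarrow> real" where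
  "mvec A u a = (\<Sum>c\<in>UNIV. A a c * u c)"

definition bil :: "('i::finite \<Rightarrow> real) \<Rightarrow> 'i mat \<Rightarrow> ('i \<Rightarrow> real) \<Rightarrow> real" where
  "bil u A v = (\<Sum>a\<in>UNIV. u a * mvec A v a)"

definition unit_at :: "'i \<Rightarrow> 'i \<Rightarrow> real" where
  "unit_at a c = (if c = a then 1 else 0)"

definition mtrace :: "('i::finite) mat \<Rightarrow> real" where
  "mtrace A = (\<Sum>a\<in>UNIV. A a a)"

section \<open>Quadratic forms and the Cauchy-Schwarz inequality\<close>

lemma quad_eq_bil: "quad u A = bil u A u"
  by (simp add: quad_def bil_def mvec_def sum_distrib_left mult.assoc)

lemma psd_sym: "psd A \<Longrightarrow> A a c = A c a"
  by (simp add: psd_def)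

lemma psd_quad_nonneg: "psd A \<Longrightarrow> 0 \<le> quad u A"
  by (simp add: psd_def)

lemma bil_sym: "psd A \<Longrightarrow> bil u A v = bil v A u"
proof -
  assume A: "psd A"
  have "bil u A v = (\<Sum>a\<in>UNIV. \<Sum>c\<in>UNIV. u a * (A a c * v c))"
    by (simp add: bil_def mvec_def sum_distrib_left)
  also have "\<dots> = (\<Sum>c\<in>UNIV. \<Sum>a\<in>UNIV. u a * (A a c * v c))"
    by (rule sum.swap)
  also have "\<dots> = (\<Sum>c\<in>UNIV. \<Sum>a\<in>UNIV. v c * (A c a * u a))"
    by (intro sum.cong refl) (use psd_sym[OF A] in \<open>simp add: mult_ac\<close>)
  finally show ?thesis
    by (simp add: bil_def mvec_def sum_distrib_left)
qed

lemma quad_add_scaled: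
  assumes "psd A"
  shows "quad (\<lambda>a. u a + s * v a) A = quad u A + 2 * s * bil u A v + s\<^sup>2 * quad v A"
proof -
  have "quad (\<lambda>a. u a + s * v a) A = bil u A u + s * bil u A v + s * bil v A u + s\<^sup>2 * bil v A v"
    unfolding quad_eq_bil bil_def mvec_def
    by (simp add: algebra_simps sum.distrib sum_distrib_left power2_eq_square)
  with bil_sym[OF assms, of v u] show ?thesis by (simp add: quad_eq_bil)
qed

text \<open>The form is nonnegative along the whole line u + s v. If \<open>quad v A\<close> is
  positive, the minimising s gives the inequality; if it vanishes, the form is affine in s and stays
  nonnegative only with zero slope.\<close>

lemma psd_cauchy_schwarz:
  assumes A: "psd A"
  shows "(bil u A v)\<^sup>2 \<le> quad u A * quad v A"
proof -
  let ?a = "quad v A" and ?b = "bil u A v" and ?c = "quad u A"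
  have ge: "0 \<le> ?c + 2 * s * ?b + s\<^sup>2 * ?a" for s
    using psd_quad_nonneg[OF A, of "\<lambda>a. u a + s * v a"] quad_add_scaled[OF A] by simp
  have nn: "0 \<le> ?a" "0 \<le> ?c" using psd_quad_nonneg[OF A] by auto
  show ?thesis
  proof (cases "?a = 0")
    case True
    have "?b = 0"
    proof (rule ccontr)
      assume "?b \<noteq> 0"
      \<comment> \<open>At this s the affine function takes the value -1.\<close>
      then show False using ge[of "-(?c + 1) / (2 * ?b)"] True by (simp add: field_simps)
    qed
    then show ?thesis using True by simp
  next
    case False
    then have "?a > 0" using nn by simp
    then show ?thesis using ge[of "- ?b / ?a"]
      by (simp add: field_simps power2_eq_square)
  qed
qed

lemma sum_unit_at [simp]: "(\<Sum>c\<in>UNIV. unit_at a c * f c) = f (a::'i::finite)"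
  "(\<Sum>c\<in>UNIV. f c * unit_at a c) = f (a::'i::finite)"
  by (simp_all add: unit_at_def if_distrib[of "\<lambda>x. x * _"] if_distrib[of "\<lambda>x. _ * x"] cong: if_cong)

lemma bil_unit_at: "bil (unit_at a) A v = mvec A v a"
  by (simp add: bil_def)

lemma mvec_unit_at: "mvec A (unit_at c) a = A a c"
  by (simp add: mvec_def)

lemma quad_unit_at: "quad (unit_at a) A = A a a"
  by (simp add: quad_eq_bil bil_unit_at mvec_unit_at)

lemma psd_diag_nonneg: "psd A \<Longrightarrow> 0 \<le> A a a"
  using psd_quad_nonneg[of A "unit_at a"] by (simp add: quad_unit_at)

lemma mtrace_nonneg: "psd A \<Longrightarrow> 0 \<le> mtrace A"
  by (simp add: mtrace_def psd_diag_nonneg sum_nonneg)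

lemma psd_offdiag: "psd A \<Longrightarrow> (A a c)\<^sup>2 \<le> A a a * A c c"
  using psd_cauchy_schwarz[of A "unit_at a" "unit_at c"]
  by (simp add: quad_unit_at bil_unit_at mvec_unit_at)

text \<open>Cauchy-Schwarz against each unit vector, summed over the rows. The trace replaces the
  largest eigenvalue and so avoids diagonalization.\<close>

lemma psd_mvec_le:
  assumes A: "psd A"
  shows "(\<Sum>a\<in>UNIV. (mvec A u a)\<^sup>2) \<le> mtrace A * quad u A"
proof -
  have "(mvec A u a)\<^sup>2 \<le> A a a * quad u A" for a
    using psd_cauchy_schwarz[OF A, of "unit_at a" u] by (simp add: bil_unit_at quad_unit_at)
  then have "(\<Sum>a\<in>UNIV. (mvec A u a)\<^sup>2) \<le> (\<Sum>a\<in>UNIV. A a a * quad u A)"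
    by (intro sum_mono)
  then show ?thesis by (simp add: mtrace_def sum_distrib_right)
qed

lemma mvec_mmul: "mvec (mmul A B) u = mvec A (mvec B u)"
proof
  fix a
  have "mvec (mmul A B) u a = (\<Sum>c\<in>UNIV. \<Sum>k\<in>UNIV. A a k * (B k c * u c))"
    by (simp add: mvec_def mmul_def sum_distrib_right mult.assoc)
  also have "\<dots> = (\<Sum>k\<in>UNIV. \<Sum>c\<in>UNIV. A a k * (B k c * u c))" by (rule sum.swap)
  finally show "mvec (mmul A B) u a = mvec A (mvec B u) a"
    by (simp add: mvec_def sum_distrib_left)
qed

lemma mat_eqI: "(\<And>u. mvec A u = mvec B u) \<Longrightarrow> A = B"
  by (intro ext) (metis mvec_unit_at)

lemma mmul_assoc: "mmul (mmul A B) C = mmul A (mmul B C)"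
  by (rule mat_eqI) (simp add: mvec_mmul)

lemma mvec_mid [simp]: "mvec mid u = u"
  by (rule ext) (simp add: mvec_def mid_def if_distrib[of "\<lambda>x. x * _"] cong: if_cong)

lemma mmul_mid [simp]: "mmul mid A = A" "mmul A mid = A"
  by (rule mat_eqI, simp add: mvec_mmul)+

lemma mpow_add: "mmul (mpow B k) (mpow B l) = mpow B (k + l)"
  by (induction k) (simp_all add: mmul_assoc)

lemma mpow_1 [simp]: "mpow B (Suc 0) = B"
  by simp

lemma mpow_sym:
  assumes "\<And>a c. B a c = B c a"
  shows "mpow B k a c = mpow B k c a"
proof (induction k arbitrary: a c)
  case 0
  then show ?case by (simp add: mid_def)
next
  case (Suc k)
  have "mpow B (Suc k) a c = mmul (mpow B k) B c a"
    by (simp add: mmul_def) (rule sum.cong, use assms Suc in \<open>auto simp: mult.commute\<close>)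
  also have "mmul (mpow B k) B = mpow B (Suc k)"
    using mpow_add[of B k 1] by simp
  finally show ?case .
qed

lemma mpow_contraction:
  assumes "\<And>u. (\<Sum>a\<in>UNIV. (mvec B u a)\<^sup>2) \<le> (\<Sum>a\<in>UNIV. (u a)\<^sup>2)"
  shows "(\<Sum>a\<in>UNIV. (mvec (mpow B k) u a)\<^sup>2) \<le> (\<Sum>a\<in>UNIV. (u a)\<^sup>2)"
  by (induction k) (use assms order_trans in \<open>auto simp: mvec_mmul\<close>)

lemma bil_mpow_le:
  assumes "\<And>u. (\<Sum>a\<in>UNIV. (mvec B u a)\<^sup>2) \<le> (\<Sum>a\<in>UNIV. (u a)\<^sup>2)"
  shows "\<bar>bil u (mpow B k) u\<bar> \<le> (\<Sum>a\<in>UNIV. (u a)\<^sup>2)"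
proof (rule abs_le_square_iff[THEN iffD2, of _ "\<Sum>a\<in>UNIV. (u a)\<^sup>2", simplified abs_of_nonneg[OF sum_nonneg[OF zero_le_power2]]])
  have "(bil u (mpow B k) u)\<^sup>2 \<le> (\<Sum>a\<in>UNIV. (u a)\<^sup>2) * (\<Sum>a\<in>UNIV. (mvec (mpow B k) u a)\<^sup>2)"
    unfolding bil_def by (rule Cauchy_Schwarz_ineq_sum)
  also have "\<dots> \<le> (\<Sum>a\<in>UNIV. (u a)\<^sup>2) * (\<Sum>a\<in>UNIV. (u a)\<^sup>2)"
    by (intro mult_left_mono mpow_contraction assms sum_nonneg) auto
  finally show "(bil u (mpow B k) u)\<^sup>2 \<le> (\<Sum>a\<in>UNIV. (u a)\<^sup>2)\<^sup>2" by (simp add: power2_eq_square)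
qed

lemma mpow_entry_le:
  assumes "\<And>u. (\<Sum>a\<in>UNIV. (mvec B u a)\<^sup>2) \<le> (\<Sum>a\<in>UNIV. (u a)\<^sup>2)"
  shows "\<bar>mpow B k a c\<bar> \<le> 1"
proof -
  have "(mpow B k a c)\<^sup>2 \<le> (\<Sum>a\<in>UNIV. (mvec (mpow B k) (unit_at c) a)\<^sup>2)"
    unfolding mvec_unit_at by (rule member_le_sum) auto
  also have "\<dots> \<le> (\<Sum>a\<in>UNIV. (unit_at c a)\<^sup>2)" by (rule mpow_contraction[OF assms])
  also have "\<dots> = 1" by (simp add: unit_at_def if_distrib[of "\<lambda>x. x^2"] cong: if_cong)
  finally show ?thesis by (simp add: abs_square_le_1)
qed

section \<open>Taylor coefficients of sqrt (1 - x) and their absolute summability\<close>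

definition sqrt_coeff :: "nat \<Rightarrow> real" where
  "sqrt_coeff k = (1/2 gchoose k) * (-1) ^ k"

lemma sqrt_coeff_0 [simp]: "sqrt_coeff 0 = 1"
  by (simp add: sqrt_coeff_def)

text \<open>The rising factorial behind the coefficient starts with the factor -1/2, and all later
  factors are positive.\<close>

lemma sqrt_coeff_nonpos: "sqrt_coeff (Suc k) \<le> 0"
proof -
  have "sqrt_coeff (Suc k) = pochhammer (-1/2) (Suc k) / fact (Suc k)"
    by (simp add: sqrt_coeff_def gbinomial_pochhammer flip: power_add power_mult_distrib)
  also have "pochhammer (-1/2::real) (Suc k) = -1/2 * pochhammer (1/2) k"
    by (simp add: pochhammer_rec)
  finally show ?thesis using pochhammer_nonneg[of "1/2::real" k]
    by (simp add: divide_nonpos_pos)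
qed

text \<open>Partial sums of the signed coefficients have a closed form that is nonnegative. Since
  only the leading 1 is positive, the others have total absolute value at most 1. This gives
  convergence for every contraction, including the boundary case of norm one that occurs when A is
  singular.\<close>

lemma sqrt_coeff_partial_sum:
  "(\<Sum>k<m. \<bar>sqrt_coeff (Suc k)\<bar>) \<le> 1"
proof -
  have "(\<Sum>k\<le>m. sqrt_coeff k) = (-1)^m * ((1/2 - 1) gchoose m)"
    unfolding sqrt_coeff_def by (rule gbinomial_sum_lower_neg)
  also have "\<dots> = pochhammer (1/2) m / fact m"
    by (simp add: gbinomial_pochhammer flip: power_add power_mult_distrib)
  also have "\<dots> \<ge> 0" using pochhammer_nonneg[of "1/2::real" m] by simp
  finally have "0 \<le> (\<Sum>k\<le>m. sqrt_coeff k)" .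
  also have "(\<Sum>k\<le>m. sqrt_coeff k) = 1 + (\<Sum>k<m. sqrt_coeff (Suc k))"
    by (simp add: sum.atMost_shift)
  also have "(\<Sum>k<m. sqrt_coeff (Suc k)) = - (\<Sum>k<m. \<bar>sqrt_coeff (Suc k)\<bar>)"
    by (simp add: sqrt_coeff_nonpos flip: sum_negf)
  finally show ?thesis by simp
qed

lemma sqrt_coeff_abs_summable_Suc: "summable (\<lambda>k. \<bar>sqrt_coeff (Suc k)\<bar>)"
  by (rule summableI_nonneg_bounded[where x=1]) (use sqrt_coeff_partial_sum in auto)

lemma sqrt_coeff_abs_suminf: "(\<Sum>k. \<bar>sqrt_coeff (Suc k)\<bar>) \<le> 1"
  by (rule suminf_le_const[OF sqrt_coeff_abs_summable_Suc]) (rule sqrt_coeff_partial_sum)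

lemma sqrt_coeff_abs_summable: "summable (\<lambda>k. \<bar>sqrt_coeff k\<bar>)"
  using sqrt_coeff_abs_summable_Suc by (rule summable_Suc_iff[THEN iffD1])

text \<open>Vandermonde with 1/2 + 1/2 = 1: the square of the power series of sqrt (1 - x) is 1 - x,
  coefficient by coefficient.\<close>

lemma sqrt_coeff_conv:
  "(\<Sum>k\<le>n. sqrt_coeff k * sqrt_coeff (n - k)) = (if n = 0 then 1 else if n = 1 then -1 else 0)"
proof -
  have "(\<Sum>k\<le>n. sqrt_coeff k * sqrt_coeff (n - k)) = (\<Sum>k\<le>n. (1/2 gchoose k) * (1/2 gchoose (n - k))) * (-1)^n"
    unfolding sum_distrib_right sqrt_coeff_def
  proof (intro sum.cong refl)
    fix k assume "k \<in> {..n}"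
    then have "(-1)^k * (-1)^(n-k) = ((-1)^n::real)" by (simp flip: power_add)
    then show "(1/2 gchoose k) * (-1) ^ k * ((1/2 gchoose (n - k)) * (-1) ^ (n - k))
       = (1/2 gchoose k) * (1/2 gchoose (n - k)) * (-1::real) ^ n"
      by (metis (no_types, lifting) mult.assoc mult.left_commute)
  qed
  also have "(\<Sum>k\<le>n. (1/2 gchoose k) * (1/2 gchoose (n - k))) = ((1/2 + 1/2 :: real) gchoose n)"
    using gbinomial_Vandermonde[of "1/2" "1/2" n] by (simp only: atMost_atLeast0)
  also have "((1/2 + 1/2 :: real) gchoose n) = of_nat (1 choose n)"
    by (simp add: binomial_gbinomial)
  finally show ?thesis by (cases n) (auto simp: binomial_eq_0)
qed

text \<open>The binomial series of the square root, applied to \<open>B = I - A / r\<close> with \<open>r = 1 + tr A\<close>: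
  then \<open>B\<close> is a contraction, and \<open>A = r (I - B)\<close>.\<close>

definition sqrt_rest :: "('i::finite) mat \<Rightarrow> 'i mat" where
  "sqrt_rest A a c = mid a c - A a c / (1 + mtrace A)"

definition sqrt_series :: "('i::finite) mat \<Rightarrow> 'i mat" where
  "sqrt_series A a c = sqrt (1 + mtrace A) * (\<Sum>k. sqrt_coeff k * mpow (sqrt_rest A) k a c)"

text \<open>Expanding, |B u|^2 = |u|^2 - 2 quad u A / r + |A u|^2 / r^2, and the last term is at
  most \<open>quad u A / r\<close> by \<open>psd_mvec_le\<close>. The summand 1 in r keeps the
  division meaningful for A = 0.\<close>

lemma sqrt_rest_contraction:
  assumes A: "psd A"
  shows "(\<Sum>a\<in>UNIV. (mvec (sqrt_rest A) u a)\<^sup>2) \<le> (\<Sum>a\<in>UNIV. (u a)\<^sup>2)"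
proof -
  define r where "r = 1 + mtrace A"
  have r: "r > 0" "mtrace A \<le> r" using mtrace_nonneg[OF A] by (auto simp: r_def)
  have m: "mvec (sqrt_rest A) u a = u a - mvec A u a / r" for a
    using fun_cong[OF mvec_mid[of u], of a] unfolding mvec_def sqrt_rest_def r_def[symmetric]
    by (simp add: left_diff_distrib sum_subtractf sum_divide_distrib)
  have "(\<Sum>a\<in>UNIV. (mvec (sqrt_rest A) u a)\<^sup>2)
     = (\<Sum>a\<in>UNIV. (u a)\<^sup>2 - 2 * (u a * mvec A u a) / r + (mvec A u a)\<^sup>2 / r\<^sup>2)"
    unfolding m by (intro sum.cong refl) (simp add: power2_diff power_divide)
  also have "\<dots> = (\<Sum>a\<in>UNIV. (u a)\<^sup>2) - 2 * quad u A / r + (\<Sum>a\<in>UNIV. (mvec A u a)\<^sup>2) / r\<^sup>2"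
    by (simp add: sum.distrib sum_subtractf quad_eq_bil bil_def sum_distrib_left sum_divide_distrib)
  also have "(\<Sum>a\<in>UNIV. (mvec A u a)\<^sup>2) / r\<^sup>2 \<le> r * quad u A / r\<^sup>2"
    using order_trans[OF psd_mvec_le[OF A, of u] mult_right_mono[OF r(2) psd_quad_nonneg[OF A]]] r
    by (intro divide_right_mono) auto
  also have "r * quad u A / r\<^sup>2 = quad u A / r" using r by (simp add: power2_eq_square)
  also have "(\<Sum>a\<in>UNIV. (u a)\<^sup>2) - 2 * quad u A / r + quad u A / r \<le> (\<Sum>a\<in>UNIV. (u a)\<^sup>2)"
    using psd_quad_nonneg[OF A, of u] r by (simp add: field_simps)
  finally show ?thesis by simp
qed

lemma sqrt_series_term_le:
  assumes "psd A"
  shows "norm (sqrt_coeff k * mpow (sqrt_rest A) k a c) \<le> \<bar>sqrt_coeff k\<bar>"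
  using mpow_entry_le[OF sqrt_rest_contraction[OF assms], of k a c]
  by (simp add: abs_mult mult_left_le)

lemma sqrt_series_summable_norm:
  assumes "psd A"
  shows "summable (\<lambda>k. norm (sqrt_coeff k * mpow (sqrt_rest A) k a c))"
  by (rule summable_comparison_test'[OF sqrt_coeff_abs_summable, of 0])
     (use sqrt_series_term_le[OF assms] in auto)

lemmas sqrt_series_summable = summable_norm_cancel[OF sqrt_series_summable_norm]

text \<open>Cauchy products are taken entry by entry; powers of B combine by
  \<open>mpow_add\<close>, so the convolution of the coefficients collapses the product to r (I - B)
  = A.\<close>

lemma sqrt_series_square:
  assumes A: "psd A"
  shows "mmul (sqrt_series A) (sqrt_series A) a c = A a c"
proof -
  define r where "r = 1 + mtrace A"
  have r: "r > 0" using mtrace_nonneg[OF A] by (auto simp: r_def)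
  let ?B = "sqrt_rest A"
  let ?f = "\<lambda>k a c. sqrt_coeff k * mpow ?B k a c"
  have "mmul (sqrt_series A) (sqrt_series A) a c = r * (\<Sum>e\<in>UNIV. (\<Sum>k. ?f k a e) * (\<Sum>k. ?f k e c))"
  proof -
    have "sqrt r * x * (sqrt r * y) = (sqrt r * sqrt r) * (x * y)" for x y
      by (simp only: mult_ac)
    then have "sqrt r * x * (sqrt r * y) = r * (x * y)" for x y
      using r by simp
    then show ?thesis
      by (simp only: mmul_def sqrt_series_def r_def[symmetric] sum_distrib_left)
  qed
  also have "(\<Sum>e\<in>UNIV. (\<Sum>k. ?f k a e) * (\<Sum>k. ?f k e c)) = (\<Sum>e\<in>UNIV. \<Sum>n. \<Sum>k\<le>n. ?f k a e * ?f (n - k) e c)"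
    by (intro sum.cong refl Cauchy_product sqrt_series_summable_norm[OF A])
  also have "\<dots> = (\<Sum>n. \<Sum>e\<in>UNIV. \<Sum>k\<le>n. ?f k a e * ?f (n - k) e c)"
    by (rule suminf_sum[symmetric]) (intro summable_Cauchy_product sqrt_series_summable_norm[OF A])
  also have "\<dots> = (\<Sum>n. (\<Sum>k\<le>n. sqrt_coeff k * sqrt_coeff (n - k)) * mpow ?B n a c)"
  proof (intro suminf_cong)
    fix n
    have "(\<Sum>e\<in>UNIV. \<Sum>k\<le>n. ?f k a e * ?f (n - k) e c) = (\<Sum>k\<le>n. \<Sum>e\<in>UNIV. ?f k a e * ?f (n - k) e c)"
      by (rule sum.swap)
    also have "\<dots> = (\<Sum>k\<le>n. sqrt_coeff k * sqrt_coeff (n - k) * mmul (mpow ?B k) (mpow ?B (n - k)) a c)"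
      by (intro sum.cong refl) (simp add: mmul_def sum_distrib_left mult_ac)
    also have "\<dots> = (\<Sum>k\<le>n. sqrt_coeff k * sqrt_coeff (n - k)) * mpow ?B n a c"
      unfolding sum_distrib_right by (intro sum.cong refl) (simp add: mpow_add)
    finally show "(\<Sum>e\<in>UNIV. \<Sum>k\<le>n. ?f k a e * ?f (n - k) e c)
        = (\<Sum>k\<le>n. sqrt_coeff k * sqrt_coeff (n - k)) * mpow ?B n a c" .
  qed
  also have "\<dots> = (\<Sum>n\<in>{0,1}. (\<Sum>k\<le>n. sqrt_coeff k * sqrt_coeff (n - k)) * mpow ?B n a c)"
    by (rule suminf_finite) (auto simp: sqrt_coeff_conv)
  also have "\<dots> = mid a c - ?B a c"
    by (subst (1) sqrt_coeff_conv) (simp add: sqrt_coeff_conv[of 1, simplified])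
  also have "\<dots> = A a c / r" by (simp add: sqrt_rest_def r_def)
  finally show ?thesis using r by simp
qed

text \<open>The constant term contributes |u|^2 to the form. The rest is at most |u|^2 in absolute
  value, because |u . B^k u| <= |u|^2 and the coefficients from k = 1 on have total absolute value
  at most 1.\<close>

lemma psd_sqrt_series:
  assumes A: "psd A"
  shows "psd (sqrt_series A)"
  unfolding psd_def
proof (intro conjI allI)
  let ?B = "sqrt_rest A"
  have sy: "mpow ?B k a c = mpow ?B k c a" for k a c
    by (rule mpow_sym) (use psd_sym[OF A] in \<open>simp add: sqrt_rest_def mid_def\<close>)
  show "sqrt_series A a c = sqrt_series A c a" for a c
    unfolding sqrt_series_def by (subst sy) simp
  fix u :: "'a \<Rightarrow> real"
  let ?f = "\<lambda>k a c. sqrt_coeff k * mpow ?B k a c"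
  let ?n = "\<Sum>a\<in>UNIV. (u a)\<^sup>2"
  have sm: "summable (\<lambda>k. \<Sum>a\<in>UNIV. \<Sum>c\<in>UNIV. u a * ?f k a c * u c)"
    by (intro summable_sum summable_mult summable_mult2 sqrt_series_summable[OF A])
  have tm: "(\<Sum>a\<in>UNIV. \<Sum>c\<in>UNIV. u a * ?f k a c * u c) = sqrt_coeff k * bil u (mpow ?B k) u" for k
    by (simp add: bil_def mvec_def sum_distrib_left mult_ac)
  have "quad u (\<lambda>a c. \<Sum>k. ?f k a c) = (\<Sum>a\<in>UNIV. \<Sum>c\<in>UNIV. \<Sum>k. u a * ?f k a c * u c)"
    unfolding quad_def
    by (simp only: suminf_mult[OF sqrt_series_summable[OF A]]
        suminf_mult2[OF summable_mult[OF sqrt_series_summable[OF A]], symmetric])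
  also have "\<dots> = (\<Sum>k. \<Sum>a\<in>UNIV. \<Sum>c\<in>UNIV. u a * ?f k a c * u c)"
    by (subst suminf_sum, intro summable_sum summable_mult summable_mult2 sqrt_series_summable[OF A])
       (intro sum.cong refl suminf_sum[symmetric] summable_mult summable_mult2 sqrt_series_summable[OF A])
  also have "\<dots> = (\<Sum>k. sqrt_coeff k * bil u (mpow ?B k) u)" by (simp only: tm)
  also have "\<dots> = bil u mid u + (\<Sum>k. sqrt_coeff (Suc k) * bil u (mpow ?B (Suc k)) u)"
    using suminf_split_head[OF sm] unfolding tm by simp
  finally have q: "quad u (\<lambda>a c. \<Sum>k. ?f k a c) = ?n + (\<Sum>k. sqrt_coeff (Suc k) * bil u (mpow ?B (Suc k)) u)"
    by (simp add: bil_def power2_eq_square)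
  have sm': "summable (\<lambda>k. \<bar>sqrt_coeff (Suc k)\<bar> * ?n)"
    by (intro summable_mult2 sqrt_coeff_abs_summable_Suc)
  have "\<bar>\<Sum>k. sqrt_coeff (Suc k) * bil u (mpow ?B (Suc k)) u\<bar> \<le> (\<Sum>k. \<bar>sqrt_coeff (Suc k)\<bar> * ?n)"
  proof -
    have "norm (sqrt_coeff (Suc k) * bil u (mpow ?B (Suc k)) u) \<le> \<bar>sqrt_coeff (Suc k)\<bar> * ?n" for k
      unfolding real_norm_def abs_mult
      by (intro mult_left_mono bil_mpow_le sqrt_rest_contraction[OF A] abs_ge_zero)
    from norm_suminf_le[OF this sm'] show ?thesis by simp
  qed
  also have "\<dots> = (\<Sum>k. \<bar>sqrt_coeff (Suc k)\<bar>) * ?n"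
    by (rule suminf_mult2[symmetric]) (rule sqrt_coeff_abs_summable_Suc)
  also have "\<dots> \<le> 1 * ?n" by (intro mult_right_mono sqrt_coeff_abs_suminf sum_nonneg) auto
  finally have "0 \<le> quad u (\<lambda>a c. \<Sum>k. ?f k a c)" using q by linarith
  moreover have "quad u (sqrt_series A) = sqrt (1 + mtrace A) * quad u (\<lambda>a c. \<Sum>k. ?f k a c)"
    by (simp add: quad_def sqrt_series_def sum_distrib_left mult_ac)
  ultimately show "0 \<le> quad u (sqrt_series A)" using mtrace_nonneg[OF A] by simp
qed

section \<open>Uniqueness of the semidefinite square root\<close>

lemma psd_quad_zero_imp:
  assumes "psd A" "quad u A = 0"
  shows "mvec A u a = 0"
  using psd_cauchy_schwarz[OF assms(1), of "unit_at a" u] assms(2) by (simp add: bil_unit_at)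

text \<open>tr (X Y Z) as a triple sum, the form in which cyclicity is an exchange of sums.\<close>

definition tr3 :: "('i::finite) mat \<Rightarrow> 'i mat \<Rightarrow> 'i mat \<Rightarrow> real" where
  "tr3 X Y Z = (\<Sum>i\<in>UNIV. \<Sum>a\<in>UNIV. \<Sum>c\<in>UNIV. X i a * Y a c * Z c i)"

lemma tr3_cyc: "tr3 X Y Z = tr3 Y Z X"
proof -
  have "tr3 X Y Z = (\<Sum>a\<in>UNIV. \<Sum>i\<in>UNIV. \<Sum>c\<in>UNIV. X i a * Y a c * Z c i)"
    unfolding tr3_def by (rule sum.swap)
  also have "\<dots> = (\<Sum>a\<in>UNIV. \<Sum>c\<in>UNIV. \<Sum>i\<in>UNIV. X i a * Y a c * Z c i)"
    by (intro sum.cong refl sum.swap)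
  finally show ?thesis by (simp add: tr3_def mult_ac)
qed

lemma tr3_mmul: "tr3 X Y Z = (\<Sum>i\<in>UNIV. \<Sum>c\<in>UNIV. mmul X Y i c * Z c i)"
  unfolding tr3_def mmul_def sum_distrib_right by (intro sum.cong refl sum.swap)

text \<open>With \<open>D = R - S\<close>, cyclicity of the trace gives \<open>tr (D (R + S) D) = 0\<close> without any
  commutation assumption.\<close>

lemma psd_square_root_unique:
  assumes R: "psd R" and S: "psd S" and eq: "mmul R R = mmul S S"
  shows "R = S"
proof -
  define D where "D a c = R a c - S a c" for a c
  have Dsym: "D a c = D c a" for a c using psd_sym[OF R] psd_sym[OF S] by (simp add: D_def)
  have exp3: "tr3 D X D = tr3 R X R - tr3 R X S - tr3 S X R + tr3 S X S" for X
    by (simp add: tr3_def D_def algebra_simps sum.distrib sum_subtractf)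
  have sq: "tr3 R R X = tr3 S S X" for X by (simp add: tr3_mmul eq)
  have e1: "tr3 R R S = tr3 S S S" "tr3 R R R = tr3 S S R" by (rule sq)+
  have e2: "tr3 R S R = tr3 R R S" "tr3 S R R = tr3 R R S" "tr3 S R S = tr3 S S R" "tr3 R S S = tr3 S S R"
    using tr3_cyc by metis+
  have "tr3 D R D + tr3 D S D = 0"
    unfolding exp3 using e1 e2 by simp
  moreover have q: "tr3 D X D = (\<Sum>i\<in>UNIV. quad (\<lambda>a. D a i) X)" for X
    by (simp add: tr3_def quad_def Dsym)
  moreover have "0 \<le> tr3 D R D" "0 \<le> tr3 D S D"
    unfolding q by (intro sum_nonneg psd_quad_nonneg R S)+
  ultimately have "tr3 D R D = 0" "tr3 D S D = 0"
    by linarith+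
  then have z: "quad (\<lambda>a. D a i) R = 0" "quad (\<lambda>a. D a i) S = 0" for i
    by (auto simp: q sum_nonneg_eq_0_iff psd_quad_nonneg R S)
  \<comment> \<open>Both R and S annihilate every column of D, so D D = 0; as D is symmetric, the
    diagonal of D D consists of the squared lengths of the columns.\<close>
  have "D a i = 0" for a i
  proof -
    have "mvec R (\<lambda>a. D a i) i = 0" "mvec S (\<lambda>a. D a i) i = 0"
      using psd_quad_zero_imp z R S by blast+
    moreover have "mvec D y i = mvec R y i - mvec S y i" for y
      by (simp add: mvec_def D_def left_diff_distrib sum_subtractf)
    ultimately have "mvec D (\<lambda>a. D a i) i = 0" by simp
    then have "(\<Sum>c\<in>UNIV. (D c i)\<^sup>2) = 0"
      by (simp add: mvec_def power2_eq_square Dsym)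
    then show ?thesis by (simp add: sum_nonneg_eq_0_iff)
  qed
  then show ?thesis by (simp add: D_def fun_eq_iff)
qed

lemma psd_sqrt_eq_series:
  assumes "psd A"
  shows "psd_sqrt A = sqrt_series A"
  unfolding psd_sqrt_def
proof (rule the_equality)
  show "psd (sqrt_series A) \<and> (\<forall>a c. (\<Sum>k\<in>UNIV. sqrt_series A a k * sqrt_series A k c) = A a c)"
    using psd_sqrt_series[OF assms] sqrt_series_square[OF assms] by (simp add: mmul_def)
  fix R assume "psd R \<and> (\<forall>a c. (\<Sum>k\<in>UNIV. R a k * R k c) = A a c)"
  then have "psd R" "mmul R R = mmul (sqrt_series A) (sqrt_series A)"
    using sqrt_series_square[OF assms] by (auto simp: fun_eq_iff mmul_def)
  then show "R = sqrt_series A" using psd_square_root_unique psd_sqrt_series[OF assms] by blast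
qed

section \<open>Size and regularity of the square root\<close>

lemma psd_psd_sqrt: "psd A \<Longrightarrow> psd (psd_sqrt A)"
  by (simp add: psd_sqrt_eq_series psd_sqrt_series)

lemma psd_sqrt_square: "psd A \<Longrightarrow> mmul (psd_sqrt A) (psd_sqrt A) = A"
  by (simp add: psd_sqrt_eq_series sqrt_series_square fun_eq_iff)

text \<open>One factor R moves across the form by symmetry. This identity removes the root from the
  quadratic variation and leaves a function of \<Phi> alone.\<close>

lemma sum_mvec_sqrt_sq:
  assumes "psd A"
  shows "(\<Sum>i\<in>UNIV. (mvec (psd_sqrt A) v i)\<^sup>2) = quad v A"
proof -
  let ?R = "psd_sqrt A"
  have "quad v A = (\<Sum>a\<in>UNIV. v a * mvec ?R (mvec ?R v) a)"
    by (simp add: quad_eq_bil bil_def psd_sqrt_square[OF assms] flip: mvec_mmul)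
  also have "\<dots> = bil v ?R (mvec ?R v)" by (simp add: bil_def)
  also have "\<dots> = bil (mvec ?R v) ?R v" by (rule bil_sym[OF psd_psd_sqrt[OF assms]])
  finally show ?thesis by (simp add: bil_def power2_eq_square)
qed

lemma psd_sqrt_entry_le:
  assumes "psd A"
  shows "(psd_sqrt A a c)\<^sup>2 \<le> A c c"
proof -
  have "(psd_sqrt A a c)\<^sup>2 \<le> (\<Sum>i\<in>UNIV. (mvec (psd_sqrt A) (unit_at c) i)\<^sup>2)"
    unfolding mvec_unit_at by (rule member_le_sum) auto
  then show ?thesis by (simp add: sum_mvec_sqrt_sq[OF assms] quad_unit_at)
qed

lemma continuous_on_mpow:
  assumes "\<And>a c. continuous_on S (\<lambda>s. B s a c)"
  shows "continuous_on S (\<lambda>s. mpow (B s) k a c)"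
  by (induction k arbitrary: a c) (auto simp: mmul_def intro!: continuous_intros assms)

lemma measurable_mpow:
  assumes "\<And>a c. (\<lambda>s. B s a c) \<in> borel_measurable N"
  shows "(\<lambda>s. mpow (B s) k a c) \<in> borel_measurable N"
  by (induction k arbitrary: a c) (auto simp: mmul_def intro!: borel_measurable_sum borel_measurable_times assms)

text \<open>The k-th term of the series is dominated by \<open>\<bar>sqrt_coeff k\<bar>\<close>
  uniformly over semidefinite A, so the Weierstrass test gives continuity on the whole cone,
  including singular matrices, where the root is not Lipschitz.\<close>

lemma continuous_on_psd_sqrt:
  assumes psd: "\<And>s. s \<in> S \<Longrightarrow> psd (A s)" and cont: "\<And>a c. continuous_on S (\<lambda>s. A s a c)"
  shows "continuous_on S (\<lambda>s. psd_sqrt (A s) a c)"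
proof -
  have tr: "continuous_on S (\<lambda>s. mtrace (A s))"
    unfolding mtrace_def by (intro continuous_intros cont)
  have rest: "continuous_on S (\<lambda>s. sqrt_rest (A s) a c)" for a c
    unfolding sqrt_rest_def
  proof (intro continuous_intros cont tr)
    show "\<forall>s\<in>S. 1 + mtrace (A s) \<noteq> 0" using mtrace_nonneg[OF psd] by (fastforce simp: add_nonneg_eq_0_iff)
  qed
  have "continuous_on S (\<lambda>s. \<Sum>k. sqrt_coeff k * mpow (sqrt_rest (A s)) k a c)"
  proof (rule uniform_limit_theorem[OF _ Weierstrass_m_test[OF _ sqrt_coeff_abs_summable]])
    show "\<forall>\<^sub>F n in sequentially. continuous_on S (\<lambda>s. \<Sum>k<n. sqrt_coeff k * mpow (sqrt_rest (A s)) k a c)"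
      by (intro always_eventually allI continuous_intros continuous_on_mpow rest)
  qed (use sqrt_series_term_le[OF psd] in auto)
  then have "continuous_on S (\<lambda>s. sqrt_series (A s) a c)"
    unfolding sqrt_series_def by (intro continuous_intros tr)
  then show ?thesis by (simp add: psd_sqrt_eq_series psd cong: continuous_on_cong)
qed

lemma measurable_psd_sqrt:
  assumes psd: "\<And>s. s \<in> space N \<Longrightarrow> psd (A s)" and meas: "\<And>a c. (\<lambda>s. A s a c) \<in> borel_measurable N"
  shows "(\<lambda>s. psd_sqrt (A s) a c) \<in> borel_measurable N"
proof -
  have tr: "(\<lambda>s. mtrace (A s)) \<in> borel_measurable N"
    unfolding mtrace_def by (intro borel_measurable_sum meas)
  have rest: "(\<lambda>s. sqrt_rest (A s) a c) \<in> borel_measurable N" for a c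
    unfolding sqrt_rest_def using tr meas by measurable
  have "(\<lambda>s. sqrt (1 + mtrace (A s))) \<in> borel_measurable N"
    using tr by measurable
  then have "(\<lambda>s. sqrt_series (A s) a c) \<in> borel_measurable N"
    unfolding sqrt_series_def using measurable_mpow[of "\<lambda>s. sqrt_rest (A s)", OF rest]
    by (intro borel_measurable_times borel_measurable_suminf borel_measurable_const)
  then show ?thesis by (simp add: psd_sqrt_eq_series psd cong: measurable_cong)
qed

section \<open>The discrete exponential martingale\<close>

text \<open>Completing the square: the exponential factor turns the centred normal density into the
  one with mean \<sigma>^2 c.\<close>

lemma nn_integral_gaussian_exp:
  assumes "\<sigma> > 0"
  shows "(\<integral>\<^sup>+y. ennreal (normal_density 0 \<sigma> y) * ennreal (exp (c * y - \<sigma>\<^sup>2 * c\<^sup>2 / 2)) \<partial>lborel) = 1"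
proof -
  have "normal_density 0 \<sigma> y * exp (c * y - \<sigma>\<^sup>2 * c\<^sup>2 / 2) = normal_density (\<sigma>\<^sup>2 * c) \<sigma> y" for y
  proof -
    have "- y\<^sup>2 / (2 * \<sigma>\<^sup>2) + (c * y - \<sigma>\<^sup>2 * c\<^sup>2 / 2) = - (y - \<sigma>\<^sup>2 * c)\<^sup>2 / (2 * \<sigma>\<^sup>2)"
      using assms by (simp add: field_simps power2_eq_square)
    then show ?thesis by (simp add: normal_density_def flip: exp_add)
  qed
  then have "(\<integral>\<^sup>+y. ennreal (normal_density 0 \<sigma> y) * ennreal (exp (c * y - \<sigma>\<^sup>2 * c\<^sup>2 / 2)) \<partial>lborel)
     = (\<integral>\<^sup>+y. ennreal (normal_density (\<sigma>\<^sup>2 * c) \<sigma> y) \<partial>lborel)"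
    by (simp flip: ennreal_mult)
  also have "\<dots> = emeasure (density lborel (normal_density (\<sigma>\<^sup>2 * c) \<sigma>)) (space lborel)"
    by (simp add: emeasure_density)
  also have "\<dots> = 1"
    using prob_space.emeasure_space_1[OF prob_space_normal_density[OF assms]] by simp
  finally show ?thesis .
qed

locale brownian_space = prob_space M for M :: "'a measure" +
  fixes F :: "real \<Rightarrow> 'a measure" and Bt :: "real \<Rightarrow> 'a \<Rightarrow> ('i::finite) mat"
  assumes filt: "is_filtration M F" and bm: "brownian_matrix M F Bt"
begin

section \<open>Brownian increments and their independence from the past\<close>

definition incr :: "real \<Rightarrow> real \<Rightarrow> 'i \<times> 'i \<Rightarrow> 'a \<Rightarrow> real" where
  "incr s t e w = Bt t w (fst e) (snd e) - Bt s w (fst e) (snd e)"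

lemma space_F [simp]: "space (F t) = space M"
  using filt by (simp add: is_filtration_def subalgebra_def)

lemma F_measurable_mono:
  assumes "s \<le> t" "f \<in> measurable (F s) N"
  shows "f \<in> measurable (F t) N"
  using assms filt by (intro measurable_from_subalg[OF _ assms(2)]) (simp add: is_filtration_def subalgebra_def)

lemma F_measurable_M:
  assumes "f \<in> measurable (F s) N"
  shows "f \<in> measurable M N"
  using assms filt by (intro measurable_from_subalg[OF _ assms]) (simp add: is_filtration_def)

lemma incr_F_measurable:
  assumes "0 \<le> s" "s \<le> t"
  shows "incr s t e \<in> borel_measurable (F t)"
proof -
  have "(\<lambda>w. Bt r w a c) \<in> borel_measurable (F r)" if "0 \<le> r" for r a c
    using bm that by (simp add: brownian_matrix_def)
  then show ?thesis
    unfolding incr_def using assms by (intro borel_measurable_diff) (auto intro: F_measurable_mono)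
qed

lemma incr_measurable:
  "0 \<le> s \<Longrightarrow> s \<le> t \<Longrightarrow> incr s t e \<in> borel_measurable M"
  by (rule F_measurable_M[OF incr_F_measurable])

lemma incr_distributed:
  assumes "0 \<le> s" "s < t"
  shows "distributed M lborel (incr s t e) (normal_density 0 (sqrt (t - s)))"
  using bm assms unfolding incr_def by (simp add: brownian_matrix_def)

lemma incr_indep_sets:
  assumes "0 \<le> s" "s < t"
  shows "indep_sets (\<lambda>k. case k of None \<Rightarrow> sets (F s)
            | Some e \<Rightarrow> {incr s t e -` A \<inter> space M | A. A \<in> sets borel}) UNIV"
proof -
  have "indep_sets (\<lambda>k. case k of None \<Rightarrow> sets (F s)
                | Some (a, c) \<Rightarrow> {(\<lambda>w. Bt t w a c - Bt s w a c) -` A \<inter> space M | A. A \<in> sets borel}) UNIV"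
    using bm assms by (simp add: brownian_matrix_def)
  also have "(\<lambda>k. case k of None \<Rightarrow> sets (F s)
                | Some (a, c) \<Rightarrow> {(\<lambda>w. Bt t w a c - Bt s w a c) -` A \<inter> space M | A. A \<in> sets borel})
     = (\<lambda>k. case k of None \<Rightarrow> sets (F s)
            | Some e \<Rightarrow> {incr s t e -` A \<inter> space M | A. A \<in> sets borel})"
    by (auto simp: fun_eq_iff incr_def[abs_def] split: option.split)
  finally show ?thesis .
qed

lemma incr_indep_vars:
  assumes "0 \<le> s" "s < t"
  shows "indep_vars (\<lambda>_. borel) (incr s t) UNIV"
  unfolding indep_vars_def2
proof (intro conjI ballI)
  show "incr s t e \<in> borel_measurable M" for e
    using assms by (simp add: incr_measurable)
  have "indep_sets (\<lambda>k. case k of None \<Rightarrow> sets (F s)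
            | Some e \<Rightarrow> {incr s t e -` A \<inter> space M | A. A \<in> sets borel}) (Some ` UNIV)"
    by (rule indep_sets_mono_index[OF _ incr_indep_sets[OF assms]]) auto
  note ind = this
  show "indep_sets (\<lambda>e. {incr s t e -` A \<inter> space M |A. A \<in> sets borel}) UNIV"
    unfolding indep_sets_def
  proof (intro conjI ballI allI impI)
    show "{incr s t e -` A \<inter> space M |A. A \<in> sets borel} \<subseteq> events" for e
      using measurable_sets[OF incr_measurable[of s t e]] assms by auto
    fix J A assume J: "J \<noteq> {}" "finite J" and A: "A \<in> (\<Pi> e\<in>J. {incr s t e -` A \<inter> space M |A. A \<in> sets borel})"
    have "prob (\<Inter>k\<in>Some ` J. A (the k)) = (\<Prod>k\<in>Some ` J. prob (A (the k)))"
      using J A by (intro indep_setsD[OF ind]) auto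
    then show "prob (\<Inter> (A ` J)) = (\<Prod>e\<in>J. prob (A e))"
      by (simp add: prod.reindex)
  qed
qed

text \<open>The hypothesis lists the past and the single entries as one independent family; merging
  the entries into one sigma-algebra gives a product law for the pair (past, increment matrix). The
  first component is the identity map into \<open>F s\<close>, so every
  \<open>F s\<close>-measurable quantity can be treated by Fubini.\<close>

lemma incr_indep_past:
  assumes "0 \<le> s" "s < t"
  shows "distr M (F s) (\<lambda>w. w) \<Otimes>\<^sub>M distr M (\<Pi>\<^sub>M e\<in>UNIV. borel) (\<lambda>w e. incr s t e w)
       = distr M (F s \<Otimes>\<^sub>M (\<Pi>\<^sub>M e\<in>UNIV. borel)) (\<lambda>w. (w, \<lambda>e. incr s t e w))"
    and "(\<lambda>w. w) \<in> measurable M (F s)"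
    and "(\<lambda>w e. incr s t e w) \<in> measurable M (\<Pi>\<^sub>M e\<in>UNIV. borel)"
proof -
  let ?E = "\<lambda>k. case k of None \<Rightarrow> sets (F s)
            | Some e \<Rightarrow> {incr s t e -` A \<inter> space M | A. A \<in> sets borel}"
  \<comment> \<open>Two blocks of indices: the past alone, and all matrix entries together.\<close>
  let ?I = "case_bool {None} (range Some)"
  have Un: "(\<Union>j\<in>UNIV. ?I j) = (UNIV :: ('i \<times> 'i) option set)"
  proof -
    have "x \<in> (\<Union>j\<in>UNIV. ?I j)" for x :: "('i \<times> 'i) option"
      by (cases x) (auto simp: UNIV_bool)
    then show ?thesis by blast
  qed
  have "indep_sets (\<lambda>j. sigma_sets (space M) (\<Union>k\<in>?I j. ?E k)) UNIV"
  proof (rule indep_sets_collect_sigma)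
    show "indep_sets ?E (\<Union>j\<in>UNIV. ?I j)"
      unfolding Un by (rule incr_indep_sets[OF assms])
    show "Int_stable (?E k)" for k
    proof (cases k)
      case None
      then show ?thesis by (auto simp: Int_stable_def)
    next
      case (Some e)
      have "\<exists>C. incr s t e -` A \<inter> space M \<inter> (incr s t e -` B \<inter> space M) = incr s t e -` C \<inter> space M \<and> C \<in> sets borel"
        if "A \<in> sets borel" "B \<in> sets borel" for A B
        using that by (intro exI[of _ "A \<inter> B"]) auto
      then show ?thesis unfolding Some by (force simp: Int_stable_def)
    qed
    show "disjoint_family ?I" by (auto simp: disjoint_family_on_def split: bool.splits)
  qed
  then have ind: "indep_set (sigma_sets (space M) (sets (F s)))
      (sigma_sets (space M) (\<Union>e. {incr s t e -` A \<inter> space M | A. A \<in> sets borel}))"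
    unfolding indep_set_def
    by (rule back_subst[where P="\<lambda>f. indep_sets f UNIV"]) (auto simp: fun_eq_iff split: bool.split)
  let ?G = "\<Union>e. {incr s t e -` A \<inter> space M | A. A \<in> sets borel}"
  let ?T = "\<Pi>\<^sub>M e\<in>UNIV. borel :: real measure"
  have Y: "(\<lambda>w e. incr s t e w) \<in> measurable (sigma (space M) ?G) ?T"
  proof (rule measurable_PiM_single')
    fix e
    have "?G \<subseteq> Pow (space M)" by auto
    then show "incr s t e \<in> measurable (sigma (space M) ?G) borel"
      by (intro measurableI) (auto simp: space_measure_of sets_measure_of intro!: sigma_sets.Basic)
  qed auto
  show rv: "(\<lambda>w. w) \<in> measurable M (F s)"
    by (rule F_measurable_M) (rule measurable_ident_sets, simp)
  show rvY: "(\<lambda>w e. incr s t e w) \<in> measurable M ?T"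
    using assms by (intro measurable_PiM_single') (auto simp: incr_measurable)
  interpret X: prob_space "distr M (F s) (\<lambda>w. w)" by (rule prob_space_distr[OF rv])
  interpret Y: prob_space "distr M ?T (\<lambda>w e. incr s t e w)" by (rule prob_space_distr[OF rvY])
  show "distr M (F s) (\<lambda>w. w) \<Otimes>\<^sub>M distr M ?T (\<lambda>w e. incr s t e w)
       = distr M (F s \<Otimes>\<^sub>M ?T) (\<lambda>w. (w, \<lambda>e. incr s t e w))"
  proof (rule pair_measure_eqI)
    fix A B assume "A \<in> sets (distr M (F s) (\<lambda>w. w))" "B \<in> sets (distr M ?T (\<lambda>w e. incr s t e w))"
    then have A: "A \<in> sets (F s)" and B: "B \<in> sets ?T" by auto
    let ?B = "(\<lambda>w e. incr s t e w) -` B \<inter> space M"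
    have AM: "A \<subseteq> space M" using sets.sets_into_space[OF A] by simp
    have "?B \<in> sigma_sets (space M) ?G"
      using measurable_sets[OF Y B] by (subst (asm) sets_measure_of) (auto simp: space_measure_of_conv)
    then have "prob (A \<inter> ?B) = prob A * prob ?B"
      using indep_setD[OF ind] A by (blast intro: sigma_sets.Basic)
    moreover have "(\<lambda>w. (w, \<lambda>e. incr s t e w)) -` (A \<times> B) \<inter> space M = A \<inter> ?B" using AM by auto
    moreover have "(\<lambda>w. w) -` A \<inter> space M = A" using AM by auto
    ultimately show "emeasure (distr M (F s) (\<lambda>w. w)) A * emeasure (distr M ?T (\<lambda>w e. incr s t e w)) B
        = emeasure (distr M (F s \<Otimes>\<^sub>M ?T) (\<lambda>w. (w, \<lambda>e. incr s t e w))) (A \<times> B)"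
      using A B by (simp add: emeasure_distr[OF rv] emeasure_distr[OF rvY] emeasure_distr[OF measurable_Pair[OF rv rvY]]
          emeasure_eq_measure ennreal_mult)
  next
    show "sigma_finite_measure (distr M (F s) (\<lambda>w. w))" by (rule X.sigma_finite_measure_axioms)
    show "sigma_finite_measure (distr M ?T (\<lambda>w e. incr s t e w))" by (rule Y.sigma_finite_measure_axioms)
    show "sets (distr M (F s) (\<lambda>w. w) \<Otimes>\<^sub>M distr M ?T (\<lambda>w e. incr s t e w))
      = sets (distr M (F s \<Otimes>\<^sub>M ?T) (\<lambda>w. (w, \<lambda>e. incr s t e w)))"
      by (simp only: sets_distr sets_pair_measure_cong[OF sets_distr sets_distr])
  qed
qed

text \<open>Given the past, the coefficients are constants and the entries independent Gaussians, so
  each factor integrates to one by \<open>nn_integral_gaussian_exp\<close>. Nonnegative integrals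
  make this valid for unbounded predictable coefficients, with no integrability to check.\<close>

lemma nn_integral_exp_increment:
  fixes H :: "'i \<times> 'i \<Rightarrow> 'a \<Rightarrow> real" and Z :: "'a \<Rightarrow> ennreal"
  assumes st: "0 \<le> s" "s < t" and H: "\<And>e. H e \<in> borel_measurable (F s)"
    and Z: "Z \<in> borel_measurable (F s)"
  shows "(\<integral>\<^sup>+w. Z w * ennreal (exp (\<Sum>e\<in>UNIV. H e w * incr s t e w - (t - s) * (H e w)\<^sup>2 / 2)) \<partial>M) = (\<integral>\<^sup>+w. Z w \<partial>M)"
proof -
  let ?T = "\<Pi>\<^sub>M e\<in>UNIV. borel :: real measure"
  let ?Y = "\<lambda>w e. incr s t e w"
  let ?g = "\<lambda>w y. Z w * ennreal (exp (\<Sum>e\<in>UNIV. H e w * y e - (t - s) * (H e w)\<^sup>2 / 2))"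
  note rv = incr_indep_past(2,3)[OF st] and dist = incr_indep_past(1)[OF st]
  interpret PY: prob_space "distr M ?T ?Y" by (rule prob_space_distr[OF rv(2)])
  have [measurable]: "(\<lambda>z. H e (fst z)) \<in> borel_measurable (F s \<Otimes>\<^sub>M ?T)" for e
    by (rule measurable_compose[OF measurable_fst H])
  have [measurable]: "(\<lambda>z. Z (fst z)) \<in> borel_measurable (F s \<Otimes>\<^sub>M ?T)"
    by (rule measurable_compose[OF measurable_fst Z])
  have gm: "(\<lambda>z. ?g (fst z) (snd z)) \<in> borel_measurable (F s \<Otimes>\<^sub>M ?T)"
    by measurable
  have inner: "(\<integral>\<^sup>+y. ?g w y \<partial>distr M ?T ?Y) = Z w" for w
  proof -
    have "(\<integral>\<^sup>+y. ?g w y \<partial>distr M ?T ?Y) = (\<integral>\<^sup>+w'. ?g w (?Y w') \<partial>M)"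
      by (rule nn_integral_distr[OF rv(2)]) measurable
    also have "\<dots> = (\<integral>\<^sup>+w'. Z w * (\<Prod>e\<in>UNIV. ennreal (exp (H e w * incr s t e w' - (t - s) * (H e w)\<^sup>2 / 2))) \<partial>M)"
      by (simp add: exp_sum prod_ennreal)
    also have "\<dots> = Z w * (\<integral>\<^sup>+w'. (\<Prod>e\<in>UNIV. ennreal (exp (H e w * incr s t e w' - (t - s) * (H e w)\<^sup>2 / 2))) \<partial>M)"
    proof -
      have [measurable]: "incr s t e \<in> borel_measurable M" for e
        using st by (intro incr_measurable) auto
      show ?thesis by (intro nn_integral_cmult) measurable
    qed
    also have "(\<integral>\<^sup>+w'. (\<Prod>e\<in>UNIV. ennreal (exp (H e w * incr s t e w' - (t - s) * (H e w)\<^sup>2 / 2))) \<partial>M)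
       = (\<Prod>e\<in>UNIV. \<integral>\<^sup>+w'. ennreal (exp (H e w * incr s t e w' - (t - s) * (H e w)\<^sup>2 / 2)) \<partial>M)"
      by (intro indep_vars_nn_integral indep_vars_compose2[OF incr_indep_vars[OF st]]) auto
    also have "\<dots> = (\<Prod>e\<in>(UNIV :: ('i \<times> 'i) set). 1)"
    proof (intro prod.cong refl)
      fix e
      have "(\<integral>\<^sup>+w'. ennreal (exp (H e w * incr s t e w' - (t - s) * (H e w)\<^sup>2 / 2)) \<partial>M)
        = (\<integral>\<^sup>+y. ennreal (normal_density 0 (sqrt (t - s)) y) * ennreal (exp (H e w * y - (t - s) * (H e w)\<^sup>2 / 2)) \<partial>lborel)"
        by (rule distributed_nn_integral[OF incr_distributed[OF st], symmetric]) measurable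
      also have "\<dots> = 1"
        using nn_integral_gaussian_exp[of "sqrt (t - s)" "H e w"] st by simp
      finally show "(\<integral>\<^sup>+w'. ennreal (exp (H e w * incr s t e w' - (t - s) * (H e w)\<^sup>2 / 2)) \<partial>M) = 1" .
    qed
    finally show ?thesis by simp
  qed
  have "(\<integral>\<^sup>+w. ?g w (?Y w) \<partial>M) = (\<integral>\<^sup>+z. ?g (fst z) (snd z) \<partial>distr M (F s \<Otimes>\<^sub>M ?T) (\<lambda>w. (w, ?Y w)))"
    using gm by (subst nn_integral_distr[OF measurable_Pair[OF rv]]) auto
  also have "\<dots> = (\<integral>\<^sup>+z. ?g (fst z) (snd z) \<partial>(distr M (F s) (\<lambda>w. w) \<Otimes>\<^sub>M distr M ?T ?Y))"
    by (simp only: dist)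
  also have "\<dots> = (\<integral>\<^sup>+w. \<integral>\<^sup>+y. ?g w y \<partial>distr M ?T ?Y \<partial>distr M (F s) (\<lambda>w. w))"
    by (subst PY.nn_integral_fst[symmetric])
       (use gm in \<open>auto simp: cong: measurable_cong_sets sets_pair_measure_cong\<close>)
  also have "\<dots> = (\<integral>\<^sup>+w. Z w \<partial>distr M (F s) (\<lambda>w. w))" by (simp only: inner)
  also have "\<dots> = (\<integral>\<^sup>+w. Z w \<partial>M)" by (rule nn_integral_distr[OF rv(1)]) (use Z in simp)
  finally show ?thesis .
qed

section \<open>Discrete stochastic sums and their exponential inequalities\<close>

definition stoch_sum :: "(nat \<Rightarrow> real) \<Rightarrow> (nat \<Rightarrow> 'i \<times> 'i \<Rightarrow> 'a \<Rightarrow> real) \<Rightarrow> nat \<Rightarrow> 'a \<Rightarrow> real" where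
  "stoch_sum tt H n w = (\<Sum>k<n. \<Sum>e\<in>UNIV. H k e w * incr (tt k) (tt (Suc k)) e w)"

text \<open>The predictable bracket, with time steps in place of squared increments; with this
  choice the exponential is an exact discrete martingale.\<close>

definition stoch_qv :: "(nat \<Rightarrow> real) \<Rightarrow> (nat \<Rightarrow> 'i \<times> 'i \<Rightarrow> 'a \<Rightarrow> real) \<Rightarrow> nat \<Rightarrow> 'a \<Rightarrow> real" where
  "stoch_qv tt H n w = (\<Sum>k<n. \<Sum>e\<in>UNIV. (tt (Suc k) - tt k) * (H k e w)\<^sup>2)"

definition time_grid :: "(nat \<Rightarrow> real) \<Rightarrow> bool" where
  "time_grid tt \<longleftrightarrow> 0 \<le> tt 0 \<and> strict_mono tt"

definition predictable :: "(nat \<Rightarrow> real) \<Rightarrow> (nat \<Rightarrow> 'i \<times> 'i \<Rightarrow> 'a \<Rightarrow> real) \<Rightarrow> bool" where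
  "predictable tt H \<longleftrightarrow> (\<forall>k e. H k e \<in> borel_measurable (F (tt k)))"

lemma predictableD: "predictable tt H \<Longrightarrow> H k e \<in> borel_measurable (F (tt k))"
  unfolding predictable_def by blast

lemma predictableI: "(\<And>k e. H k e \<in> borel_measurable (F (tt k))) \<Longrightarrow> predictable tt H"
  unfolding predictable_def by blast

lemma time_grid_nonneg: "time_grid tt \<Longrightarrow> 0 \<le> tt k"
  unfolding time_grid_def by (metis less_eq_nat.simps(1) order_trans strict_mono_less_eq)

lemma time_grid_mono: "time_grid tt \<Longrightarrow> k \<le> l \<Longrightarrow> tt k \<le> tt l"
  unfolding time_grid_def by (simp add: strict_mono_less_eq)

lemma time_grid_less: "time_grid tt \<Longrightarrow> tt k < tt (Suc k)"
  unfolding time_grid_def by (simp add: strict_mono_less)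

lemma stoch_sum_measurable:
  assumes tt: "time_grid tt" and H: "predictable tt H" and "n \<le> m"
  shows "stoch_sum tt H n \<in> borel_measurable (F (tt m))"
  unfolding stoch_sum_def
proof (intro borel_measurable_sum borel_measurable_times)
  fix k e assume k: "k \<in> {..<n}"
  show "H k e \<in> borel_measurable (F (tt m))"
    using k assms(3) by (intro F_measurable_mono[OF time_grid_mono[OF tt, of k m] predictableD[OF H]]) auto
  show "incr (tt k) (tt (Suc k)) e \<in> borel_measurable (F (tt m))"
    using k assms(3) by (intro F_measurable_mono[OF time_grid_mono[OF tt, of "Suc k" m]] incr_F_measurable
      time_grid_nonneg[OF tt] less_imp_le[OF time_grid_less[OF tt]]) auto
qed

lemma stoch_qv_measurable:
  assumes tt: "time_grid tt" and H: "predictable tt H" and "n \<le> m"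
  shows "stoch_qv tt H n \<in> borel_measurable (F (tt m))"
  unfolding stoch_qv_def
proof (intro borel_measurable_sum borel_measurable_times borel_measurable_power borel_measurable_const)
  fix k e assume k: "k \<in> {..<n}"
  show "H k e \<in> borel_measurable (F (tt m))"
    using k assms(3) by (intro F_measurable_mono[OF time_grid_mono[OF tt, of k m] predictableD[OF H]]) auto
qed

text \<open>Induction on the number of cells: the exponential of the first n cells is known at the
  left end of cell n, so it can play the role of Z in
  \<open>nn_integral_exp_increment\<close>.\<close>

lemma exponential_martingale:
  assumes tt: "time_grid tt" and H: "predictable tt H"
  shows "(\<integral>\<^sup>+w. ennreal (exp (stoch_sum tt H n w - stoch_qv tt H n w / 2)) \<partial>M) = 1"
proof (induction n)
  case 0
  then show ?case by (simp add: stoch_sum_def stoch_qv_def emeasure_space_1)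
next
  case (Suc n)
  let ?X = "\<lambda>n w. stoch_sum tt H n w - stoch_qv tt H n w / 2"
  have m: "?X n \<in> borel_measurable (F (tt n))"
    using stoch_sum_measurable[OF tt H, of n n] stoch_qv_measurable[OF tt H, of n n] by simp
  have "?X (Suc n) w = ?X n w + (\<Sum>e\<in>UNIV. H n e w * incr (tt n) (tt (Suc n)) e w
      - (tt (Suc n) - tt n) * (H n e w)\<^sup>2 / 2)" for w
    by (simp add: stoch_sum_def stoch_qv_def sum_subtractf sum_divide_distrib add_divide_distrib)
  then have "(\<integral>\<^sup>+w. ennreal (exp (?X (Suc n) w)) \<partial>M) = (\<integral>\<^sup>+w. ennreal (exp (?X n w)) *
      ennreal (exp (\<Sum>e\<in>UNIV. H n e w * incr (tt n) (tt (Suc n)) e w - (tt (Suc n) - tt n) * (H n e w)\<^sup>2 / 2)) \<partial>M)"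
    by (simp add: exp_add ennreal_mult)
  also have "\<dots> = (\<integral>\<^sup>+w. ennreal (exp (?X n w)) \<partial>M)"
    using m by (intro nn_integral_exp_increment time_grid_nonneg[OF tt] time_grid_less[OF tt] predictableD[OF H]) simp
  finally show ?case using Suc by simp
qed

lemma stoch_sum_scale: "stoch_sum tt (\<lambda>k e w. c * H k e w) n w = c * stoch_sum tt H n w"
  by (simp add: stoch_sum_def sum_distrib_left mult_ac)

lemma stoch_qv_scale: "stoch_qv tt (\<lambda>k e w. c * H k e w) n w = c\<^sup>2 * stoch_qv tt H n w"
  by (simp add: stoch_qv_def sum_distrib_left power_mult_distrib mult_ac)

lemma predictable_scale: "predictable tt H \<Longrightarrow> predictable tt (\<lambda>k e w. c * H k e w)"
  by (rule predictableI, rule borel_measurable_times[OF borel_measurable_const predictableD])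

lemma stoch_sum_M_measurable:
  "time_grid tt \<Longrightarrow> predictable tt H \<Longrightarrow> stoch_sum tt H n \<in> borel_measurable M"
  by (rule F_measurable_M[OF stoch_sum_measurable[OF _ _ order_refl]])

lemma stoch_qv_M_measurable:
  "time_grid tt \<Longrightarrow> predictable tt H \<Longrightarrow> stoch_qv tt H n \<in> borel_measurable M"
  by (rule F_measurable_M[OF stoch_qv_measurable[OF _ _ order_refl]])

text \<open>Chernoff bound: on the event, the stochastic exponential with integrand l H is at least
  exp (l a - l^2 V / 2), and its expectation is 1.\<close>

lemma stoch_sum_tail:
  assumes tt: "time_grid tt" and H: "predictable tt H" and V: "\<And>w. w \<in> space M \<Longrightarrow> stoch_qv tt H n w \<le> V"
    and l: "0 \<le> l"
  shows "prob {w\<in>space M. a \<le> stoch_sum tt H n w} \<le> exp (- l * a + l\<^sup>2 * V / 2)"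
proof -
  note [measurable] = stoch_sum_M_measurable[OF tt H]
  let ?A = "{w\<in>space M. a \<le> stoch_sum tt H n w}"
  let ?lH = "\<lambda>k e w. l * H k e w"
  let ?X = "\<lambda>w. stoch_sum tt ?lH n w - stoch_qv tt ?lH n w / 2"
  have [measurable]: "?X \<in> borel_measurable M"
    using stoch_sum_M_measurable[OF tt predictable_scale[OF H]] stoch_qv_M_measurable[OF tt predictable_scale[OF H]] by simp
  have "emeasure M ?A = (\<integral>\<^sup>+w. indicator ?A w \<partial>M)" by simp
  also have "\<dots> \<le> (\<integral>\<^sup>+w. ennreal (exp (- l * a + l\<^sup>2 * V / 2)) * ennreal (exp (?X w)) \<partial>M)"
  proof (rule nn_integral_mono)
    fix w assume w: "w \<in> space M"
    show "indicator ?A w \<le> ennreal (exp (- l * a + l\<^sup>2 * V / 2)) * ennreal (exp (?X w))"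
    proof (cases "w \<in> ?A")
      case True
      have "0 \<le> l * (stoch_sum tt H n w - a) + l\<^sup>2 / 2 * (V - stoch_qv tt H n w)"
        using True V[OF w] l by (intro add_nonneg_nonneg mult_nonneg_nonneg) auto
      then have "0 \<le> - l * a + l\<^sup>2 * V / 2 + ?X w"
        by (simp add: stoch_sum_scale stoch_qv_scale field_simps)
      then have "1 \<le> exp (- l * a + l\<^sup>2 * V / 2) * exp (?X w)"
        by (simp flip: exp_add)
      then have "ennreal 1 \<le> ennreal (exp (- l * a + l\<^sup>2 * V / 2) * exp (?X w))"
        by (rule ennreal_leI)
      then show ?thesis using True by (simp add: ennreal_mult)
    qed simp
  qed
  also have "\<dots> = ennreal (exp (- l * a + l\<^sup>2 * V / 2))"
    by (subst nn_integral_cmult) (simp_all add: exponential_martingale[OF tt predictable_scale[OF H]])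
  finally show ?thesis by (simp add: emeasure_eq_measure)
qed

text \<open>Stopping at the first passage above \<open>a\<close> keeps the integrand predictable and turns the maximum
  into a terminal value.\<close>

lemma stoch_sum_maximal:
  assumes tt: "time_grid tt" and H: "predictable tt H" and V: "\<And>w. w \<in> space M \<Longrightarrow> stoch_qv tt H n w \<le> V"
    and l: "0 \<le> l"
  shows "prob {w\<in>space M. \<exists>m\<le>n. a \<le> stoch_sum tt H m w} \<le> exp (- l * a + l\<^sup>2 * V / 2)"
proof -
  \<comment> \<open>The test includes j = k: cell k is switched off once the value at its left end
    has reached a. So the increment that leads to the first passage is still counted, and
    \<open>K k e\<close> is measurable at time \<open>tt k\<close>.\<close>
  define K where "K k e w = (if \<forall>j\<in>{..k}. stoch_sum tt H j w < a then H k e w else 0)" for k e w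
  have K: "predictable tt K"
    unfolding predictable_def
  proof (intro allI)
    fix k e
    have "{w\<in>space (F (tt k)). stoch_sum tt H j w < a} \<in> sets (F (tt k))" if "j \<le> k" for j
      by (intro borel_measurable_less stoch_sum_measurable[OF tt H that] borel_measurable_const)
    then have "{w\<in>space (F (tt k)). \<forall>j\<in>{..k}. stoch_sum tt H j w < a} \<in> sets (F (tt k))"
      by (intro sets.sets_Collect_finite_All) auto
    then have "(\<lambda>w. if \<forall>j\<in>{..k}. stoch_sum tt H j w < a then H k e w else 0) \<in> borel_measurable (F (tt k))"
      by (intro measurable_If predictableD[OF H] borel_measurable_const)
    then show "K k e \<in> borel_measurable (F (tt k))"
      unfolding K_def[abs_def] .
  qed
  have "stoch_qv tt K n w \<le> stoch_qv tt H n w" for w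
    unfolding stoch_qv_def
    by (intro sum_mono mult_left_mono) (auto simp: K_def less_imp_le[OF time_grid_less[OF tt]])
  then have qv: "stoch_qv tt K n w \<le> V" if "w \<in> space M" for w
    using V[OF that] order_trans by blast
  have "{w\<in>space M. \<exists>m\<le>n. a \<le> stoch_sum tt H m w} \<subseteq> {w\<in>space M. a \<le> stoch_sum tt K n w}"
  proof safe
    fix w m assume m: "m \<le> n" "a \<le> stoch_sum tt H m w"
    define r where "r = (LEAST m. a \<le> stoch_sum tt H m w)"
    have r: "a \<le> stoch_sum tt H r w" unfolding r_def using m(2) by (rule LeastI)
    have "r \<le> m" unfolding r_def using m(2) by (rule Least_le)
    have below: "stoch_sum tt H j w < a" if "j < r" for j
      using not_less_Least[of j "\<lambda>m. a \<le> stoch_sum tt H m w"] that by (auto simp: r_def)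
    have "stoch_sum tt K n w = (\<Sum>k\<in>{..<r}. \<Sum>e\<in>UNIV. K k e w * incr (tt k) (tt (Suc k)) e w)"
      unfolding stoch_sum_def
    proof (rule sum.mono_neutral_right)
      show "\<forall>k\<in>{..<n} - {..<r}. (\<Sum>e\<in>UNIV. K k e w * incr (tt k) (tt (Suc k)) e w) = 0"
      proof
        fix k assume "k \<in> {..<n} - {..<r}"
        then have "\<not> (\<forall>j\<in>{..k}. stoch_sum tt H j w < a)" using r by (metis DiffE atMost_iff lessThan_iff not_less)
        then have "K k e w = 0" for e unfolding K_def by (rule if_not_P)
        then show "(\<Sum>e\<in>UNIV. K k e w * incr (tt k) (tt (Suc k)) e w) = 0"
          by simp
      qed
    qed (use \<open>r \<le> m\<close> m in auto)
    also have "\<dots> = stoch_sum tt H r w"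
      unfolding stoch_sum_def using below by (intro sum.cong refl) (auto simp: K_def)
    finally show "a \<le> stoch_sum tt K n w" using r by simp
  qed
  then have "prob {w\<in>space M. \<exists>m\<le>n. a \<le> stoch_sum tt H m w} \<le> prob {w\<in>space M. a \<le> stoch_sum tt K n w}"
    using stoch_sum_M_measurable[OF tt K] by (intro finite_measure_mono) measurable
  also have "\<dots> \<le> exp (- l * a + l\<^sup>2 * V / 2)"
    by (rule stoch_sum_tail[OF tt K qv l])
  finally show ?thesis .
qed

end

section \<open>Exit probabilities of the covariance process\<close>

text \<open>Dominated convergence for indicators. It turns pathwise continuity, whose modulus
  depends on w, into small probabilities.\<close>

lemma (in prob_space) prob_eventually_vanishing:
  assumes A: "\<And>n. A n \<in> events" and ev: "\<And>w. w \<in> space M \<Longrightarrow> \<forall>\<^sub>F n in sequentially. w \<notin> A n"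
  shows "(\<lambda>n. prob (A n)) \<longlonglongrightarrow> 0"
proof -
  have "(\<lambda>n. \<integral>w. indicator (A n) w \<partial>M) \<longlonglongrightarrow> (\<integral>w. 0 \<partial>M :: real)"
  proof (rule integral_dominated_convergence[where w="\<lambda>_. 1"])
    show "AE w in M. (\<lambda>n. indicator (A n) w :: real) \<longlonglongrightarrow> 0"
    proof (rule AE_I2)
      fix w assume "w \<in> space M"
      from ev[OF this] show "(\<lambda>n. indicator (A n) w :: real) \<longlonglongrightarrow> 0"
        by (rule tendsto_eventually[OF eventually_mono]) simp
    qed
  qed (use A in auto)
  then show ?thesis using A by simp
qed

lemma uniformly_continuous_on_interval:
  fixes f :: "real \<Rightarrow> real"
  assumes "continuous_on {0..} f" "\<rho> > 0"
  obtains d where "d > 0" "\<And>s s'. \<lbrakk>0 \<le> s; s \<le> t; 0 \<le> s'; s' \<le> t; \<bar>s - s'\<bar> < d\<rbrakk> \<Longrightarrow> \<bar>f s - f s'\<bar> < \<rho>"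
proof -
  have "uniformly_continuous_on {0..t} f"
    by (intro compact_uniformly_continuous continuous_on_subset[OF assms(1)]) auto
  from uniformly_continuous_onE[OF this assms(2)] obtain d where d: "d > 0"
    "\<And>x x'. \<lbrakk>x \<in> {0..t}; x' \<in> {0..t}; dist x' x < d\<rbrakk> \<Longrightarrow> dist (f x') (f x) < \<rho>" by metis
  show ?thesis
    by (rule that[OF d(1)]) (use d(2) in \<open>force simp: dist_real_def\<close>)
qed

section \<open>Dyadic grids\<close>

definition grid :: "real \<Rightarrow> nat \<Rightarrow> nat \<Rightarrow> real" where
  "grid t n k = real k * t / 2 ^ n"

lemma grid_0 [simp]: "grid t n 0 = 0" by (simp add: grid_def)

lemma grid_top [simp]: "grid t n (2 ^ n) = t" by (simp add: grid_def)

lemma grid_diff: "grid t n (Suc k) - grid t n k = t / 2 ^ n"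
  by (simp add: grid_def field_simps)

lemma grid_nonneg: "0 \<le> t \<Longrightarrow> 0 \<le> grid t n k" by (simp add: grid_def)

lemma grid_less_iff: "0 < t \<Longrightarrow> grid t n k < grid t n l \<longleftrightarrow> k < l"
  by (simp add: grid_def divide_less_cancel)

lemma grid_le_iff: "0 < t \<Longrightarrow> grid t n k \<le> grid t n l \<longleftrightarrow> k \<le> l"
  by (simp add: grid_def divide_le_cancel)

lemma grid_le: "0 < t \<Longrightarrow> k \<le> 2 ^ n \<Longrightarrow> grid t n k \<le> t"
  using grid_le_iff[of t n k "2 ^ n"] by simp

text \<open>This puts the approximating sums for all intermediate dyadic times on one common grid of
  [0, t].\<close>

lemma grid_grid: "grid (grid t m j) r k = grid t (m + r) (j * k)"
  by (simp add: grid_def power_add field_simps)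

lemma grid_refine: "grid t m j = grid t (m + r) (j * 2 ^ r)"
  by (simp add: grid_def power_add field_simps)

definition grid_index :: "real \<Rightarrow> nat \<Rightarrow> real \<Rightarrow> nat" where
  "grid_index t n s = nat \<lfloor>s * 2 ^ n / t\<rfloor>"

lemma grid_index:
  assumes "0 < t" "0 \<le> s"
  shows "grid t n (grid_index t n s) \<le> s" "s < grid t n (grid_index t n s) + t / 2 ^ n"
proof -
  have "0 \<le> s * 2 ^ n / t" using assms by simp
  then have r: "real (grid_index t n s) = of_int \<lfloor>s * 2 ^ n / t\<rfloor>" by (simp add: grid_index_def)
  have "real (grid_index t n s) \<le> s * 2 ^ n / t" "s * 2 ^ n / t < real (grid_index t n s) + 1"
    unfolding r by linarith+
  then show "grid t n (grid_index t n s) \<le> s" "s < grid t n (grid_index t n s) + t / 2 ^ n"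
    using assms by (simp_all add: grid_def field_simps)
qed

lemma grid_index_tendsto:
  assumes "0 < t" "0 \<le> s"
  shows "(\<lambda>n. grid t n (grid_index t n s)) \<longlonglongrightarrow> s"
proof (rule LIMSEQ_I)
  fix r :: real assume "r > 0"
  have "(\<lambda>n. t * (1/2) ^ n) \<longlonglongrightarrow> t * 0" by (intro tendsto_intros LIMSEQ_power_zero) simp
  then have "\<forall>\<^sub>F n in sequentially. t * (1/2) ^ n < r" using \<open>r > 0\<close> by (intro order_tendstoD) auto
  then obtain N where N: "\<And>n. n \<ge> N \<Longrightarrow> t * (1/2)^n < r" by (auto simp: eventually_sequentially)
  then show "\<exists>no. \<forall>n\<ge>no. norm (grid t n (grid_index t n s) - s) < r"
  proof (intro exI[of _ N] allI impI)
    fix n assume "N \<le> n"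
    then have "t / 2 ^ n < r" using N[of n] by (simp add: power_divide)
    then show "norm (grid t n (grid_index t n s) - s) < r"
      using grid_index[OF assms, of n] by simp
  qed
qed

lemma time_grid_grid: "0 < t \<Longrightarrow> brownian_space M F Bt \<Longrightarrow> brownian_space.time_grid (grid t n)"
  by (simp add: brownian_space.time_grid_def strict_mono_def grid_less_iff)

text \<open>Coefficients of the entry \<open>(a, c)\<close> of \<open>R dB R\<close> with respect to the entries of the
  unsymmetrized Brownian matrix.\<close>

definition sandwich_coeff :: "('i::finite) mat \<Rightarrow> 'i \<Rightarrow> 'i \<Rightarrow> 'i \<times> 'i \<Rightarrow> real" where
  "sandwich_coeff R a c e = (R a (fst e) * R (snd e) c + R a (snd e) * R (fst e) c) / sqrt 2"

lemma sandwich_coeff_sum: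
  "(\<Sum>i\<in>UNIV. \<Sum>j\<in>UNIV. R a i * ((X i j + X j i) / sqrt 2) * R j c)
    = (\<Sum>e\<in>UNIV. sandwich_coeff R a c e * X (fst e) (snd e))"
proof -
  have "(\<Sum>i\<in>UNIV. \<Sum>j\<in>UNIV. R a i * ((X i j + X j i) / sqrt 2) * R j c)
     = (\<Sum>i\<in>UNIV. \<Sum>j\<in>UNIV. R a i * X i j * R j c / sqrt 2) + (\<Sum>i\<in>UNIV. \<Sum>j\<in>UNIV. R a i * X j i * R j c / sqrt 2)"
    by (simp add: sum.distrib[symmetric] add_divide_distrib algebra_simps)
  also have "(\<Sum>i\<in>UNIV. \<Sum>j\<in>UNIV. R a i * X j i * R j c / sqrt 2) = (\<Sum>i\<in>UNIV. \<Sum>j\<in>UNIV. R a j * X i j * R i c / sqrt 2)"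
    by (rule sum.swap)
  finally have "(\<Sum>i\<in>UNIV. \<Sum>j\<in>UNIV. R a i * ((X i j + X j i) / sqrt 2) * R j c)
     = (\<Sum>i\<in>UNIV. \<Sum>j\<in>UNIV. sandwich_coeff R a c (i, j) * X i j)"
    by (simp add: sandwich_coeff_def sum.distrib[symmetric] add_divide_distrib algebra_simps)
  then show ?thesis by (simp add: sum.cartesian_product case_prod_beta)
qed

lemma sandwich_coeff_sq_le:
  assumes A: "psd A" and K: "\<And>c. A c c \<le> K"
  shows "(sandwich_coeff (psd_sqrt A) a c e)\<^sup>2 \<le> 2 * K\<^sup>2"
proof -
  have K0: "0 \<le> K" using K[of a] psd_diag_nonneg[OF A, of a] by simp
  have r: "\<bar>psd_sqrt A i j\<bar> \<le> sqrt K" for i j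
    using order_trans[OF psd_sqrt_entry_le[OF A, of i j] K[of j]] real_le_rsqrt by fastforce
  have p: "\<bar>psd_sqrt A i j * psd_sqrt A k l\<bar> \<le> K" for i j k l
    using mult_mono[OF r[of i j] r[of k l]] K0 by (simp add: abs_mult)
  have "\<bar>sandwich_coeff (psd_sqrt A) a c e\<bar> \<le> 2 * K / sqrt 2"
    unfolding sandwich_coeff_def abs_divide
    using p[of a "fst e" "snd e" c] p[of a "snd e" "fst e" c] by (intro divide_mono) auto
  then have "(sandwich_coeff (psd_sqrt A) a c e)\<^sup>2 \<le> (2 * K / sqrt 2)\<^sup>2"
    by (rule power2_le_iff_abs_le[THEN iffD2, rotated]) (use K0 in simp)
  then show ?thesis by (simp add: power_divide power_mult_distrib)
qed

text \<open>Beyond the equation, only continuity of the drift at \<Phi>0 among semidefinite matrices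
  is recorded: the argument takes place before \<Phi> leaves a small ball, so both drifts are
  treated alike.\<close>

locale covariance_sde = brownian_space M F Bt
  for M :: "'a measure" and F and Bt :: "real \<Rightarrow> 'a \<Rightarrow> ('i::finite) mat" +
  fixes P cact :: real and b :: "'i mat \<Rightarrow> 'i mat" and \<Phi>0 :: "'i mat" and \<Phi> :: "real \<Rightarrow> 'a \<Rightarrow> 'i mat"
  assumes sol: "ncsde_solution M F Bt P cact b \<Phi>0 \<Phi>"
    and P: "0 < P" and cact: "0 \<le> cact"
    and drift_continuous: "\<And>\<epsilon>. \<epsilon> > 0 \<Longrightarrow>
      \<exists>\<delta>>0. \<forall>A. psd A \<and> (\<forall>a c. \<bar>A a c - \<Phi>0 a c\<bar> \<le> \<delta>) \<longrightarrow> (\<forall>a c. \<bar>b A a c - b \<Phi>0 a c\<bar> \<le> \<epsilon>)"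
begin

definition near :: "real \<Rightarrow> 'i mat \<Rightarrow> bool" where
  "near \<delta> A \<longleftrightarrow> (\<forall>a c. \<bar>A a c - \<Phi>0 a c\<bar> \<le> \<delta>)"

lemma Phi_0: "w \<in> space M \<Longrightarrow> \<Phi> 0 w = \<Phi>0"
  and Phi_psd: "w \<in> space M \<Longrightarrow> 0 \<le> t \<Longrightarrow> psd (\<Phi> t w)"
  and Phi_continuous: "w \<in> space M \<Longrightarrow> continuous_on {0..} (\<lambda>t. \<Phi> t w a c)"
  and drift_integrable: "w \<in> space M \<Longrightarrow> 0 \<le> t \<Longrightarrow> (\<lambda>s. b (\<Phi> s w) a c) integrable_on {0..t}"
  and Phi_F_measurable: "0 \<le> t \<Longrightarrow> (\<lambda>w. \<Phi> t w a c) \<in> borel_measurable (F t)"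
  and drift_measurable: "0 \<le> t \<Longrightarrow> (\<lambda>w. integral {0..t} (\<lambda>s. b (\<Phi> s w) a c)) \<in> borel_measurable M"
  using sol unfolding ncsde_solution_def by blast+

text \<open>The defect of the equation, multiplied by \<open>sqrt P\<close>, at level n and one time
  t. The stochastic integral enters only through its convergence to zero in probability at fixed
  times.\<close>

definition ito_error :: "nat \<Rightarrow> real \<Rightarrow> 'i \<Rightarrow> 'i \<Rightarrow> 'a \<Rightarrow> real" where
  "ito_error n t a c w = ito_sum \<Phi> Bt n t w a c
     - sqrt P * (\<Phi> t w a c - \<Phi>0 a c - cact * integral {0..t} (\<lambda>s. b (\<Phi> s w) a c))"

lemma ito_error_tendsto:
  "0 \<le> t \<Longrightarrow> \<epsilon> > 0 \<Longrightarrow> (\<lambda>n. prob {w\<in>space M. \<epsilon> < \<bar>ito_error n t a c w\<bar>}) \<longlonglongrightarrow> 0"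
  using sol unfolding ncsde_solution_def ito_error_def by blast

lemma psd_Phi0: "psd \<Phi>0"
proof -
  obtain w where "w \<in> space M" using not_empty by blast
  then show ?thesis using Phi_psd[of w 0] Phi_0 by simp
qed

lemma Phi_measurable_later:
  assumes "0 \<le> s" "s \<le> t"
  shows "(\<lambda>w. \<Phi> s w a c) \<in> borel_measurable (F t)"
  by (rule F_measurable_mono[OF assms(2) Phi_F_measurable[OF assms(1)]])

lemma Phi_measurable: "0 \<le> s \<Longrightarrow> (\<lambda>w. \<Phi> s w a c) \<in> borel_measurable M"
  by (rule F_measurable_M[OF Phi_F_measurable])

lemma near_sets:
  assumes "\<And>a c. (\<lambda>w. X w a c) \<in> borel_measurable N"
  shows "{w\<in>space N. near \<delta> (X w)} \<in> sets N"
proof -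
  have "{w\<in>space N. \<forall>a\<in>UNIV. \<forall>c\<in>UNIV. \<bar>X w a c - \<Phi>0 a c\<bar> \<le> \<delta>} \<in> sets N"
    by (intro sets.sets_Collect_finite_All borel_measurable_le borel_measurable_abs borel_measurable_diff
        borel_measurable_const assms finite)
  then show ?thesis by (simp add: near_def)
qed

definition coeff :: "'i \<Rightarrow> 'i \<Rightarrow> 'i \<times> 'i \<Rightarrow> real \<Rightarrow> 'a \<Rightarrow> real" where
  "coeff a c e s w = sandwich_coeff (psd_sqrt (\<Phi> s w)) a c e"

lemma coeff_measurable:
  assumes "0 \<le> s" "s \<le> t"
  shows "(\<lambda>w. coeff a c e s w) \<in> borel_measurable (F t)"
proof -
  have "(\<lambda>w. psd_sqrt (\<Phi> s w) i j) \<in> borel_measurable (F t)" for i j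
    by (rule measurable_psd_sqrt) (use Phi_psd Phi_measurable_later assms in auto)
  then show ?thesis unfolding coeff_def sandwich_coeff_def by measurable
qed

lemma coeff_continuous:
  assumes "w \<in> space M"
  shows "continuous_on {0..} (\<lambda>s. coeff a c e s w)"
proof -
  have "continuous_on {0..} (\<lambda>s. psd_sqrt (\<Phi> s w) i j)" for i j
    by (rule continuous_on_psd_sqrt) (use Phi_psd Phi_continuous assms in auto)
  then show ?thesis unfolding coeff_def sandwich_coeff_def by (intro continuous_intros) auto
qed

definition Phi0_bound :: real where
  "Phi0_bound = (\<Sum>a\<in>UNIV. \<Sum>c\<in>UNIV. \<bar>\<Phi>0 a c\<bar>)"

lemma Phi0_bound: "\<bar>\<Phi>0 a c\<bar> \<le> Phi0_bound"
proof -
  have "\<bar>\<Phi>0 a c\<bar> \<le> (\<Sum>c\<in>UNIV. \<bar>\<Phi>0 a c\<bar>)" by (rule member_le_sum) auto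
  also have "\<dots> \<le> Phi0_bound" unfolding Phi0_bound_def
    by (rule member_le_sum) (auto intro: sum_nonneg)
  finally show ?thesis .
qed

lemma Phi0_bound_nonneg: "0 \<le> Phi0_bound"
  using order_trans[OF abs_ge_zero Phi0_bound] .

lemma near_le: "near \<delta> A \<Longrightarrow> A a c \<le> Phi0_bound + \<delta>"
proof -
  assume "near \<delta> A"
  then have "\<bar>A a c - \<Phi>0 a c\<bar> \<le> \<delta>" by (simp add: near_def)
  then show ?thesis using Phi0_bound[of a c] by linarith
qed

lemma coeff_sq_le:
  assumes "w \<in> space M" "0 \<le> s" "near \<delta> (\<Phi> s w)"
  shows "(coeff a c e s w)\<^sup>2 \<le> 2 * (Phi0_bound + \<delta>)\<^sup>2"
  unfolding coeff_def by (rule sandwich_coeff_sq_le[OF Phi_psd[OF assms(1,2)] near_le[OF assms(3)]])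

text \<open>Symmetrizing the increments is absorbed into the coefficients, so the approximating sum
  becomes a stochastic sum over the independent Brownian entries.\<close>

lemma ito_sum_eq: "ito_sum \<Phi> Bt n t w a c = stoch_sum (grid t n) (\<lambda>k e w. coeff a c e (grid t n k) w) (2 ^ n) w"
proof -
  have diff: "sym_bm Bt u w i j - sym_bm Bt s w i j
     = ((Bt u w i j - Bt s w i j) + (Bt u w j i - Bt s w j i)) / sqrt 2" for u s i j
    by (simp add: sym_bm_def diff_divide_distrib add_divide_distrib)
  have cell: "(\<Sum>i\<in>UNIV. \<Sum>j\<in>UNIV. R a i * (sym_bm Bt u w i j - sym_bm Bt s w i j) * R j c)
     = (\<Sum>e\<in>UNIV. sandwich_coeff R a c e * (Bt u w (fst e) (snd e) - Bt s w (fst e) (snd e)))" for R u s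
    unfolding diff by (rule sandwich_coeff_sum)
  show ?thesis
    unfolding ito_sum_def stoch_sum_def Let_def grid_def coeff_def incr_def
    by (rule sum.cong[OF refl], rule cell)
qed

lemma ito_sum_measurable:
  assumes "0 < t"
  shows "(\<lambda>w. ito_sum \<Phi> Bt n t w a c) \<in> borel_measurable M"
  unfolding ito_sum_eq
  by (intro stoch_sum_M_measurable time_grid_grid[OF assms] predictableI coeff_measurable)
     (use assms brownian_space_axioms in \<open>auto simp: grid_nonneg\<close>)

lemma ito_error_measurable:
  assumes "0 < t"
  shows "ito_error n t a c \<in> borel_measurable M"
  unfolding ito_error_def[abs_def] using assms
  by (intro borel_measurable_diff borel_measurable_times borel_measurable_const ito_sum_measurable
      Phi_measurable drift_measurable) auto

text \<open>Both sides of the sum over the coarse dyadic grid of \<open>[0, grid t m j]\<close> live on the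
  \<open>(m + r)\<close>-th dyadic grid of \<open>[0, t]\<close>, where each coarse cell consists of \<open>j\<close> fine cells.\<close>

lemma ito_sum_refine:
  "ito_sum \<Phi> Bt r (grid t m j) w a c =
    stoch_sum (grid t (m + r)) (\<lambda>k e w. coeff a c e (grid t (m + r) (j * (k div j))) w) (j * 2 ^ r) w"
\<comment> \<open>For j = 0 the left side has only zero increments and the right side is an empty
  sum; the index \<open>j * (k div j)\<close> is a left cell end only for positive j.\<close>
proof (cases "j = 0")
  case True
  then show ?thesis by (simp add: ito_sum_eq stoch_sum_def incr_def grid_def)
next
  case False
  let ?g = "grid t (m + r)"
  let ?f = "\<lambda>l. \<Sum>e\<in>UNIV. coeff a c e (?g (j * (l div j))) w * incr (?g l) (?g (Suc l)) e w"
  have "ito_sum \<Phi> Bt r (grid t m j) w a c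
     = (\<Sum>k<2 ^ r. \<Sum>e\<in>UNIV. coeff a c e (?g (j * k)) w * incr (?g (j * k)) (?g (j * Suc k)) e w)"
    by (simp only: ito_sum_eq stoch_sum_def grid_grid)
  also have "\<dots> = (\<Sum>k<2 ^ r. sum ?f {k * j..<k * j + j})"
  proof (intro sum.cong refl)
    fix k
    have "sum ?f {k * j..<k * j + j} = (\<Sum>l\<in>{k * j..<k * j + j}. \<Sum>e\<in>UNIV. coeff a c e (?g (j * k)) w * incr (?g l) (?g (Suc l)) e w)"
    proof (rule sum.cong[OF refl])
      fix l assume "l \<in> {k * j..<k * j + j}"
      then have "l div j = k" by (metis add.commute atLeastLessThan_iff div_nat_eqI mult.commute mult_Suc_right)
      then show "?f l = (\<Sum>e\<in>UNIV. coeff a c e (?g (j * k)) w * incr (?g l) (?g (Suc l)) e w)" by simp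
    qed
    \<comment> \<open>Within a coarse cell the coefficient is frozen at the left end
      \<open>?g (j * k)\<close>, so the fine increments telescope to the coarse one.\<close>
    also have "\<dots> = (\<Sum>e\<in>UNIV. coeff a c e (?g (j * k)) w * (\<Sum>l\<in>{k * j..<k * j + j}. incr (?g l) (?g (Suc l)) e w))"
      by (subst sum.swap) (simp add: sum_distrib_left)
    also have "\<dots> = (\<Sum>e\<in>UNIV. coeff a c e (?g (j * k)) w * incr (?g (j * k)) (?g (j * Suc k)) e w)"
    proof (intro sum.cong refl arg_cong2[where f="(*)"])
      fix e
      show "(\<Sum>l\<in>{k * j..<k * j + j}. incr (?g l) (?g (Suc l)) e w) = incr (?g (j * k)) (?g (j * Suc k)) e w"
        unfolding incr_def using sum_Suc_diff'[of "k * j" "k * j + j" "\<lambda>l. Bt (?g l) w (fst e) (snd e)"]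
        by (simp add: mult.commute add.commute)
    qed
    finally show "(\<Sum>e\<in>UNIV. coeff a c e (?g (j * k)) w * incr (?g (j * k)) (?g (j * Suc k)) e w) = sum ?f {k * j..<k * j + j}" ..
  qed
  also have "\<dots> = sum ?f {..<2 ^ r * j}" by (rule sum.nat_group)
  finally show ?thesis by (simp add: stoch_sum_def mult.commute)
qed

section \<open>Integrands stopped on leaving a ball\<close>

definition inside :: "real \<Rightarrow> real \<Rightarrow> nat \<Rightarrow> nat \<Rightarrow> 'a \<Rightarrow> bool" where
  "inside \<delta> t n k w \<longleftrightarrow> (\<forall>l\<in>{..k}. near \<delta> (\<Phi> (grid t n l) w))"

lemma inside_sets:
  assumes "0 < t"
  shows "{w\<in>space (F (grid t n k)). inside \<delta> t n k w} \<in> sets (F (grid t n k))"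
  unfolding inside_def
  by (intro sets.sets_Collect_finite_All near_sets Phi_measurable_later)
     (use assms in \<open>auto simp: grid_nonneg grid_le_iff\<close>)

text \<open>The integrand vanishes from the first grid time at which \<Phi> is outside the ball,
  that time included. Predictability is kept, and coefficients built from \<Phi> get the
  deterministic bounds that the exponential inequalities require.\<close>

definition stopped :: "real \<Rightarrow> real \<Rightarrow> nat \<Rightarrow> (nat \<Rightarrow> 'i \<times> 'i \<Rightarrow> 'a \<Rightarrow> real) \<Rightarrow> nat \<Rightarrow> 'i \<times> 'i \<Rightarrow> 'a \<Rightarrow> real" where
  "stopped \<delta> t n H k e w = (if inside \<delta> t n k w then H k e w else 0)"

lemma predictable_stopped:
  assumes t: "0 < t" and H: "predictable (grid t n) H"
  shows "predictable (grid t n) (stopped \<delta> t n H)"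
proof (rule predictableI)
  fix k e
  have "(\<lambda>w. if inside \<delta> t n k w then H k e w else 0) \<in> borel_measurable (F (grid t n k))"
    by (intro measurable_If predictableD[OF H] borel_measurable_const inside_sets[OF t])
  then show "stopped \<delta> t n H k e \<in> borel_measurable (F (grid t n k))"
    unfolding stopped_def[abs_def] .
qed

lemma predictable_coeff:
  assumes "0 < t" "\<And>k. f k \<le> k"
  shows "predictable (grid t n) (\<lambda>k e w. coeff a c e (grid t n (f k)) w)"
  by (intro predictableI coeff_measurable) (use assms in \<open>auto simp: grid_nonneg grid_le_iff\<close>)

lemma stoch_qv_grid_le:
  assumes t: "0 < t" and B: "\<And>k e. k < m \<Longrightarrow> (H k e w)\<^sup>2 \<le> B" and m: "m \<le> 2 ^ n" and B0: "0 \<le> B"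
  shows "stoch_qv (grid t n) H m w \<le> t * (real CARD('i) ^ 2 * B)"
proof -
  have "stoch_qv (grid t n) H m w = (\<Sum>k<m. \<Sum>e\<in>UNIV. t / 2 ^ n * (H k e w)\<^sup>2)"
    by (simp add: stoch_qv_def grid_diff)
  also have "\<dots> \<le> (\<Sum>k<m. \<Sum>e\<in>(UNIV :: ('i \<times> 'i) set). t / 2 ^ n * B)"
    using t B by (intro sum_mono mult_left_mono) auto
  also have "\<dots> = real m * (real CARD('i) ^ 2 * (t / 2 ^ n * B))"
    by (simp add: power2_eq_square)
  also have "\<dots> \<le> 2 ^ n * (real CARD('i) ^ 2 * (t / 2 ^ n * B))"
    using m t B0 by (intro mult_right_mono) (auto simp flip: of_nat_le_iff)
  also have "\<dots> = t * (real CARD('i) ^ 2 * B)" by simp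
  finally show ?thesis .
qed

lemma stopped_coeff_sq_le:
  assumes "w \<in> space M" "0 < t" "0 \<le> \<delta>"
  shows "(stopped \<delta> t n (\<lambda>k e w. coeff a c e (grid t n k) w) k e w)\<^sup>2 \<le> 2 * (Phi0_bound + \<delta>)\<^sup>2"
  using assms coeff_sq_le[of w "grid t n k" \<delta> a c e]
  by (auto simp: stopped_def inside_def grid_nonneg)

end

context brownian_space
begin

lemma stoch_sum_abs_maximal:
  assumes tt: "time_grid tt" and H: "predictable tt H" and V: "\<And>w. w \<in> space M \<Longrightarrow> stoch_qv tt H n w \<le> V"
    and l: "0 \<le> l"
  shows "prob {w\<in>space M. \<exists>m\<in>{..n}. a \<le> \<bar>stoch_sum tt H m w\<bar>} \<le> 2 * exp (- l * a + l\<^sup>2 * V / 2)"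
    and "{w\<in>space M. \<exists>m\<in>{..n}. a \<le> \<bar>stoch_sum tt H m w\<bar>} \<in> events"
proof -
  let ?H = "\<lambda>k e w. -1 * H k e w"
  have H': "predictable tt ?H" by (rule predictable_scale[OF H])
  have V': "stoch_qv tt ?H n w \<le> V" if "w \<in> space M" for w
    unfolding stoch_qv_scale using V[OF that] by simp
  let ?A = "\<lambda>H. {w\<in>space M. \<exists>m\<in>{..n}. a \<le> stoch_sum tt H m w}"
  have ev: "?A H \<in> events" if "predictable tt H" for H
    by (intro sets.sets_Collect_finite_Ex borel_measurable_le borel_measurable_const
        stoch_sum_M_measurable[OF tt that]) auto
  have eq: "{w\<in>space M. \<exists>m\<in>{..n}. a \<le> \<bar>stoch_sum tt H m w\<bar>} = ?A H \<union> ?A ?H"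
  proof -
    have "a \<le> \<bar>x\<bar> \<longleftrightarrow> a \<le> x \<or> a \<le> -1 * x" for x :: real by auto
    then show ?thesis unfolding stoch_sum_scale by blast
  qed
  show "{w\<in>space M. \<exists>m\<in>{..n}. a \<le> \<bar>stoch_sum tt H m w\<bar>} \<in> events"
    unfolding eq using ev[OF H] ev[OF H'] by blast
  have "prob (?A H \<union> ?A ?H) \<le> prob (?A H) + prob (?A ?H)"
    by (rule measure_Un_le[OF ev[OF H] ev[OF H']])
  also have "\<dots> \<le> exp (- l * a + l\<^sup>2 * V / 2) + exp (- l * a + l\<^sup>2 * V / 2)"
    using stoch_sum_maximal[OF tt H V l, of a] stoch_sum_maximal[OF tt H' V' l, of a]
    by (intro add_mono) (simp_all add: Bex_def)
  finally show "prob {w\<in>space M. \<exists>m\<in>{..n}. a \<le> \<bar>stoch_sum tt H m w\<bar>} \<le> 2 * exp (- l * a + l\<^sup>2 * V / 2)"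
    unfolding eq by simp
qed

end

context covariance_sde
begin

section \<open>From dyadic times to whole paths, and from coarse to fine coefficients\<close>

lemma Phi_tendsto:
  assumes w: "w \<in> space M" and s: "0 \<le> s" and x: "x \<longlonglongrightarrow> s" "\<And>n. 0 \<le> x n"
  shows "(\<lambda>n. \<Phi> (x n) w a c) \<longlonglongrightarrow> \<Phi> s w a c"
  using continuous_on_tendsto_compose[OF Phi_continuous[OF w, of a c] x(1)] s x(2) by simp

lemma near_tendsto:
  assumes w: "w \<in> space M" and s: "0 \<le> s" and x: "x \<longlonglongrightarrow> s" "\<And>n. 0 \<le> x n"
    and near: "\<And>n. near \<delta> (\<Phi> (x n) w)"
  shows "near \<delta> (\<Phi> s w)"
  unfolding near_def
proof (intro allI)
  fix a c
  have "(\<lambda>n. \<bar>\<Phi> (x n) w a c - \<Phi>0 a c\<bar>) \<longlonglongrightarrow> \<bar>\<Phi> s w a c - \<Phi>0 a c\<bar>"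
    by (intro tendsto_intros Phi_tendsto[OF w s x])
  then show "\<bar>\<Phi> s w a c - \<Phi>0 a c\<bar> \<le> \<delta>"
    by (rule LIMSEQ_le_const2) (use near in \<open>auto simp: near_def\<close>)
qed

lemma near_from_grid:
  assumes w: "w \<in> space M" and t: "0 < t" and s: "0 \<le> s"
    and near: "\<And>n k. grid t n k \<le> s \<Longrightarrow> near \<delta> (\<Phi> (grid t n k) w)"
  shows "near \<delta> (\<Phi> s w)"
  by (rule near_tendsto[OF w s grid_index_tendsto[OF t s]])
     (use near grid_index(1)[OF t s] t in \<open>auto simp: grid_nonneg\<close>)

text \<open>Intended for the time u at which the path is first seen far away: closeness is known
  only at grid times strictly before u, and continuity carries it to u itself.\<close>

lemma near_from_grid_below:
  assumes w: "w \<in> space M" and t: "0 < t" and u: "0 < u" and s: "0 \<le> s" "s \<le> u"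
    and near: "\<And>n k. grid t n k < u \<Longrightarrow> near \<delta> (\<Phi> (grid t n k) w)"
  shows "near \<delta> (\<Phi> s w)"
proof -
  have below: "near \<delta> (\<Phi> s w)" if "0 \<le> s" "s < u" for s
    by (rule near_from_grid[OF w t that(1)]) (use near that in auto)
  show ?thesis
  proof (cases "s = u")
    case True
    let ?x = "\<lambda>n. u * (1 - inverse (real (Suc n)))"
    have x: "0 \<le> ?x n" "?x n < u" for n using u by (auto simp: field_simps)
    have "?x \<longlonglongrightarrow> u * (1 - 0)"
      by (intro tendsto_intros LIMSEQ_inverse_real_of_nat)
    then have "?x \<longlonglongrightarrow> s" using True by simp
    then show ?thesis using near_tendsto[OF w s(1), of ?x] x below by blast
  qed (use below s in auto)
qed

text \<open>Only dyadic times are tested, so that this is an event; by continuity it is the event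
  that \<Phi> stays in the closed ball on [0, t].\<close>

definition good :: "real \<Rightarrow> real \<Rightarrow> 'a set" where
  "good \<delta> t = {w\<in>space M. \<forall>n. \<forall>k\<in>{..2 ^ n}. near \<delta> (\<Phi> (grid t n k) w)}"

lemma good_events: "0 < t \<Longrightarrow> good \<delta> t \<in> events"
  unfolding good_def
  by (intro sets.sets_Collect_countable_All sets.sets_Collect_finite_All near_sets Phi_measurable) (auto simp: grid_nonneg)

lemma good_near:
  assumes "w \<in> good \<delta> t" "0 < t" "0 \<le> s" "s \<le> t"
  shows "near \<delta> (\<Phi> s w)"
proof (rule near_from_grid)
  fix n k assume "grid t n k \<le> s"
  then have "grid t n k \<le> grid t n (2 ^ n)" using assms by simp
  then have "k \<le> 2 ^ n" using grid_le_iff[OF assms(2)] by blast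
  then show "near \<delta> (\<Phi> (grid t n k) w)" using assms by (auto simp: good_def)
qed (use assms in \<open>auto simp: good_def\<close>)

lemma good_inside:
  assumes "w \<in> good \<delta> t" "0 < t" "k \<le> 2 ^ n"
  shows "inside \<delta> t n k w"
  using assms unfolding inside_def good_def by auto

lemma good_mono: "\<delta> \<le> \<delta>' \<Longrightarrow> good \<delta> t \<subseteq> good \<delta>' t"
  unfolding good_def near_def by (blast intro: order_trans)

lemma drift_integral_bound:
  assumes w: "w \<in> space M" and u: "0 \<le> u" and K: "\<And>s. 0 \<le> s \<Longrightarrow> s \<le> u \<Longrightarrow> \<bar>b (\<Phi> s w) a c - m\<bar> \<le> K"
  shows "\<bar>integral {0..u} (\<lambda>s. b (\<Phi> s w) a c) - u * m\<bar> \<le> K * u"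
proof -
  have "((\<lambda>s. b (\<Phi> s w) a c - m) has_integral integral {0..u} (\<lambda>s. b (\<Phi> s w) a c) - (u - 0) *\<^sub>R m) {0..u}"
    by (intro has_integral_diff integrable_integral drift_integrable w u has_integral_const_real[of m 0 u, simplified] )
       (use u has_integral_const_real[of m 0 u] in simp)
  then have "norm (integral {0..u} (\<lambda>s. b (\<Phi> s w) a c) - (u - 0) *\<^sub>R m) \<le> K * measure lborel {0..u}"
    by (rule has_integral_bound_real[rotated 2, where S="{}"]) (use order_trans[OF abs_ge_zero K[of 0]] u K in auto)
  then show ?thesis using u by simp
qed

text \<open>Moving the evaluation points of the coefficient from the coarse to the fine grid is
  asymptotically negligible: by uniform continuity the integrand is uniformly small.\<close>

definition refine_error :: "real \<Rightarrow> real \<Rightarrow> nat \<Rightarrow> nat \<Rightarrow> 'i \<Rightarrow> 'i \<Rightarrow> nat \<Rightarrow> 'a \<Rightarrow> real" where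
  "refine_error \<delta> t m j a c r w = stoch_sum (grid t (m + r)) (stopped \<delta> t (m + r)
      (\<lambda>k e w. coeff a c e (grid t (m + r) k) w - coeff a c e (grid t (m + r) (j * (k div j))) w)) (j * 2 ^ r) w"

lemma coeff_oscillation:
  assumes w: "w \<in> space M" and t: "0 < t" and j: "j \<le> 2 ^ m" and \<rho>: "\<rho> > 0"
  shows "\<forall>\<^sub>F r in sequentially. \<forall>k<j * 2 ^ r. \<forall>e.
    \<bar>coeff a c e (grid t (m + r) k) w - coeff a c e (grid t (m + r) (j * (k div j))) w\<bar> \<le> \<rho>"
proof -
  have "\<forall>\<^sub>F r in sequentially. \<forall>k<j * 2 ^ r.
    \<bar>coeff a c e (grid t (m + r) k) w - coeff a c e (grid t (m + r) (j * (k div j))) w\<bar> \<le> \<rho>" for e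
  proof -
    obtain d where d: "d > 0" "\<And>s s'. \<lbrakk>0 \<le> s; s \<le> t; 0 \<le> s'; s' \<le> t; \<bar>s - s'\<bar> < d\<rbrakk>
        \<Longrightarrow> \<bar>coeff a c e s w - coeff a c e s' w\<bar> < \<rho>"
      using uniformly_continuous_on_interval[OF coeff_continuous[OF w] \<rho>] by metis
    have "(\<lambda>r. t * (1/2) ^ r) \<longlonglongrightarrow> t * 0" by (intro tendsto_intros LIMSEQ_power_zero) simp
    then have "\<forall>\<^sub>F r in sequentially. t * (1/2) ^ r < d" using d(1) by (intro order_tendstoD) auto
    then show ?thesis
    proof (rule eventually_mono, intro allI impI)
      fix r k assume r: "t * (1/2) ^ r < d" and k: "k < j * 2 ^ r"
      let ?g = "grid t (m + r)" and ?k = "j * (k div j)"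
      have "j * 2 ^ r \<le> 2 ^ (m + r)" using j by (simp add: power_add)
      then have kk: "k \<le> 2 ^ (m + r)" "?k \<le> k" using k by auto
      \<comment> \<open>The remainder of k modulo j is below j <= 2^m, so the two times differ by at
        most t / 2^r, uniformly in k.\<close>
      have "k - ?k \<le> j" using k by (metis minus_mult_div_eq_mod less_imp_le mod_less_divisor mult_is_0 neq0_conv not_less0)
      then have "k - ?k \<le> 2 ^ m" using j by simp
      then have "real k - real ?k \<le> 2 ^ m" using kk(2) by (metis of_nat_diff of_nat_le_iff of_nat_numeral of_nat_power)
      then have "(real k - real ?k) * t / 2 ^ (m + r) \<le> 2 ^ m * t / 2 ^ (m + r)"
        using t by (intro divide_right_mono mult_right_mono) auto
      also have "\<dots> = t * (1/2) ^ r" using t by (simp add: power_add power_divide)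
      finally have "?g k - ?g ?k < d" using r by (simp add: grid_def left_diff_distrib diff_divide_distrib)
      moreover have "?g ?k \<le> ?g k" "?g k \<le> t" using kk t by (simp_all add: grid_le_iff grid_le)
      ultimately show "\<bar>coeff a c e (?g k) w - coeff a c e (?g ?k) w\<bar> \<le> \<rho>"
        using t by (intro less_imp_le[OF d(2)]) (auto simp: grid_nonneg)
    qed
  qed
  then have "\<forall>\<^sub>F r in sequentially. \<forall>e. \<forall>k<j * 2 ^ r.
    \<bar>coeff a c e (grid t (m + r) k) w - coeff a c e (grid t (m + r) (j * (k div j))) w\<bar> \<le> \<rho>"
    by (intro eventually_all_finite) auto
  then show ?thesis by (rule eventually_mono) blast
qed

lemma predictable_refine:
  assumes "0 < t"
  shows "predictable (grid t n) (stopped \<delta> t n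
      (\<lambda>k e w. coeff a c e (grid t n k) w - coeff a c e (grid t n (j * (k div j))) w))"
proof (intro predictable_stopped[OF assms] predictableI borel_measurable_diff)
  fix k e
  show "coeff a c e (grid t n k) \<in> borel_measurable (F (grid t n k))"
    using coeff_measurable[of "grid t n k" "grid t n k"] assms by (simp add: grid_nonneg)
  show "coeff a c e (grid t n (j * (k div j))) \<in> borel_measurable (F (grid t n k))"
    using coeff_measurable[of "grid t n (j * (k div j))" "grid t n k"] assms by (simp add: grid_nonneg grid_le_iff)
qed

lemma refine_error_measurable:
  assumes "0 < t"
  shows "refine_error \<delta> t m j a c r \<in> borel_measurable M"
  unfolding refine_error_def[abs_def]
  by (rule stoch_sum_M_measurable[OF time_grid_grid[OF assms brownian_space_axioms] predictable_refine[OF assms]])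

text \<open>The coefficients are uniformly small only pathwise, whereas the maximal inequality needs
  a deterministic bracket bound. They are therefore cut off at \<rho>; outside the event
  \<open>E r\<close>, whose probability vanishes, the cutoff changes nothing.\<close>

lemma refine_error_tendsto:
  assumes t: "0 < t" and j: "j \<le> 2 ^ m" and g: "0 < \<gamma>"
  shows "(\<lambda>r. prob {w\<in>space M. \<gamma> \<le> \<bar>refine_error \<delta> t m j a c r w\<bar>}) \<longlonglongrightarrow> 0"
proof (rule LIMSEQ_I)
  fix \<epsilon> :: real assume \<epsilon>: "\<epsilon> > 0"
  define V where "V = t * real CARD('i) ^ 2"
  have V: "V > 0" using t by (simp add: V_def)
  \<comment> \<open>With l = 1/\<rho> the exponent in the maximal inequality becomes
    -\<gamma>/\<rho> + V/2 = -4/\<epsilon>, and 2 exp (-4/\<epsilon>) < \<epsilon>/2.\<close>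
  define \<rho> where "\<rho> = \<gamma> / (V / 2 + 4 / \<epsilon>)"
  have den: "V / 2 + 4 / \<epsilon> > 0" using V \<epsilon> by (simp add: add_pos_pos)
  have \<rho>: "\<rho> > 0" using g den by (simp add: \<rho>_def)
  define Q where "Q r = stopped \<delta> t (m + r)
      (\<lambda>k e w. coeff a c e (grid t (m + r) k) w - coeff a c e (grid t (m + r) (j * (k div j))) w)" for r
  have Q: "predictable (grid t (m + r)) (Q r)" for r
    unfolding Q_def by (rule predictable_refine[OF t])
  define Q' where "Q' r k e w = (if \<bar>Q r k e w\<bar> \<le> \<rho> then Q r k e w else 0)" for r k e w
  have Q': "predictable (grid t (m + r)) (Q' r)" for r
  proof (rule predictableI)
    fix k e
    note [measurable] = predictableD[OF Q, of r k e]
    have "(\<lambda>w. if \<bar>Q r k e w\<bar> \<le> \<rho> then Q r k e w else 0) \<in> borel_measurable (F (grid t (m + r) k))"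
      by measurable
    then show "Q' r k e \<in> borel_measurable (F (grid t (m + r) k))" unfolding Q'_def[abs_def] .
  qed
  have top: "j * 2 ^ r \<le> 2 ^ (m + r)" for r using j by (simp add: power_add)
  have qv: "stoch_qv (grid t (m + r)) (Q' r) (j * 2 ^ r) w \<le> V * \<rho>\<^sup>2" for r w
  proof -
    have "(Q' r k e w)\<^sup>2 \<le> \<rho>\<^sup>2" for k e
      using \<rho> by (auto simp: Q'_def abs_le_square_iff[symmetric])
    then have "stoch_qv (grid t (m + r)) (Q' r) (j * 2 ^ r) w \<le> t * (real CARD('i) ^ 2 * \<rho>\<^sup>2)"
      by (intro stoch_qv_grid_le[OF t _ top]) auto
    then show ?thesis by (simp add: V_def mult.assoc)
  qed
  define E where "E r = {w\<in>space M. \<exists>k\<in>{..<j * 2 ^ r}. \<exists>e\<in>UNIV. \<rho> < \<bar>Q r k e w\<bar>}" for r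
  have E: "E r \<in> events" for r
    unfolding E_def
    by (intro sets.sets_Collect_finite_Ex borel_measurable_less borel_measurable_const borel_measurable_abs
        F_measurable_M[OF predictableD[OF Q]]) auto
  have "(\<lambda>r. prob (E r)) \<longlonglongrightarrow> 0"
  proof (rule prob_eventually_vanishing[OF E])
    fix w assume w: "w \<in> space M"
    from coeff_oscillation[OF w t j \<rho>, of a c] show "\<forall>\<^sub>F r in sequentially. w \<notin> E r"
      by (rule eventually_mono) (use \<rho> in \<open>auto simp: E_def Q_def stopped_def not_less\<close>)
  qed
  then have "\<forall>\<^sub>F r in sequentially. prob (E r) < \<epsilon> / 2" using \<epsilon> by (intro order_tendstoD) auto
  then obtain N where N: "\<And>r. r \<ge> N \<Longrightarrow> prob (E r) < \<epsilon> / 2" by (auto simp: eventually_sequentially)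
  show "\<exists>no. \<forall>r\<ge>no. norm (prob {w\<in>space M. \<gamma> \<le> \<bar>refine_error \<delta> t m j a c r w\<bar>} - 0) < \<epsilon>"
  proof (intro exI[of _ N] allI impI)
    fix r assume r: "N \<le> r"
    let ?n = "j * 2 ^ r" and ?tt = "grid t (m + r)"
    let ?B = "{w\<in>space M. \<exists>l\<in>{..?n}. \<gamma> \<le> \<bar>stoch_sum ?tt (Q' r) l w\<bar>}"
    have tt: "time_grid ?tt" by (rule time_grid_grid[OF t brownian_space_axioms])
    note mx = stoch_sum_abs_maximal[OF tt Q'[of r] qv, where l="1/\<rho>" and a=\<gamma>]
    have "{w\<in>space M. \<gamma> \<le> \<bar>refine_error \<delta> t m j a c r w\<bar>} \<subseteq> E r \<union> ?B"
    proof (safe, rule ccontr)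
      fix w assume w: "w \<in> space M" "\<gamma> \<le> \<bar>refine_error \<delta> t m j a c r w\<bar>" "w \<notin> E r"
        "\<not> (\<exists>l\<in>{..?n}. \<gamma> \<le> \<bar>stoch_sum ?tt (Q' r) l w\<bar>)"
      have "refine_error \<delta> t m j a c r w = stoch_sum ?tt (Q' r) ?n w"
        unfolding refine_error_def Q_def[symmetric] stoch_sum_def
        using w(1,3) by (intro sum.cong refl) (auto simp: E_def Q'_def not_less)
      then show False using w(2,4) by auto
    qed
    then have "prob {w\<in>space M. \<gamma> \<le> \<bar>refine_error \<delta> t m j a c r w\<bar>} \<le> prob (E r \<union> ?B)"
      using E mx(2) \<rho> by (intro finite_measure_mono sets.Un) auto
    also have "\<dots> \<le> prob (E r) + prob ?B"
      using E mx(2) \<rho> by (intro measure_Un_le) auto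
    also have "prob ?B \<le> 2 * exp (- (1/\<rho>) * \<gamma> + (1/\<rho>)\<^sup>2 * (V * \<rho>\<^sup>2) / 2)"
      using mx(1) \<rho> by simp
    also have "- (1/\<rho>) * \<gamma> + (1/\<rho>)\<^sup>2 * (V * \<rho>\<^sup>2) / 2 = - (4 / \<epsilon>)"
    proof -
      have "\<gamma> / \<rho> = V / 2 + 4 / \<epsilon>" using g den by (simp add: \<rho>_def)
      then show ?thesis using \<rho> by (simp add: power_divide)
    qed
    also have "2 * exp (- (4 / \<epsilon>)) < \<epsilon> / 2"
    proof -
      have "4 / \<epsilon> < exp (4 / \<epsilon>)" using exp_ge_add_one_self[of "4 / \<epsilon>"] by linarith
      then have "inverse (exp (4 / \<epsilon>)) < inverse (4 / \<epsilon>)" using \<epsilon> by (intro less_imp_inverse_less) auto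
      then show ?thesis by (simp add: exp_minus)
    qed
    finally show "norm (prob {w\<in>space M. \<gamma> \<le> \<bar>refine_error \<delta> t m j a c r w\<bar>} - 0) < \<epsilon>"
      using N[OF r] by simp
  qed
qed


section \<open>Exit from the ball\<close>

definition trunc_coeff :: "real \<Rightarrow> real \<Rightarrow> nat \<Rightarrow> 'i \<Rightarrow> 'i \<Rightarrow> nat \<Rightarrow> 'i \<times> 'i \<Rightarrow> 'a \<Rightarrow> real" where
  "trunc_coeff \<delta> t n a c = stopped \<delta> t n (\<lambda>k e w. coeff a c e (grid t n k) w)"

lemma predictable_trunc_coeff:
  assumes "0 < t"
  shows "predictable (grid t n) (trunc_coeff \<delta> t n a c)"
  unfolding trunc_coeff_def by (intro predictable_stopped[OF assms] predictable_coeff[OF assms]) simp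

definition qv_bound :: "real \<Rightarrow> real" where
  "qv_bound \<delta> = real CARD('i) ^ 2 * (2 * (Phi0_bound + \<delta>)\<^sup>2)"

lemma trunc_coeff_qv_le:
  assumes "0 < t" "0 \<le> \<delta>" "w \<in> space M"
  shows "stoch_qv (grid t n) (trunc_coeff \<delta> t n a c) (2 ^ n) w \<le> t * qv_bound \<delta>"
  unfolding trunc_coeff_def qv_bound_def
  using assms by (intro stoch_qv_grid_le stopped_coeff_sq_le) auto

text \<open>Until the path leaves the ball nothing is stopped, and the fine coefficients differ from
  those of the coarse Ito sum exactly by the integrand of \<open>refine_error\<close>.\<close>

lemma trunc_sum_eq:
  assumes "\<And>k. k < j * 2 ^ r \<Longrightarrow> inside \<delta> t (m + r) k w"
  shows "stoch_sum (grid t (m + r)) (trunc_coeff \<delta> t (m + r) a c) (j * 2 ^ r) w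
       = ito_sum \<Phi> Bt r (grid t m j) w a c + refine_error \<delta> t m j a c r w"
  unfolding ito_sum_refine refine_error_def stoch_sum_def sum.distrib[symmetric] trunc_coeff_def
  using assms by (intro sum.cong refl) (auto simp: stopped_def algebra_simps)

text \<open>The equation is available only at fixed times, so the random exit time is replaced by
  the first point of a fixed coarse grid at which \<Phi> is farther than \<delta>/2. The oscillation
  bound keeps the path within \<delta> up to that point, so nothing has been stopped yet. Of a
  displacement above \<delta>/2 the drift explains at most \<delta>/8; after scaling by
  \<open>sqrt P\<close>, the two error terms take \<delta>/8 each, and \<delta>/8 is left for the
  stopped stochastic sum.\<close>

lemma exit_pathwise:
  assumes w: "w \<in> space M" and t: "0 < t" and \<delta>: "0 < \<delta>"
    and K: "\<And>A a c. psd A \<Longrightarrow> near \<delta> A \<Longrightarrow> \<bar>b A a c\<bar> \<le> K"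
    and small: "cact * K * t \<le> \<delta> / 8"
    and osc: "\<And>n k n' k' a c. \<lbrakk>k \<le> 2 ^ n; k' \<le> 2 ^ n'; \<bar>grid t n k - grid t n' k'\<bar> \<le> t / 2 ^ m\<rbrakk>
        \<Longrightarrow> \<bar>\<Phi> (grid t n k) w a c - \<Phi> (grid t n' k') w a c\<bar> \<le> \<delta> / 2"
    and bad: "w \<notin> good \<delta> t"
    and I: "\<And>j a c. 0 < j \<Longrightarrow> j \<le> 2 ^ m \<Longrightarrow> \<bar>ito_error r (grid t m j) a c w\<bar> \<le> sqrt P * \<delta> / 8"
    and D: "\<And>j a c. 0 < j \<Longrightarrow> j \<le> 2 ^ m \<Longrightarrow> \<bar>refine_error \<delta> t m j a c r w\<bar> \<le> sqrt P * \<delta> / 8"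
  shows "\<exists>a c. \<exists>l\<le>2 ^ (m + r). sqrt P * \<delta> / 8 \<le> \<bar>stoch_sum (grid t (m + r)) (trunc_coeff \<delta> t (m + r) a c) l w\<bar>"
proof -
  have snap: "grid_index t m (grid t n k) \<le> 2 ^ m" "\<bar>grid t n k - grid t m (grid_index t m (grid t n k))\<bar> \<le> t / 2 ^ m"
    "grid t m (grid_index t m (grid t n k)) \<le> grid t n k"
    if "k \<le> 2 ^ n" for n k
  proof -
    note gi = grid_index[OF t grid_nonneg[of t n k], of m]
    show "grid t m (grid_index t m (grid t n k)) \<le> grid t n k" using gi t by simp
    then have "grid t m (grid_index t m (grid t n k)) \<le> grid t m (2 ^ m)"
      using grid_le[OF t that] by simp
    then show "grid_index t m (grid t n k) \<le> 2 ^ m" using grid_le_iff[OF t] by blast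
    show "\<bar>grid t n k - grid t m (grid_index t m (grid t n k))\<bar> \<le> t / 2 ^ m" using gi t by simp
  qed
  let ?far = "\<lambda>j. j \<le> 2 ^ m \<and> \<not> near (\<delta> / 2) (\<Phi> (grid t m j) w)"
  have near_add: "near \<delta> (\<Phi> (grid t n k) w)"
    if "k \<le> 2 ^ n" "near (\<delta> / 2) (\<Phi> (grid t m (grid_index t m (grid t n k))) w)" for n k
    unfolding near_def
  proof (intro allI)
    fix a c
    let ?s = "grid t m (grid_index t m (grid t n k))"
    have "\<bar>\<Phi> ?s w a c - \<Phi>0 a c\<bar> \<le> \<delta> / 2" using that(2) by (simp add: near_def)
    moreover have "\<bar>\<Phi> (grid t n k) w a c - \<Phi> ?s w a c\<bar> \<le> \<delta> / 2"
      by (rule osc[OF that(1) snap(1,2)[OF that(1)]])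
    ultimately show "\<bar>\<Phi> (grid t n k) w a c - \<Phi>0 a c\<bar> \<le> \<delta>" by linarith
  qed
  obtain n0 k0 where "k0 \<le> 2 ^ n0" "\<not> near \<delta> (\<Phi> (grid t n0 k0) w)"
    using bad w by (auto simp: good_def)
  then have "?far (grid_index t m (grid t n0 k0))" using near_add snap by blast
  define J where "J = (LEAST j. ?far j)"
  have J: "?far J" unfolding J_def by (rule LeastI) fact
  have below: "near (\<delta> / 2) (\<Phi> (grid t m j) w)" if "j < J" for j
    using not_less_Least[of j ?far] that J by (auto simp: J_def[symmetric])
  have "J \<noteq> 0"
    using J Phi_0[OF w] \<delta> by (cases "J = 0") (auto simp: near_def)
  let ?u = "grid t m J"
  have u: "0 < ?u" "?u \<le> t" using grid_less_iff[OF t, of m 0 J] grid_le[OF t] J \<open>J \<noteq> 0\<close> by auto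
  have near_grid: "near \<delta> (\<Phi> (grid t n k) w)" if "grid t n k < ?u" for n k
  proof -
    have "grid t n k < grid t n (2 ^ n)" using that u by simp
    then have k: "k \<le> 2 ^ n" using grid_less_iff[OF t] by (simp del: grid_top)
    have "grid t m (grid_index t m (grid t n k)) < ?u" using snap(3)[OF k] that by simp
    then have "grid_index t m (grid t n k) < J" using grid_less_iff[OF t] by blast
    then show ?thesis using near_add[OF k] below by blast
  qed
  obtain a c where ac: "\<delta> / 2 < \<bar>\<Phi> ?u w a c - \<Phi>0 a c\<bar>"
    using J by (auto simp: near_def not_le)
  have "\<bar>integral {0..?u} (\<lambda>s. b (\<Phi> s w) a c) - ?u * 0\<bar> \<le> K * ?u"
  proof (rule drift_integral_bound[OF w])
    fix s assume s: "0 \<le> s" "s \<le> ?u"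
    have "near \<delta> (\<Phi> s w)" by (rule near_from_grid_below[OF w t u(1) s near_grid])
    then show "\<bar>b (\<Phi> s w) a c - 0\<bar> \<le> K" using K[OF Phi_psd[OF w s(1)]] by simp
  qed (use u in simp)
  then have "cact * \<bar>integral {0..?u} (\<lambda>s. b (\<Phi> s w) a c)\<bar> \<le> cact * (K * ?u)"
    using cact by (intro mult_left_mono) auto
  also have "\<dots> \<le> cact * (K * t)"
  proof -
    have "0 \<le> K" using K[OF psd_Phi0, of a c] \<delta> by (force simp: near_def)
    then show ?thesis using u cact by (intro mult_left_mono) auto
  qed
  finally have "\<bar>cact * integral {0..?u} (\<lambda>s. b (\<Phi> s w) a c)\<bar> \<le> \<delta> / 8"
    using small cact by (simp add: abs_mult mult.assoc)
  then have "3 / 8 * \<delta> \<le> \<bar>\<Phi> ?u w a c - \<Phi>0 a c - cact * integral {0..?u} (\<lambda>s. b (\<Phi> s w) a c)\<bar>"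
    using ac by linarith
  then have "sqrt P * (3 / 8 * \<delta>) \<le> sqrt P * \<bar>\<Phi> ?u w a c - \<Phi>0 a c - cact * integral {0..?u} (\<lambda>s. b (\<Phi> s w) a c)\<bar>"
    using P by (intro mult_left_mono) auto
  also have "\<dots> = \<bar>sqrt P * (\<Phi> ?u w a c - \<Phi>0 a c - cact * integral {0..?u} (\<lambda>s. b (\<Phi> s w) a c))\<bar>"
    using P by (simp add: abs_mult)
  finally have main: "3 * (sqrt P * \<delta> / 8) \<le> \<bar>sqrt P * (\<Phi> ?u w a c - \<Phi>0 a c - cact * integral {0..?u} (\<lambda>s. b (\<Phi> s w) a c))\<bar>"
    by simp
  \<comment> \<open>The sum up to \<open>J * 2 ^ r\<close> uses cells whose left ends lie strictly
    before \<open>?u\<close>, exactly where closeness was proved.\<close>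
  have ins: "inside \<delta> t (m + r) k w" if "k < J * 2 ^ r" for k
    unfolding inside_def
  proof
    fix l assume "l \<in> {..k}"
    then have "grid t (m + r) l < ?u" using that grid_less_iff[OF t, of "m + r" l "J * 2 ^ r"] by (simp add: grid_refine[of t m J r])
    then show "near \<delta> (\<Phi> (grid t (m + r) l) w)" by (rule near_grid)
  qed
  have "\<bar>ito_error r ?u a c w\<bar> \<le> sqrt P * \<delta> / 8" "\<bar>refine_error \<delta> t m J a c r w\<bar> \<le> sqrt P * \<delta> / 8"
    using I D J \<open>J \<noteq> 0\<close> by auto
  note * = this
  have "sqrt P * \<delta> / 8 \<le> \<bar>stoch_sum (grid t (m + r)) (trunc_coeff \<delta> t (m + r) a c) (J * 2 ^ r) w\<bar>"
  proof -
    have "stoch_sum (grid t (m + r)) (trunc_coeff \<delta> t (m + r) a c) (J * 2 ^ r) w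
       = ito_sum \<Phi> Bt r ?u w a c + refine_error \<delta> t m J a c r w"
      by (rule trunc_sum_eq) (rule ins)
    then show ?thesis
      using * main unfolding ito_error_def by linarith
  qed
  moreover have "J * 2 ^ r \<le> 2 ^ (m + r)" using J by (simp add: power_add)
  ultimately show ?thesis by blast
qed

text \<open>Failure of the modulus of continuity at scale t / 2^m, tested at dyadic times of all
  levels so that it is a countable union of events.\<close>

definition osc_event :: "real \<Rightarrow> real \<Rightarrow> nat \<Rightarrow> 'a set" where
  "osc_event \<delta> t m = {w\<in>space M. \<exists>n n'. \<exists>k\<in>{k. k \<le> 2 ^ n}. \<exists>k'\<in>{k'. k' \<le> 2 ^ n' \<and> \<bar>grid t n k - grid t n' k'\<bar> \<le> t / 2 ^ m}.
     \<exists>a\<in>UNIV. \<exists>c\<in>UNIV. \<delta> / 2 < \<bar>\<Phi> (grid t n k) w a c - \<Phi> (grid t n' k') w a c\<bar>}"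

lemma osc_event_events:
  assumes "0 < t"
  shows "osc_event \<delta> t m \<in> events"
  unfolding osc_event_def
  by (intro sets.sets_Collect_countable_Ex sets.sets_Collect_finite_Ex borel_measurable_less borel_measurable_const
      borel_measurable_abs borel_measurable_diff Phi_measurable finite)
     (use assms in \<open>auto simp: grid_nonneg\<close>)

lemma osc_event_vanishes:
  assumes t: "0 < t" and \<delta>: "0 < \<delta>" and w: "w \<in> space M"
  shows "\<forall>\<^sub>F m in sequentially. w \<notin> osc_event \<delta> t m"
proof -
  have "\<forall>\<^sub>F m in sequentially. \<forall>s s'. 0 \<le> s \<and> s \<le> t \<and> 0 \<le> s' \<and> s' \<le> t \<and> \<bar>s - s'\<bar> \<le> t / 2 ^ m \<longrightarrow>
       \<bar>\<Phi> s w a c - \<Phi> s' w a c\<bar> \<le> \<delta> / 2" for a c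
  proof -
    obtain d where d: "d > 0" "\<And>s s'. \<lbrakk>0 \<le> s; s \<le> t; 0 \<le> s'; s' \<le> t; \<bar>s - s'\<bar> < d\<rbrakk>
        \<Longrightarrow> \<bar>\<Phi> s w a c - \<Phi> s' w a c\<bar> < \<delta> / 2"
      using uniformly_continuous_on_interval[OF Phi_continuous[OF w], of "\<delta> / 2"] \<delta> by (metis half_gt_zero)
    have "(\<lambda>r. t * (1/2) ^ r) \<longlonglongrightarrow> t * 0" by (intro tendsto_intros LIMSEQ_power_zero) simp
    then have "\<forall>\<^sub>F r in sequentially. t * (1/2) ^ r < d" using d(1) by (intro order_tendstoD) auto
    then show ?thesis
    proof (rule eventually_mono, intro allI impI)
      fix r s s' assume r: "t * (1/2) ^ r < d"
        and s: "0 \<le> s \<and> s \<le> t \<and> 0 \<le> s' \<and> s' \<le> t \<and> \<bar>s - s'\<bar> \<le> t / 2 ^ r"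
      have "\<bar>\<Phi> s w a c - \<Phi> s' w a c\<bar> < \<delta> / 2"
        by (rule d(2)) (use r s in \<open>auto simp: power_divide\<close>)
      then show "\<bar>\<Phi> s w a c - \<Phi> s' w a c\<bar> \<le> \<delta> / 2" by simp
    qed
  qed
  then have "\<forall>\<^sub>F m in sequentially. \<forall>a c. \<forall>s s'. 0 \<le> s \<and> s \<le> t \<and> 0 \<le> s' \<and> s' \<le> t \<and> \<bar>s - s'\<bar> \<le> t / 2 ^ m \<longrightarrow>
       \<bar>\<Phi> s w a c - \<Phi> s' w a c\<bar> \<le> \<delta> / 2"
    by (intro eventually_all_finite) auto
  then show ?thesis
  proof (rule eventually_mono)
    fix m assume *: "\<forall>a c. \<forall>s s'. 0 \<le> s \<and> s \<le> t \<and> 0 \<le> s' \<and> s' \<le> t \<and> \<bar>s - s'\<bar> \<le> t / 2 ^ m \<longrightarrow>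
       \<bar>\<Phi> s w a c - \<Phi> s' w a c\<bar> \<le> \<delta> / 2"
    show "w \<notin> osc_event \<delta> t m"
    proof
      assume "w \<in> osc_event \<delta> t m"
      then obtain n n' k k' a c where k: "k \<le> 2 ^ n" "k' \<le> 2 ^ n'" "\<bar>grid t n k - grid t n' k'\<bar> \<le> t / 2 ^ m"
        and "\<delta> / 2 < \<bar>\<Phi> (grid t n k) w a c - \<Phi> (grid t n' k') w a c\<bar>"
        by (auto simp: osc_event_def)
      moreover have "0 \<le> grid t n k" "grid t n k \<le> t" "0 \<le> grid t n' k'" "grid t n' k' \<le> t"
        using t k by (auto simp: grid_nonneg grid_le)
      ultimately show False using * by (meson not_le)
    qed
  qed
qed

text \<open>The coarse level m is fixed first, to make the oscillation event unlikely; it leaves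
  finitely many times, and then r makes the discretization errors at these times unlikely. What
  remains is the maximal inequality for each pair of indices and both signs, hence the factor
  \<open>real CARD('i) ^ 2 * 2\<close>.\<close>

lemma exit_probability:
  assumes t: "0 < t" and \<delta>: "0 < \<delta>"
    and K: "\<And>A a c. psd A \<Longrightarrow> near \<delta> A \<Longrightarrow> \<bar>b A a c\<bar> \<le> K"
    and small: "cact * K * t \<le> \<delta> / 8" and l: "0 \<le> l"
  shows "prob (space M - good \<delta> t)
     \<le> real CARD('i) ^ 2 * (2 * exp (- l * (sqrt P * \<delta> / 8) + l\<^sup>2 * (t * qv_bound \<delta>) / 2))"
proof (rule field_le_epsilon)
  fix \<epsilon> :: real assume \<epsilon>: "0 < \<epsilon>"
  define \<alpha> where "\<alpha> = sqrt P * \<delta> / 8"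
  have \<alpha>: "0 < \<alpha>" using P \<delta> by (simp add: \<alpha>_def)
  have "(\<lambda>m. prob (osc_event \<delta> t m)) \<longlonglongrightarrow> 0"
    by (intro prob_eventually_vanishing osc_event_events osc_event_vanishes t \<delta>)
  then have "\<forall>\<^sub>F m in sequentially. prob (osc_event \<delta> t m) < \<epsilon> / 2" using \<epsilon> by (intro order_tendstoD) auto
  then obtain m where m: "prob (osc_event \<delta> t m) < \<epsilon> / 2" by (auto simp: eventually_sequentially)
  let ?X = "{1..2 ^ m :: nat} \<times> (UNIV :: ('i \<times> 'i) set)"
  let ?E = "\<lambda>r (j, a, c). {w\<in>space M. \<alpha> < \<bar>ito_error r (grid t m j) a c w\<bar>}
      \<union> {w\<in>space M. \<alpha> \<le> \<bar>refine_error \<delta> t m j a c r w\<bar>}"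
  have gpos: "0 < grid t m j" if "1 \<le> j" for j using grid_less_iff[OF t, of m 0 j] that by simp
  have Eev1: "{w\<in>space M. \<alpha> < \<bar>ito_error r (grid t m j) a c w\<bar>} \<in> events" if "1 \<le> j" for r j a c
    by (intro borel_measurable_less borel_measurable_const borel_measurable_abs ito_error_measurable gpos that)
  have Eev2: "{w\<in>space M. \<alpha> \<le> \<bar>refine_error \<delta> t m j a c r w\<bar>} \<in> events" for r j a c
    by (intro borel_measurable_le borel_measurable_const borel_measurable_abs refine_error_measurable t)
  have Eev: "?E r x \<in> events" if "x \<in> ?X" for r x
    using that Eev1 Eev2 by (cases x) auto
  have "(\<lambda>r. prob (?E r x)) \<longlonglongrightarrow> 0" if x: "x \<in> ?X" for x
  proof -
    obtain j a c where xj: "x = (j, a, c)" by (cases x)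
    then have j: "1 \<le> j" "j \<le> 2 ^ m" using x by auto
    have "(\<lambda>r. prob {w\<in>space M. \<alpha> < \<bar>ito_error r (grid t m j) a c w\<bar>}
       + prob {w\<in>space M. \<alpha> \<le> \<bar>refine_error \<delta> t m j a c r w\<bar>}) \<longlonglongrightarrow> 0 + 0"
      using gpos[OF j(1)] by (intro tendsto_add ito_error_tendsto refine_error_tendsto t j(2) \<alpha>) simp
    then have lim: "(\<lambda>r. prob {w\<in>space M. \<alpha> < \<bar>ito_error r (grid t m j) a c w\<bar>}
       + prob {w\<in>space M. \<alpha> \<le> \<bar>refine_error \<delta> t m j a c r w\<bar>}) \<longlonglongrightarrow> 0" by simp
    show ?thesis
    proof (rule tendsto_sandwich[OF _ _ tendsto_const lim])
      show "\<forall>\<^sub>F r in sequentially. prob (?E r x) \<le> prob {w\<in>space M. \<alpha> < \<bar>ito_error r (grid t m j) a c w\<bar>}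
       + prob {w\<in>space M. \<alpha> \<le> \<bar>refine_error \<delta> t m j a c r w\<bar>}"
        unfolding xj prod.case by (intro always_eventually allI measure_Un_le Eev1 Eev2 j)
    qed simp
  qed
  then have "(\<lambda>r. \<Sum>x\<in>?X. prob (?E r x)) \<longlonglongrightarrow> (\<Sum>x\<in>?X. 0)" by (intro tendsto_sum)
  then have "\<forall>\<^sub>F r in sequentially. (\<Sum>x\<in>?X. prob (?E r x)) < \<epsilon> / 2" using \<epsilon> by (intro order_tendstoD) auto
  then obtain r where r: "(\<Sum>x\<in>?X. prob (?E r x)) < \<epsilon> / 2" by (auto simp: eventually_sequentially)
  let ?tt = "grid t (m + r)" and ?n = "2 ^ (m + r) :: nat"
  let ?S = "\<lambda>(a, c). {w\<in>space M. \<exists>l\<in>{..?n}. \<alpha> \<le> \<bar>stoch_sum ?tt (trunc_coeff \<delta> t (m + r) a c) l w\<bar>}"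
  have tt: "time_grid ?tt" by (rule time_grid_grid[OF t brownian_space_axioms])
  note mx = stoch_sum_abs_maximal[OF tt predictable_trunc_coeff[OF t, of "m + r" \<delta>] trunc_coeff_qv_le[OF t less_imp_le[OF \<delta>]] l, of \<alpha>]
  have Sev: "?S x \<in> events" for x using mx(2) by (cases x) auto
  have sub: "space M - good \<delta> t \<subseteq> osc_event \<delta> t m \<union> ((\<Union>x\<in>?X. ?E r x) \<union> (\<Union>x\<in>UNIV. ?S x))"
  proof
    fix w assume w: "w \<in> space M - good \<delta> t"
    show "w \<in> osc_event \<delta> t m \<union> ((\<Union>x\<in>?X. ?E r x) \<union> (\<Union>x\<in>UNIV. ?S x))"
    proof (rule ccontr)
      assume n: "w \<notin> osc_event \<delta> t m \<union> ((\<Union>x\<in>?X. ?E r x) \<union> (\<Union>x\<in>UNIV. ?S x))"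
      then have nE: "w \<notin> ?E r (j, a, c)" if "0 < j" "j \<le> 2 ^ m" for j a c using that by auto
      have "\<exists>a c. \<exists>l\<le>?n. sqrt P * \<delta> / 8 \<le> \<bar>stoch_sum ?tt (trunc_coeff \<delta> t (m + r) a c) l w\<bar>"
      proof (rule exit_pathwise[OF _ t \<delta> K small])
        show "\<bar>ito_error r (grid t m j) a c w\<bar> \<le> sqrt P * \<delta> / 8"
          "\<bar>refine_error \<delta> t m j a c r w\<bar> \<le> sqrt P * \<delta> / 8" if "0 < j" "j \<le> 2 ^ m" for j a c
          using nE[OF that, of a c] w by (auto simp: \<alpha>_def)
        show "\<bar>\<Phi> (grid t n k) w a c - \<Phi> (grid t n' k') w a c\<bar> \<le> \<delta> / 2"
          if "k \<le> 2 ^ n" "k' \<le> 2 ^ n'" "\<bar>grid t n k - grid t n' k'\<bar> \<le> t / 2 ^ m" for n k n' k' a c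
        proof (rule ccontr)
          assume "\<not> ?thesis"
          then have "w \<in> osc_event \<delta> t m" using that w unfolding osc_event_def by (auto simp: not_le) blast
          then show False using n by blast
        qed
      qed (use w in auto)
      then obtain a c where "w \<in> ?S (a, c)" using w by (auto simp: \<alpha>_def)
      then show False using n by blast
    qed
  qed
  have UE: "(\<Union>x\<in>?X. ?E r x) \<in> events" by (intro sets.finite_UN Eev) auto
  have US: "(\<Union>x\<in>UNIV. ?S x) \<in> events" by (intro sets.finite_UN Sev) auto
  have "prob (space M - good \<delta> t) \<le> prob (osc_event \<delta> t m \<union> ((\<Union>x\<in>?X. ?E r x) \<union> (\<Union>x\<in>UNIV. ?S x)))"
    by (intro finite_measure_mono sub sets.Un osc_event_events t UE US)
  also have "\<dots> \<le> prob (osc_event \<delta> t m) + (prob (\<Union>x\<in>?X. ?E r x) + prob (\<Union>x\<in>UNIV. ?S x))"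
    by (intro order_trans[OF measure_Un_le] add_left_mono measure_Un_le sets.Un osc_event_events t UE US)
  also have "\<dots> \<le> prob (osc_event \<delta> t m) + ((\<Sum>x\<in>?X. prob (?E r x)) + (\<Sum>x\<in>UNIV. prob (?S x)))"
    by (intro add_left_mono add_mono measure_UNION_le Eev Sev) auto
  also have "(\<Sum>x\<in>UNIV. prob (?S x)) \<le> (\<Sum>x\<in>(UNIV :: ('i \<times> 'i) set). 2 * exp (- l * \<alpha> + l\<^sup>2 * (t * qv_bound \<delta>) / 2))"
    by (intro sum_mono) (use mx(1) in auto)
  also have "\<dots> = real CARD('i) ^ 2 * (2 * exp (- l * \<alpha> + l\<^sup>2 * (t * qv_bound \<delta>) / 2))"
    by (simp add: power2_eq_square)
  finally show "prob (space M - good \<delta> t)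
     \<le> real CARD('i) ^ 2 * (2 * exp (- l * (sqrt P * \<delta> / 8) + l\<^sup>2 * (t * qv_bound \<delta>) / 2)) + \<epsilon>"
    using m r by (simp add: \<alpha>_def)
qed

end

section \<open>Short-time expansion of the exponential functional\<close>

definition l1 :: "('i::finite \<Rightarrow> real) \<Rightarrow> real" where
  "l1 v = (\<Sum>a\<in>UNIV. \<bar>v a\<bar>)"

lemma l1_nonneg: "0 \<le> l1 v" by (simp add: l1_def sum_nonneg)

text \<open>The number \<open>quad v X\<close>, with the weights in front so that linearity in X can
  be applied to sums over cells and entries.\<close>

definition outer_sum :: "('i::finite \<Rightarrow> real) \<Rightarrow> ('i \<Rightarrow> 'i \<Rightarrow> real) \<Rightarrow> real" where
  "outer_sum v X = (\<Sum>a\<in>UNIV. \<Sum>c\<in>UNIV. v a * v c * X a c)"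

lemma quad_outer_sum: "quad v A = outer_sum v A"
  by (simp add: quad_def outer_sum_def mult_ac)

lemma outer_sum_lin:
  "outer_sum v (\<lambda>a c. X a c + Y a c) = outer_sum v X + outer_sum v Y"
  "outer_sum v (\<lambda>a c. X a c - Y a c) = outer_sum v X - outer_sum v Y"
  "outer_sum v (\<lambda>a c. r * X a c) = r * outer_sum v X"
  by (simp_all add: outer_sum_def algebra_simps sum.distrib sum_subtractf sum_distrib_left)

lemma outer_sum_sum: "outer_sum v (\<lambda>a c. \<Sum>x\<in>S. X x a c) = (\<Sum>x\<in>S. outer_sum v (X x))"
proof -
  have "outer_sum v (\<lambda>a c. \<Sum>x\<in>S. X x a c) = (\<Sum>a\<in>UNIV. \<Sum>x\<in>S. \<Sum>c\<in>UNIV. v a * v c * X x a c)"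
    unfolding outer_sum_def sum_distrib_left by (intro sum.cong refl sum.swap)
  also have "\<dots> = (\<Sum>x\<in>S. \<Sum>a\<in>UNIV. \<Sum>c\<in>UNIV. v a * v c * X x a c)" by (rule sum.swap)
  finally show ?thesis by (simp add: outer_sum_def)
qed

lemma outer_sum_le:
  assumes "\<And>a c. \<bar>X a c\<bar> \<le> \<epsilon>"
  shows "\<bar>outer_sum v X\<bar> \<le> (l1 v)\<^sup>2 * \<epsilon>"
proof -
  have "\<bar>outer_sum v X\<bar> \<le> (\<Sum>a\<in>UNIV. \<Sum>c\<in>UNIV. \<bar>v a * v c * X a c\<bar>)"
    unfolding outer_sum_def by (intro order_trans[OF sum_abs] sum_mono sum_abs)
  also have "\<dots> \<le> (\<Sum>a\<in>UNIV. \<Sum>c\<in>UNIV. \<bar>v a\<bar> * \<bar>v c\<bar> * \<epsilon>)"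
    unfolding abs_mult by (intro sum_mono mult_left_mono assms) auto
  also have "\<dots> = (l1 v)\<^sup>2 * \<epsilon>"
    unfolding l1_def power2_eq_square sum_product by (simp only: sum_distrib_right)
  finally show ?thesis .
qed

lemma sandwich_outer_sum:
  assumes "psd A"
  shows "outer_sum v (\<lambda>a c. sandwich_coeff (psd_sqrt A) a c e)
     = sqrt 2 * mvec (psd_sqrt A) v (fst e) * mvec (psd_sqrt A) v (snd e)"
proof -
  let ?R = "psd_sqrt A"
  have sym: "?R i j = ?R j i" for i j by (rule psd_sym[OF psd_psd_sqrt[OF assms]])
  have p: "mvec ?R v i * mvec ?R v j = (\<Sum>a\<in>UNIV. \<Sum>c\<in>UNIV. v a * v c * (?R a i * ?R j c))" for i j
    unfolding mvec_def sum_product using sym by (intro sum.cong refl) (simp add: mult_ac)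
  have "outer_sum v (\<lambda>a c. sandwich_coeff ?R a c e)
     = (mvec ?R v (fst e) * mvec ?R v (snd e) + mvec ?R v (snd e) * mvec ?R v (fst e)) / sqrt 2"
    unfolding p outer_sum_def sandwich_coeff_def
    by (simp add: sum.distrib[symmetric] sum_divide_distrib distrib_left add_divide_distrib)
  also have "\<dots> = sqrt 2 * mvec ?R v (fst e) * mvec ?R v (snd e)"
    by (simp add: field_simps)
  finally show ?thesis .
qed

text \<open>The coefficient of each Brownian entry is sqrt 2 times a product of two components of R
  v, so the sum of squares factorizes into 2 |R v|^4. With the factor 1 / (2 sqrt P)^2 and the half
  in the stochastic exponential it becomes (quad v \<Phi>)^2 / (4 P).\<close>

lemma sandwich_outer_sum_sq:
  assumes "psd A"
  shows "(\<Sum>e\<in>UNIV. (outer_sum v (\<lambda>a c. sandwich_coeff (psd_sqrt A) a c e))\<^sup>2) = 2 * (quad v A)\<^sup>2"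
proof -
  let ?u = "mvec (psd_sqrt A) v"
  have "(\<Sum>e\<in>UNIV. (outer_sum v (\<lambda>a c. sandwich_coeff (psd_sqrt A) a c e))\<^sup>2)
     = (\<Sum>i\<in>UNIV. \<Sum>j\<in>UNIV. 2 * ((?u i)\<^sup>2 * (?u j)\<^sup>2))"
    by (simp add: sandwich_outer_sum[OF assms] power_mult_distrib mult.assoc sum.cartesian_product case_prod_beta)
  also have "\<dots> = 2 * ((\<Sum>i\<in>UNIV. (?u i)\<^sup>2) * (\<Sum>i\<in>UNIV. (?u i)\<^sup>2))"
    unfolding sum_product by (simp only: sum_distrib_left)
  finally show ?thesis unfolding sum_mvec_sqrt_sq[OF assms] by (simp add: power2_eq_square)
qed

context covariance_sde
begin

text \<open>The generator of the SDE applied to exp (- quad v \<Phi> / 2) as a function of \<Phi>,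
  evaluated at \<Phi>0 and divided by the value of that exponential there.\<close>

definition rate :: "('i \<Rightarrow> real) \<Rightarrow> real" where
  "rate v = - (cact * quad v (b \<Phi>0) / 2) + (quad v \<Phi>0)\<^sup>2 / (4 * P)"

text \<open>The martingale integrand of the exponent \<open>- quad v \<Phi> / 2\<close>, stopped on
  leaving the ball; its stochastic exponential is the density of the change of measure.\<close>

definition tilt :: "real \<Rightarrow> real \<Rightarrow> nat \<Rightarrow> ('i \<Rightarrow> real) \<Rightarrow> nat \<Rightarrow> 'i \<times> 'i \<Rightarrow> 'a \<Rightarrow> real" where
  "tilt \<delta> t n v = stopped \<delta> t n
     (\<lambda>k e w. - (1 / (2 * sqrt P)) * outer_sum v (\<lambda>a c. coeff a c e (grid t n k) w))"

lemma predictable_tilt: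
  assumes "0 < t"
  shows "predictable (grid t n) (tilt \<delta> t n v)"
  unfolding tilt_def outer_sum_def
proof (intro predictable_stopped[OF assms] predictableI borel_measurable_times borel_measurable_const borel_measurable_sum)
  fix k e a c
  show "coeff a c e (grid t n k) \<in> borel_measurable (F (grid t n k))"
    using coeff_measurable[of "grid t n k" "grid t n k"] assms by (simp add: grid_nonneg)
qed

lemma tilt_qv:
  assumes w: "w \<in> space M" and t: "0 < t"
  shows "stoch_qv (grid t n) (tilt \<delta> t n v) N w
     = (\<Sum>k<N. if inside \<delta> t n k w then t / 2 ^ n * ((quad v (\<Phi> (grid t n k) w))\<^sup>2 / (2 * P)) else 0)"
  unfolding stoch_qv_def
proof (rule sum.cong[OF refl])
  fix k
  let ?A = "\<Phi> (grid t n k) w"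
  have A: "psd ?A" using Phi_psd[OF w] t by (simp add: grid_nonneg)
  have c: "(- (1 / (2 * sqrt P)))\<^sup>2 = 1 / (4 * P)" using P by (simp add: power_divide power_mult_distrib)
  have "(\<Sum>e\<in>UNIV. t / 2 ^ n * (- (1 / (2 * sqrt P)) * outer_sum v (\<lambda>a c. coeff a c e (grid t n k) w))\<^sup>2)
     = t / 2 ^ n * (1 / (4 * P) * (\<Sum>e\<in>UNIV. (outer_sum v (\<lambda>a c. coeff a c e (grid t n k) w))\<^sup>2))"
    unfolding power_mult_distrib c by (simp only: sum_distrib_left)
  also have "\<dots> = t / 2 ^ n * ((quad v ?A)\<^sup>2 / (2 * P))"
    unfolding coeff_def sandwich_outer_sum_sq[OF A] by simp
  finally show "(\<Sum>e\<in>UNIV. (grid t n (Suc k) - grid t n k) * (tilt \<delta> t n v k e w)\<^sup>2)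
      = (if inside \<delta> t n k w then t / 2 ^ n * ((quad v ?A)\<^sup>2 / (2 * P)) else 0)"
    by (simp add: grid_diff tilt_def stopped_def)
qed

lemma near_quad_sq:
  assumes "near \<delta> A" "0 \<le> \<delta>"
  shows "\<bar>(quad v A)\<^sup>2 - (quad v \<Phi>0)\<^sup>2\<bar> \<le> (l1 v)^4 * (\<delta> * (2 * Phi0_bound + \<delta>))"
    and "(quad v A)\<^sup>2 \<le> (l1 v)^4 * (Phi0_bound + \<delta>)\<^sup>2"
proof -
  have d: "\<bar>quad v A - quad v \<Phi>0\<bar> \<le> (l1 v)\<^sup>2 * \<delta>"
    unfolding quad_outer_sum outer_sum_lin(2)[symmetric] using assms by (intro outer_sum_le) (simp add: near_def)
  have z: "\<bar>quad v \<Phi>0\<bar> \<le> (l1 v)\<^sup>2 * Phi0_bound"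
    unfolding quad_outer_sum by (intro outer_sum_le Phi0_bound)
  have s: "\<bar>quad v A + quad v \<Phi>0\<bar> \<le> (l1 v)\<^sup>2 * (2 * Phi0_bound + \<delta>)"
    using d z by (simp add: algebra_simps)
  have "\<bar>(quad v A)\<^sup>2 - (quad v \<Phi>0)\<^sup>2\<bar> = \<bar>quad v A - quad v \<Phi>0\<bar> * \<bar>quad v A + quad v \<Phi>0\<bar>"
    by (simp add: abs_mult[symmetric] power2_eq_square algebra_simps)
  also have "\<dots> \<le> ((l1 v)\<^sup>2 * \<delta>) * ((l1 v)\<^sup>2 * (2 * Phi0_bound + \<delta>))"
    by (intro mult_mono d s) (use assms in auto)
  also have "\<dots> = (l1 v)^4 * (\<delta> * (2 * Phi0_bound + \<delta>))"
    by (simp add: power2_eq_square power4_eq_xxxx)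
  finally show "\<bar>(quad v A)\<^sup>2 - (quad v \<Phi>0)\<^sup>2\<bar> \<le> (l1 v)^4 * (\<delta> * (2 * Phi0_bound + \<delta>))" .
  have "\<bar>quad v A\<bar> \<le> (l1 v)\<^sup>2 * (Phi0_bound + \<delta>)" using d z by (simp add: algebra_simps)
  then have "(quad v A)\<^sup>2 \<le> ((l1 v)\<^sup>2 * (Phi0_bound + \<delta>))\<^sup>2"
    by (rule power2_le_iff_abs_le[THEN iffD2, rotated]) (use assms Phi0_bound_nonneg in auto)
  then show "(quad v A)\<^sup>2 \<le> (l1 v)^4 * (Phi0_bound + \<delta>)\<^sup>2"
    by (simp add: power_mult_distrib flip: power_mult)
qed

lemma tilt_qv_le:
  assumes w: "w \<in> space M" and t: "0 < t" and \<delta>: "0 \<le> \<delta>"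
  shows "stoch_qv (grid t n) (tilt \<delta> t n v) (2 ^ n) w \<le> t * ((l1 v)^4 * (Phi0_bound + \<delta>)\<^sup>2 / (2 * P))"
proof -
  have "stoch_qv (grid t n) (tilt \<delta> t n v) (2 ^ n) w
     \<le> (\<Sum>k<(2::nat) ^ n. t / 2 ^ n * ((l1 v)^4 * (Phi0_bound + \<delta>)\<^sup>2 / (2 * P)))"
    unfolding tilt_qv[OF w t]
  proof (rule sum_mono)
    fix k
    show "(if inside \<delta> t n k w then t / 2 ^ n * ((quad v (\<Phi> (grid t n k) w))\<^sup>2 / (2 * P)) else 0)
      \<le> t / 2 ^ n * ((l1 v)^4 * (Phi0_bound + \<delta>)\<^sup>2 / (2 * P))"
    proof (cases "inside \<delta> t n k w")
      case True
      then have "near \<delta> (\<Phi> (grid t n k) w)" by (simp add: inside_def)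
      then show ?thesis using True t P near_quad_sq(2)[OF _ \<delta>]
        by (auto intro!: mult_left_mono divide_right_mono)
    qed (use t P in simp)
  qed
  then show ?thesis by simp
qed

lemma tilt_qv_good:
  assumes w: "w \<in> good \<delta> t" and t: "0 < t" and \<delta>: "0 \<le> \<delta>"
  shows "\<bar>stoch_qv (grid t n) (tilt \<delta> t n v) (2 ^ n) w - t * ((quad v \<Phi>0)\<^sup>2 / (2 * P))\<bar>
     \<le> t * ((l1 v)^4 * (\<delta> * (2 * Phi0_bound + \<delta>)) / (2 * P))"
proof -
  have wM: "w \<in> space M" using w by (simp add: good_def)
  let ?q = "\<lambda>k. (quad v (\<Phi> (grid t n k) w))\<^sup>2"
  have "stoch_qv (grid t n) (tilt \<delta> t n v) (2 ^ n) w = (\<Sum>k<(2::nat) ^ n. t / 2 ^ n * (?q k / (2 * P)))"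
    unfolding tilt_qv[OF wM t] using good_inside[OF w t] by (intro sum.cong refl) auto
  moreover have "t * ((quad v \<Phi>0)\<^sup>2 / (2 * P)) = (\<Sum>k<(2::nat) ^ n. t / 2 ^ n * ((quad v \<Phi>0)\<^sup>2 / (2 * P)))"
    by simp
  ultimately have "\<bar>stoch_qv (grid t n) (tilt \<delta> t n v) (2 ^ n) w - t * ((quad v \<Phi>0)\<^sup>2 / (2 * P))\<bar>
     = \<bar>\<Sum>k<(2::nat) ^ n. t / 2 ^ n * ((?q k - (quad v \<Phi>0)\<^sup>2) / (2 * P))\<bar>"
    by (simp only: sum_subtractf[symmetric] right_diff_distrib diff_divide_distrib)
  also have "\<dots> \<le> (\<Sum>k<(2::nat) ^ n. \<bar>t / 2 ^ n * ((?q k - (quad v \<Phi>0)\<^sup>2) / (2 * P))\<bar>)" by (rule sum_abs)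
  also have "\<dots> \<le> (\<Sum>k<(2::nat) ^ n. t / 2 ^ n * ((l1 v)^4 * (\<delta> * (2 * Phi0_bound + \<delta>)) / (2 * P)))"
  proof (rule sum_mono)
    fix k assume "k \<in> {..<(2::nat) ^ n}"
    then have "near \<delta> (\<Phi> (grid t n k) w)" using w by (auto simp: good_def)
    then have "\<bar>?q k - (quad v \<Phi>0)\<^sup>2\<bar> \<le> (l1 v)^4 * (\<delta> * (2 * Phi0_bound + \<delta>))" using near_quad_sq(1) \<delta> by blast
    then show "\<bar>t / 2 ^ n * ((?q k - (quad v \<Phi>0)\<^sup>2) / (2 * P))\<bar> \<le> t / 2 ^ n * ((l1 v)^4 * (\<delta> * (2 * Phi0_bound + \<delta>)) / (2 * P))"
      using t P by (simp only: abs_mult abs_divide) (auto intro!: mult_left_mono divide_right_mono)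
  qed
  finally show ?thesis by simp
qed

lemma tilt_sum_good:
  assumes w: "w \<in> good \<delta> t" and t: "0 < t"
  shows "stoch_sum (grid t n) (tilt \<delta> t n v) (2 ^ n) w
     = - (1 / (2 * sqrt P)) * outer_sum v (\<lambda>a c. ito_sum \<Phi> Bt n t w a c)"
proof -
  let ?inc = "\<lambda>k e. incr (grid t n k) (grid t n (Suc k)) e w"
  have "stoch_sum (grid t n) (tilt \<delta> t n v) (2 ^ n) w
     = (\<Sum>k<2 ^ n. \<Sum>e\<in>UNIV. - (1 / (2 * sqrt P)) * outer_sum v (\<lambda>a c. coeff a c e (grid t n k) w) * ?inc k e)"
    unfolding stoch_sum_def tilt_def stopped_def using good_inside[OF w t] by (intro sum.cong refl) auto
  also have "\<dots> = - (1 / (2 * sqrt P)) * (\<Sum>k<2 ^ n. \<Sum>e\<in>UNIV. outer_sum v (\<lambda>a c. coeff a c e (grid t n k) w) * ?inc k e)"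
    by (simp only: sum_distrib_left mult.assoc)
  also have "(\<Sum>k<2 ^ n. \<Sum>e\<in>UNIV. outer_sum v (\<lambda>a c. coeff a c e (grid t n k) w) * ?inc k e)
     = outer_sum v (\<lambda>a c. ito_sum \<Phi> Bt n t w a c)"
    unfolding ito_sum_eq stoch_sum_def outer_sum_sum
    by (simp only: mult.commute[of _ "?inc _ _"] outer_sum_lin(3))
  finally show ?thesis .
qed

text \<open>On the good event nothing is stopped, and the equation paired with v expresses the
  exponent through the stochastic sum and the drift. After removing the stochastic exponential and t
  times the rate, three defects remain: the discretization error, the oscillation of the drift and
  that of the bracket. They give the three terms of the bound.\<close>

lemma exponent_pathwise:
  assumes w: "w \<in> good \<delta> t" and t: "0 < t" and \<delta>: "0 \<le> \<delta>"
    and err: "\<And>a c. \<bar>ito_error n t a c w\<bar> \<le> \<gamma>"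
    and \<eta>: "\<And>A a c. psd A \<Longrightarrow> near \<delta> A \<Longrightarrow> \<bar>b A a c - b \<Phi>0 a c\<bar> \<le> \<eta>"
  shows "\<bar>- (quad v (\<Phi> t w) / 2) + quad v \<Phi>0 / 2
      - (stoch_sum (grid t n) (tilt \<delta> t n v) (2 ^ n) w - stoch_qv (grid t n) (tilt \<delta> t n v) (2 ^ n) w / 2) - t * rate v\<bar>
    \<le> (l1 v)\<^sup>2 * \<gamma> / (2 * sqrt P) + t * (cact * (l1 v)\<^sup>2 * \<eta> / 2 + (l1 v)^4 * (\<delta> * (2 * Phi0_bound + \<delta>)) / (4 * P))"
proof -
  have wM: "w \<in> space M" using w by (simp add: good_def)
  define I where "I a c = integral {0..t} (\<lambda>s. b (\<Phi> s w) a c)" for a c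
  define QV where "QV = stoch_qv (grid t n) (tilt \<delta> t n v) (2 ^ n) w"
  define E where "E = outer_sum v (\<lambda>a c. ito_error n t a c w)"
  define T where "T = outer_sum v (\<lambda>a c. ito_sum \<Phi> Bt n t w a c)"
  define J where "J = outer_sum v (\<lambda>a c. I a c - t * b \<Phi>0 a c)"
  have S: "stoch_sum (grid t n) (tilt \<delta> t n v) (2 ^ n) w = - (1 / (2 * sqrt P)) * T"
    unfolding T_def by (rule tilt_sum_good[OF w t])
  have "\<bar>I a c - t * b \<Phi>0 a c\<bar> \<le> \<eta> * t" for a c
    unfolding I_def
    by (rule drift_integral_bound[OF wM]) (use t \<eta> Phi_psd[OF wM] good_near[OF w t] in auto)
  then have J: "\<bar>J\<bar> \<le> (l1 v)\<^sup>2 * (\<eta> * t)" unfolding J_def by (rule outer_sum_le)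
  have E: "\<bar>E\<bar> \<le> (l1 v)\<^sup>2 * \<gamma>" unfolding E_def by (intro outer_sum_le err)
  have QV: "\<bar>QV - t * ((quad v \<Phi>0)\<^sup>2 / (2 * P))\<bar> \<le> t * ((l1 v)^4 * (\<delta> * (2 * Phi0_bound + \<delta>)) / (2 * P))"
    unfolding QV_def by (rule tilt_qv_good[OF w t \<delta>])
  have "E = T - sqrt P * (outer_sum v (\<Phi> t w) - outer_sum v \<Phi>0 - cact * outer_sum v I)"
    unfolding E_def T_def ito_error_def I_def[symmetric] outer_sum_lin by (rule refl)
  moreover have "J = outer_sum v I - t * quad v (b \<Phi>0)"
    by (simp add: J_def outer_sum_lin quad_outer_sum)
  ultimately have E2: "E = T - sqrt P * (quad v (\<Phi> t w) - quad v \<Phi>0 - cact * (J + t * quad v (b \<Phi>0)))"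
    by (simp add: quad_outer_sum)
  have sP: "sqrt P > 0" using P by simp
  have "E / (2 * sqrt P) = T / (2 * sqrt P) - (quad v (\<Phi> t w) - quad v \<Phi>0 - cact * (J + t * quad v (b \<Phi>0))) / 2"
    unfolding E2 using sP by (simp add: diff_divide_distrib)
  then have eq: "- (quad v (\<Phi> t w) / 2) + quad v \<Phi>0 / 2 - (- (1 / (2 * sqrt P)) * T - QV / 2) - t * rate v
     = E / (2 * sqrt P) - cact * J / 2 + (QV - t * ((quad v \<Phi>0)\<^sup>2 / (2 * P))) / 2"
    by (simp add: rate_def algebra_simps diff_divide_distrib add_divide_distrib)
  have triangle: "\<bar>p - q + r\<bar> \<le> x + (y + z)" if "\<bar>p\<bar> \<le> x" "\<bar>q\<bar> \<le> y" "\<bar>r\<bar> \<le> z" for p q r x y z :: real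
    using that by linarith
  show ?thesis
    unfolding S QV_def[symmetric] eq distrib_left[of t]
  proof (rule triangle)
    show "\<bar>E / (2 * sqrt P)\<bar> \<le> (l1 v)\<^sup>2 * \<gamma> / (2 * sqrt P)"
      unfolding abs_divide using E sP by (simp add: divide_right_mono)
    show "\<bar>cact * J / 2\<bar> \<le> t * (cact * (l1 v)\<^sup>2 * \<eta> / 2)"
      using mult_left_mono[OF J cact] cact by (simp add: abs_mult mult_ac)
    have half: "t * (Z / (4 * P)) = t * (Z / (2 * P)) / 2" for Z by simp
    have "\<bar>x / 2\<bar> \<le> y / 2" if "\<bar>x\<bar> \<le> y" for x y :: real using that by simp
    from this[OF QV] show "\<bar>(QV - t * ((quad v \<Phi>0)\<^sup>2 / (2 * P))) / 2\<bar>
        \<le> t * ((l1 v)^4 * (\<delta> * (2 * Phi0_bound + \<delta>)) / (4 * P))"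
      unfolding half .
  qed
qed

section \<open>Moments and two-sided estimates of the functional\<close>

definition gval :: "real \<Rightarrow> ('i \<Rightarrow> real) \<Rightarrow> real" where
  "gval t v = expectation (\<lambda>w. exp (- quad v (\<Phi> t w) / 2))"

lemma quad_Phi_measurable: "0 \<le> t \<Longrightarrow> (\<lambda>w. quad v (\<Phi> t w)) \<in> borel_measurable M"
  unfolding quad_def by (intro borel_measurable_sum borel_measurable_times borel_measurable_const Phi_measurable)

lemma exp_quad_integrable:
  assumes "0 \<le> t"
  shows "integrable M (\<lambda>w. exp (- quad v (\<Phi> t w) / 2))"
proof (rule integrable_const_bound[where B=1])
  show "AE w in M. norm (exp (- quad v (\<Phi> t w) / 2)) \<le> 1"
    using psd_quad_nonneg[OF Phi_psd[OF _ assms]] by (intro AE_I2) simp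
qed (use quad_Phi_measurable[OF assms] in measurable)

lemma gval_bounds:
  assumes "0 \<le> t"
  shows "0 \<le> gval t v" "gval t v \<le> 1"
proof -
  show "0 \<le> gval t v" unfolding gval_def by (intro integral_nonneg_AE AE_I2) simp
  have "gval t v \<le> expectation (\<lambda>w. 1)" unfolding gval_def
    using psd_quad_nonneg[OF Phi_psd[OF _ assms]] by (intro integral_mono exp_quad_integrable assms) auto
  then show "gval t v \<le> 1" by (simp add: prob_space)
qed

lemma gval_0: "gval 0 v = exp (- quad v \<Phi>0 / 2)"
proof -
  have "gval 0 v = expectation (\<lambda>w. exp (- quad v \<Phi>0 / 2))"
    unfolding gval_def by (intro Bochner_Integration.integral_cong refl) (simp add: Phi_0)
  then show ?thesis by (simp add: prob_space)
qed

text \<open>The squared stochastic exponential is that of the doubled integrand times exp of the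
  bracket, and stopping bounds the bracket by a constant of order t |v|^4. The second moment is
  therefore bounded uniformly in the level n.\<close>

lemma tilt_exp_moments:
  fixes v :: "'i \<Rightarrow> real"
  assumes t: "0 < t" and \<delta>: "0 \<le> \<delta>"
  defines "X \<equiv> \<lambda>(n::nat) w. exp (stoch_sum (grid t n) (tilt \<delta> t n v) (2 ^ n) w - stoch_qv (grid t n) (tilt \<delta> t n v) (2 ^ n) w / 2)"
  shows "integrable M (X n)" "expectation (X n) = 1" "integrable M (\<lambda>w. (X n w)\<^sup>2)"
    "expectation (\<lambda>w. (X n w)\<^sup>2) \<le> exp (t * ((l1 v)^4 * (Phi0_bound + \<delta>)\<^sup>2 / (2 * P)))"
proof -
  let ?tt = "grid t n" and ?B = "exp (t * ((l1 v)^4 * (Phi0_bound + \<delta>)\<^sup>2 / (2 * P)))"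
  let ?H = "tilt \<delta> t n v" and ?N = "2 ^ n :: nat"
  have tt: "time_grid ?tt" by (rule time_grid_grid[OF t brownian_space_axioms])
  note H = predictable_tilt[OF t, of n \<delta> v]
  have X[measurable]: "X n \<in> borel_measurable M"
    unfolding X_def using stoch_sum_M_measurable[OF tt H] stoch_qv_M_measurable[OF tt H] by simp
  have one: "(\<integral>\<^sup>+w. ennreal (X n w) \<partial>M) = ennreal 1"
    unfolding X_def by (simp add: exponential_martingale[OF tt H])
  show "integrable M (X n)"
    by (rule integrableI_nn_integral_finite[OF X _ one]) (simp add: X_def)
  show "expectation (X n) = 1"
    by (subst integral_eq_nn_integral[OF X]) (simp_all add: one, simp add: X_def)
  let ?H2 = "\<lambda>k e w. 2 * ?H k e w"
  let ?Y = "\<lambda>w. exp (stoch_sum ?tt ?H2 ?N w - stoch_qv ?tt ?H2 ?N w / 2)"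
  have Y[measurable]: "?Y \<in> borel_measurable M"
    using stoch_sum_M_measurable[OF tt predictable_scale[OF H]] stoch_qv_M_measurable[OF tt predictable_scale[OF H]] by simp
  have le: "(X n w)\<^sup>2 \<le> ?B * ?Y w" if w: "w \<in> space M" for w
  proof -
    have "(X n w)\<^sup>2 = exp (2 * stoch_sum ?tt ?H ?N w - stoch_qv ?tt ?H ?N w)"
      by (simp add: X_def power2_eq_square flip: exp_add)
    also have "\<dots> = exp (stoch_qv ?tt ?H ?N w) * ?Y w"
      unfolding stoch_sum_scale stoch_qv_scale by (simp flip: exp_add)
    also have "\<dots> \<le> ?B * ?Y w"
      using tilt_qv_le[OF w t \<delta>, of n v] by (intro mult_right_mono) auto
    finally show ?thesis .
  qed
  have "(\<integral>\<^sup>+w. ennreal ((X n w)\<^sup>2) \<partial>M) \<le> (\<integral>\<^sup>+w. ennreal ?B * ennreal (?Y w) \<partial>M)"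
    using le by (intro nn_integral_mono) (simp add: ennreal_leI flip: ennreal_mult)
  also have "\<dots> = ennreal ?B"
    by (subst nn_integral_cmult) (simp_all add: exponential_martingale[OF tt predictable_scale[OF H]])
  finally have le2: "(\<integral>\<^sup>+w. ennreal ((X n w)\<^sup>2) \<partial>M) \<le> ennreal ?B" .
  show int2: "integrable M (\<lambda>w. (X n w)\<^sup>2)"
    by (rule integrableI_nonneg) (use le2 in \<open>auto intro: le_less_trans\<close>)
  show "expectation (\<lambda>w. (X n w)\<^sup>2) \<le> ?B"
    by (subst integral_eq_nn_integral) (use le2 in \<open>auto intro!: enn2real_leI\<close>)
qed

text \<open>On the good event the exponential functional equals, up to small errors in the exponent, the
  exponential martingale times the deterministic factor given by the rate; the complement of
  the good event enters through its probability only.\<close>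

lemma gval_estimate:
  assumes t: "0 < t" and \<delta>: "0 \<le> \<delta>" and \<rho>: "0 < \<rho>"
    and \<eta>: "\<And>A a c. psd A \<Longrightarrow> near \<delta> A \<Longrightarrow> \<bar>b A a c - b \<Phi>0 a c\<bar> \<le> \<eta>"
    and \<zeta>: "cact * (l1 v)\<^sup>2 * \<eta> / 2 + (l1 v)^4 * (\<delta> * (2 * Phi0_bound + \<delta>)) / (4 * P) < \<zeta>"
  shows "gval t v \<le> gval 0 v * exp (t * (rate v + \<zeta>)) + prob (space M - good \<delta> t)"
    and "gval 0 v * exp (t * (rate v - \<zeta>)) *
        (1 - \<rho> / 2 * exp (t * ((l1 v)^4 * (Phi0_bound + \<delta>)\<^sup>2 / (2 * P))) - prob (space M - good \<delta> t) / (2 * \<rho>))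
      \<le> gval t v"
proof -
  define \<zeta>0 where "\<zeta>0 = cact * (l1 v)\<^sup>2 * \<eta> / 2 + (l1 v)^4 * (\<delta> * (2 * Phi0_bound + \<delta>)) / (4 * P)"
  \<comment> \<open>Chosen so that the discretization error uses up at most the gap t (\<zeta> -
    \<zeta>0); the added 1 in the denominator handles v = 0.\<close>
  define \<gamma> where "\<gamma> = t * (\<zeta> - \<zeta>0) * (2 * sqrt P) / ((l1 v)\<^sup>2 + 1)"
  have sP: "0 < sqrt P" using P by simp
  have l1: "0 < (l1 v)\<^sup>2 + 1" by (simp add: add_nonneg_pos)
  have \<gamma>: "0 < \<gamma>" using t \<zeta> sP l1 by (auto simp: \<gamma>_def \<zeta>0_def intro!: divide_pos_pos mult_pos_pos)
  have "(l1 v)\<^sup>2 * \<gamma> / (2 * sqrt P) = t * (\<zeta> - \<zeta>0) * ((l1 v)\<^sup>2 / ((l1 v)\<^sup>2 + 1))"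
    using sP l1 by (simp add: \<gamma>_def)
  also have "\<dots> \<le> t * (\<zeta> - \<zeta>0) * 1"
    using t \<zeta> l1 by (intro mult_left_mono) (auto simp: \<zeta>0_def)
  finally have \<gamma>_le: "(l1 v)\<^sup>2 * \<gamma> / (2 * sqrt P) + t * \<zeta>0 \<le> t * \<zeta>" by (simp add: algebra_simps)
  define X where "X n w = exp (stoch_sum (grid t n) (tilt \<delta> t n v) (2 ^ n) w - stoch_qv (grid t n) (tilt \<delta> t n v) (2 ^ n) w / 2)" for n w
  note moments = tilt_exp_moments[OF t \<delta>, where v=v, folded X_def]
  have X_pos: "0 < X n w" for n w by (simp add: X_def)
  define f where "f w = exp (- quad v (\<Phi> t w) / 2)" for w
  define f0 where "f0 = gval 0 v"
  have f0: "f0 = exp (- quad v \<Phi>0 / 2)" by (simp add: f0_def gval_0)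
  have f_int: "integrable M f" unfolding f_def by (rule exp_quad_integrable) (use t in simp)
  have f_le: "f w \<le> 1" if "w \<in> space M" for w
    using psd_quad_nonneg[OF Phi_psd[OF that, of t]] t by (simp add: f_def)
  define B where "B n = {w\<in>space M. \<exists>a\<in>UNIV. \<exists>c\<in>UNIV. \<gamma> < \<bar>ito_error n t a c w\<bar>}" for n
  have Bev: "B n \<in> events" for n
    unfolding B_def by (intro sets.sets_Collect_finite_Ex borel_measurable_less borel_measurable_const
      borel_measurable_abs ito_error_measurable t finite)
  have Blim: "(\<lambda>n. prob (B n)) \<longlonglongrightarrow> 0"
  proof (rule tendsto_sandwich[OF _ _ tendsto_const])
    let ?C = "\<lambda>n x. {w\<in>space M. \<gamma> < \<bar>ito_error n t (fst x) (snd x) w\<bar>}"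
    have Cev: "?C n x \<in> events" for n x
      by (intro borel_measurable_less borel_measurable_const borel_measurable_abs ito_error_measurable t)
    have "prob (B n) \<le> (\<Sum>x\<in>UNIV. prob (?C n x))" for n
    proof -
      have "B n = (\<Union>x\<in>UNIV. ?C n x)" by (auto simp: B_def) blast
      then show ?thesis using measure_UNION_le[of UNIV "?C n" M] Cev by simp
    qed
    then show "\<forall>\<^sub>F n in sequentially. prob (B n) \<le> (\<Sum>x\<in>UNIV. prob (?C n x))" by simp
    have "(\<lambda>n. \<Sum>x\<in>UNIV. prob (?C n x)) \<longlonglongrightarrow> (\<Sum>x\<in>(UNIV :: ('i \<times> 'i) set). 0)"
      using t \<gamma> by (intro tendsto_sum ito_error_tendsto) auto
    then show "(\<lambda>n. \<Sum>x\<in>UNIV. prob (?C n x)) \<longlonglongrightarrow> 0" by simp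
  qed simp
  define E where "E n = good \<delta> t - B n" for n
  have Eev[measurable]: "E n \<in> events" for n unfolding E_def using good_events[OF t] Bev by blast
  have compl: "prob (space M - E n) \<le> prob (space M - good \<delta> t) + prob (B n)" for n
  proof -
    have "prob (space M - E n) \<le> prob ((space M - good \<delta> t) \<union> B n)"
      by (intro finite_measure_mono sets.Un Bev sets.compl_sets good_events t) (auto simp: E_def)
    also have "\<dots> \<le> prob (space M - good \<delta> t) + prob (B n)"
      by (intro measure_Un_le Bev sets.compl_sets good_events t)
    finally show ?thesis .
  qed
  have path: "f w \<le> f0 * exp (t * (rate v + \<zeta>)) * X n w" "f0 * exp (t * (rate v - \<zeta>)) * X n w \<le> f w"
    if w: "w \<in> E n" for n w
  proof -
    have g: "w \<in> good \<delta> t" using w by (simp add: E_def)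
    then have "w \<in> space M" by (simp add: good_def)
    then have "\<bar>ito_error n t a c w\<bar> \<le> \<gamma>" for a c using w by (auto simp: E_def B_def not_less)
    from exponent_pathwise[OF g t \<delta> this \<eta>, of v, folded \<zeta>0_def] \<gamma>_le
    have "\<bar>- (quad v (\<Phi> t w) / 2) + quad v \<Phi>0 / 2
      - (stoch_sum (grid t n) (tilt \<delta> t n v) (2 ^ n) w - stoch_qv (grid t n) (tilt \<delta> t n v) (2 ^ n) w / 2) - t * rate v\<bar> \<le> t * \<zeta>"
      by (rule order_trans)
    then have *: "- quad v (\<Phi> t w) / 2 \<le> - quad v \<Phi>0 / 2 + (t * rate v + t * \<zeta>)
        + (stoch_sum (grid t n) (tilt \<delta> t n v) (2 ^ n) w - stoch_qv (grid t n) (tilt \<delta> t n v) (2 ^ n) w / 2)"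
      "- quad v \<Phi>0 / 2 + (t * rate v - t * \<zeta>)
        + (stoch_sum (grid t n) (tilt \<delta> t n v) (2 ^ n) w - stoch_qv (grid t n) (tilt \<delta> t n v) (2 ^ n) w / 2) \<le> - quad v (\<Phi> t w) / 2"
      by linarith+
    show "f w \<le> f0 * exp (t * (rate v + \<zeta>)) * X n w" "f0 * exp (t * (rate v - \<zeta>)) * X n w \<le> f w"
      unfolding f_def f0 X_def distrib_left right_diff_distrib exp_add[symmetric] using * by auto
  qed
  \<comment> \<open>Outside \<open>E n\<close> the bound f <= 1 suffices, as the martingale term is
    nonnegative.\<close>
  have upper: "gval t v \<le> f0 * exp (t * (rate v + \<zeta>)) + (prob (space M - good \<delta> t) + prob (B n))" for n
  proof -
    have "gval t v \<le> expectation (\<lambda>w. f0 * exp (t * (rate v + \<zeta>)) * X n w + indicator (space M - E n) w)"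
      unfolding gval_def f_def[symmetric]
    proof (intro integral_mono f_int Bochner_Integration.integrable_add integrable_mult_right moments(1))
      fix w assume w: "w \<in> space M"
      have "0 \<le> f0 * exp (t * (rate v + \<zeta>)) * X n w" using X_pos[of n w] by (simp add: f0)
      then show "f w \<le> f0 * exp (t * (rate v + \<zeta>)) * X n w + indicator (space M - E n) w"
        using path(1)[of w n] f_le[OF w] w by (cases "w \<in> E n") auto
    qed (auto simp: integrable_indicator_iff emeasure_eq_measure)
    also have "\<dots> = f0 * exp (t * (rate v + \<zeta>)) + prob (space M - E n)"
      using moments(1,2) by (subst Bochner_Integration.integral_add) (auto simp: integrable_indicator_iff emeasure_eq_measure)
    finally show ?thesis using compl[of n] by linarith
  qed
  have "(\<lambda>n. f0 * exp (t * (rate v + \<zeta>)) + (prob (space M - good \<delta> t) + prob (B n)))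
      \<longlonglongrightarrow> f0 * exp (t * (rate v + \<zeta>)) + (prob (space M - good \<delta> t) + 0)"
    by (intro tendsto_intros Blim)
  from LIMSEQ_le_const[OF this] upper
  show "gval t v \<le> gval 0 v * exp (t * (rate v + \<zeta>)) + prob (space M - good \<delta> t)"
    unfolding f0_def[symmetric] by auto
  let ?m = "exp (t * ((l1 v)^4 * (Phi0_bound + \<delta>)\<^sup>2 / (2 * P)))"
  \<comment> \<open>The mass of X outside \<open>E n\<close> must be subtracted. There X <= \<rho>
    X^2 / 2 + 1 / (2 \<rho>), which is (\<rho> X - 1)^2 >= 0 rearranged, so a second moment and a
    probability control it.\<close>
  have lower: "f0 * exp (t * (rate v - \<zeta>)) * (1 - \<rho> / 2 * ?m - (prob (space M - good \<delta> t) + prob (B n)) / (2 * \<rho>)) \<le> gval t v" for n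
  proof -
    have pos: "0 \<le> f0 * exp (t * (rate v - \<zeta>))" by (simp add: f0)
    have int: "integrable M (\<lambda>w. X n w - (\<rho> / 2 * (X n w)\<^sup>2 + 1 / (2 * \<rho>) * indicator (space M - E n) w))"
      by (intro Bochner_Integration.integrable_diff Bochner_Integration.integrable_add integrable_mult_right moments)
         (auto simp: integrable_indicator_iff emeasure_eq_measure)
    have "1 - \<rho> / 2 * ?m - (prob (space M - good \<delta> t) + prob (B n)) / (2 * \<rho>)
       \<le> 1 - (\<rho> / 2 * expectation (\<lambda>w. (X n w)\<^sup>2) + 1 / (2 * \<rho>) * prob (space M - E n))"
    proof -
      have "\<rho> / 2 * expectation (\<lambda>w. (X n w)\<^sup>2) \<le> \<rho> / 2 * ?m"
        using moments(4)[of n] \<rho> by (intro mult_left_mono) auto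
      moreover have "1 / (2 * \<rho>) * prob (space M - E n) \<le> 1 / (2 * \<rho>) * (prob (space M - good \<delta> t) + prob (B n))"
        using compl[of n] \<rho> by (intro mult_left_mono) auto
      ultimately show ?thesis by simp
    qed
    also have "\<dots> = expectation (\<lambda>w. X n w - (\<rho> / 2 * (X n w)\<^sup>2 + 1 / (2 * \<rho>) * indicator (space M - E n) w))"
      using moments(1-3)[of n]
      by (subst Bochner_Integration.integral_diff Bochner_Integration.integral_add;
          auto simp: integrable_indicator_iff emeasure_eq_measure)+
    finally have "f0 * exp (t * (rate v - \<zeta>)) * (1 - \<rho> / 2 * ?m - (prob (space M - good \<delta> t) + prob (B n)) / (2 * \<rho>))
       \<le> f0 * exp (t * (rate v - \<zeta>)) * expectation (\<lambda>w. X n w - (\<rho> / 2 * (X n w)\<^sup>2 + 1 / (2 * \<rho>) * indicator (space M - E n) w))"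
      by (rule mult_left_mono[OF _ pos])
    also have "\<dots> = expectation (\<lambda>w. f0 * exp (t * (rate v - \<zeta>)) * (X n w - (\<rho> / 2 * (X n w)\<^sup>2 + 1 / (2 * \<rho>) * indicator (space M - E n) w)))"
      by (rule integral_mult_right_zero[symmetric])
    also have "\<dots> \<le> gval t v"
      unfolding gval_def f_def[symmetric]
    proof (intro integral_mono f_int integrable_mult_right int)
      fix w assume w: "w \<in> space M"
      show "f0 * exp (t * (rate v - \<zeta>)) * (X n w - (\<rho> / 2 * (X n w)\<^sup>2 + 1 / (2 * \<rho>) * indicator (space M - E n) w)) \<le> f w"
      proof (cases "w \<in> E n")
        case True
        have "f0 * exp (t * (rate v - \<zeta>)) * (X n w - (\<rho> / 2 * (X n w)\<^sup>2 + 1 / (2 * \<rho>) * indicator (space M - E n) w))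
           \<le> f0 * exp (t * (rate v - \<zeta>)) * X n w"
          using True \<rho> by (intro mult_left_mono pos) simp
        then show ?thesis using path(2)[OF True] by linarith
      next
        case False
        have "0 \<le> (\<rho> * X n w - 1)\<^sup>2 / (2 * \<rho>)" using \<rho> by simp
        also have "\<dots> = \<rho> / 2 * (X n w)\<^sup>2 + 1 / (2 * \<rho>) - X n w"
          using \<rho> by (simp add: power2_eq_square field_simps)
        finally have "X n w - (\<rho> / 2 * (X n w)\<^sup>2 + 1 / (2 * \<rho>) * indicator (space M - E n) w) \<le> 0"
          using False w by simp
        then have "f0 * exp (t * (rate v - \<zeta>)) * (X n w - (\<rho> / 2 * (X n w)\<^sup>2 + 1 / (2 * \<rho>) * indicator (space M - E n) w)) \<le> 0"
          by (rule mult_nonneg_nonpos[OF pos])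
        then show ?thesis by (rule order_trans) (simp add: f_def)
      qed
    qed
    finally show ?thesis .
  qed
  have "(\<lambda>n. f0 * exp (t * (rate v - \<zeta>)) * (1 - \<rho> / 2 * ?m - (prob (space M - good \<delta> t) + prob (B n)) / (2 * \<rho>)))
     \<longlonglongrightarrow> f0 * exp (t * (rate v - \<zeta>)) * (1 - \<rho> / 2 * ?m - (prob (space M - good \<delta> t) + 0) / (2 * \<rho>))"
    using \<rho> by (intro tendsto_intros Blim) auto
  from LIMSEQ_le_const2[OF this] lower
  show "gval 0 v * exp (t * (rate v - \<zeta>)) * (1 - \<rho> / 2 * ?m - prob (space M - good \<delta> t) / (2 * \<rho>)) \<le> gval t v"
    unfolding f0_def[symmetric] by auto
qed

end

section \<open>The derivative of the exponential functional\<close>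

text \<open>The power 8 is tuned to the exit bound: with y of order 1 / sqrt t it yields
  t^4.\<close>

lemma exp_neg_le_power8:
  fixes y :: real
  assumes "0 < y"
  shows "exp (- y) \<le> (8 / y) ^ 8"
proof -
  have "y / 8 \<le> exp (y / 8)" using exp_ge_add_one_self[of "y / 8"] by linarith
  then have "(y / 8) ^ 8 \<le> exp (y / 8) ^ 8" using assms by (intro power_mono) auto
  also have "\<dots> = exp y" by (simp flip: exp_of_nat_mult)
  finally have "inverse (exp y) \<le> inverse ((y / 8) ^ 8)" using assms by (intro le_imp_inverse_le) auto
  then show ?thesis by (simp add: exp_minus power_divide)
qed

context covariance_sde
begin

lemma drift_bounded_near:
  obtains \<delta>0 K where "0 < \<delta>0" "0 \<le> K" "\<And>A a c. psd A \<Longrightarrow> near \<delta>0 A \<Longrightarrow> \<bar>b A a c\<bar> \<le> K"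
    "\<And>A a c. psd A \<Longrightarrow> near \<delta>0 A \<Longrightarrow> \<bar>b A a c - b \<Phi>0 a c\<bar> \<le> 1"
proof -
  obtain \<delta>0 where \<delta>0: "\<delta>0 > 0" "\<And>A a c. psd A \<Longrightarrow> near \<delta>0 A \<Longrightarrow> \<bar>b A a c - b \<Phi>0 a c\<bar> \<le> 1"
    using drift_continuous[of 1] unfolding near_def by auto
  define K where "K = (\<Sum>a\<in>UNIV. \<Sum>c\<in>UNIV. \<bar>b \<Phi>0 a c\<bar>) + 1"
  have K: "\<bar>b \<Phi>0 a c\<bar> + 1 \<le> K" for a c
  proof -
    have "\<bar>b \<Phi>0 a c\<bar> \<le> (\<Sum>c\<in>UNIV. \<bar>b \<Phi>0 a c\<bar>)" by (rule member_le_sum) auto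
    also have "\<dots> \<le> (\<Sum>a\<in>UNIV. \<Sum>c\<in>UNIV. \<bar>b \<Phi>0 a c\<bar>)" by (rule member_le_sum) (auto intro: sum_nonneg)
    finally show ?thesis by (simp add: K_def)
  qed
  have "0 \<le> K" unfolding K_def by (intro add_nonneg_nonneg sum_nonneg) auto
  moreover have "\<bar>b A a c\<bar> \<le> K" if "psd A" "near \<delta>0 A" for A a c
    using \<delta>0(2)[OF that, of a c] K[of a c] by linarith
  ultimately show ?thesis using that \<delta>0 by blast
qed

text \<open>Taking l = 1 / sqrt t in the exit bound keeps the bracket term bounded, while the linear
  term is -\<alpha> / sqrt t and beats every power of t. Order four leaves t^2 after the later
  division by t^2.\<close>

lemma exit_order:
  assumes \<delta>: "0 < \<delta>"
  shows "\<exists>C t0. 0 \<le> C \<and> 0 < t0 \<and> (\<forall>t. 0 < t \<longrightarrow> t \<le> t0 \<longrightarrow> prob (space M - good \<delta> t) \<le> C * t ^ 4)"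
proof -
  obtain \<delta>0 K where \<delta>0: "0 < \<delta>0" and K0: "0 \<le> K" and K: "\<And>A a c. psd A \<Longrightarrow> near \<delta>0 A \<Longrightarrow> \<bar>b A a c\<bar> \<le> K"
    using drift_bounded_near by metis
  \<comment> \<open>The drift bound holds on the ball of radius \<delta>0; an exit from a larger
    ball is also an exit from the smaller one.\<close>
  define \<delta>1 where "\<delta>1 = min \<delta> \<delta>0"
  have \<delta>1: "0 < \<delta>1" "\<delta>1 \<le> \<delta>" "\<delta>1 \<le> \<delta>0" using \<delta> \<delta>0 by (auto simp: \<delta>1_def)
  have K1: "\<bar>b A a c\<bar> \<le> K" if "psd A" "near \<delta>1 A" for A a c
    using that \<delta>1(3) by (intro K) (auto simp: near_def intro: order_trans)
  define \<alpha> where "\<alpha> = sqrt P * \<delta>1 / 8"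
  have \<alpha>: "0 < \<alpha>" using P \<delta>1 by (simp add: \<alpha>_def)
  \<comment> \<open>Up to this time a drift bounded by K moves \<Phi> by at most \<delta>1/8; the 1
    keeps the denominator positive.\<close>
  define t0 where "t0 = \<delta>1 / (8 * (cact * K + 1))"
  have cK: "0 < cact * K + 1" using cact K0 by (simp add: add_nonneg_pos)
  define C where "C = real CARD('i) ^ 2 * (2 * ((8 / \<alpha>) ^ 8 * exp (qv_bound \<delta>1 / 2)))"
  have "prob (space M - good \<delta> t) \<le> C * t ^ 4" if t: "0 < t" "t \<le> t0" for t
  proof -
    have "cact * K * t \<le> (cact * K + 1) * t0" using t cact K0 by (intro mult_mono) auto
    also have "\<dots> = \<delta>1 / 8"
    proof -
      have "s * (\<delta>1 / (8 * s)) = \<delta>1 / 8" if "0 < s" for s using that by simp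
      from this[OF cK] show ?thesis unfolding t0_def .
    qed
    finally have small: "cact * K * t \<le> \<delta>1 / 8" .
    have st: "0 < sqrt t" using t by simp
    have "prob (space M - good \<delta> t) \<le> prob (space M - good \<delta>1 t)"
      using good_mono[OF \<delta>1(2)] by (intro finite_measure_mono sets.compl_sets good_events t(1)) auto
    also have "\<dots> \<le> real CARD('i) ^ 2 * (2 * exp (- (1 / sqrt t) * (sqrt P * \<delta>1 / 8) + (1 / sqrt t)\<^sup>2 * (t * qv_bound \<delta>1) / 2))"
      by (rule exit_probability[OF t(1) \<delta>1(1) K1 small]) (use t in auto)
    also have "- (1 / sqrt t) * (sqrt P * \<delta>1 / 8) + (1 / sqrt t)\<^sup>2 * (t * qv_bound \<delta>1) / 2 = - (\<alpha> / sqrt t) + qv_bound \<delta>1 / 2"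
      using t by (simp add: \<alpha>_def power_divide)
    also have "exp (- (\<alpha> / sqrt t) + qv_bound \<delta>1 / 2) \<le> (8 / (\<alpha> / sqrt t)) ^ 8 * exp (qv_bound \<delta>1 / 2)"
      unfolding exp_add using \<alpha> st by (intro mult_right_mono exp_neg_le_power8) auto
    also have "(8 / (\<alpha> / sqrt t)) ^ 8 = (8 / \<alpha>) ^ 8 * t ^ 4"
    proof -
      have "sqrt t ^ 8 = (sqrt t ^ 2) ^ 4" by (simp flip: power_mult)
      then have "sqrt t ^ 8 = t ^ 4" using t by simp
      then show ?thesis by (simp add: power_divide power_mult_distrib)
    qed
    finally show ?thesis by (simp add: C_def mult_ac)
  qed
  moreover have "0 \<le> C" by (simp add: C_def)
  moreover have "0 < t0" using \<delta>1 cK by (simp add: t0_def)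
  ultimately show ?thesis by blast
qed

lemma l1_pow_le: "(l1 v)\<^sup>2 \<le> 1 + (l1 v) ^ 4" "1 \<le> 1 + (l1 v) ^ 4" "(l1 v) ^ 4 \<le> 1 + (l1 v) ^ 4"
proof -
  have "0 \<le> ((l1 v)\<^sup>2 - 1)\<^sup>2 + (l1 v)\<^sup>2" by (intro add_nonneg_nonneg) auto
  also have "\<dots> = (l1 v) ^ 4 - (l1 v)\<^sup>2 + 1" by (simp add: power2_eq_square power4_eq_xxxx algebra_simps)
  finally show "(l1 v)\<^sup>2 \<le> 1 + (l1 v) ^ 4" by simp
qed auto

lemma rate_bound: "\<exists>C\<ge>0. \<forall>v. \<bar>rate v\<bar> \<le> C * (1 + (l1 v) ^ 4)"
proof -
  obtain \<delta>0 K where \<delta>0: "0 < \<delta>0" and K0: "0 \<le> K" and K: "\<And>A a c. psd A \<Longrightarrow> near \<delta>0 A \<Longrightarrow> \<bar>b A a c\<bar> \<le> K"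
    using drift_bounded_near by metis
  have K': "\<bar>b \<Phi>0 a c\<bar> \<le> K" for a c using K[OF psd_Phi0] \<delta>0 by (simp add: near_def)
  define C where "C = cact * K / 2 + Phi0_bound\<^sup>2 / (4 * P)"
  have "\<bar>rate v\<bar> \<le> C * (1 + (l1 v) ^ 4)" for v
  proof -
    have "\<bar>quad v (b \<Phi>0)\<bar> \<le> (l1 v)\<^sup>2 * K" unfolding quad_outer_sum by (intro outer_sum_le K')
    also have "\<dots> \<le> (1 + (l1 v) ^ 4) * K" by (intro mult_right_mono l1_pow_le K0)
    finally have "cact * \<bar>quad v (b \<Phi>0)\<bar> / 2 \<le> cact * ((1 + (l1 v) ^ 4) * K) / 2"
      using cact by (intro divide_right_mono mult_left_mono) auto
    moreover have "(quad v \<Phi>0)\<^sup>2 / (4 * P) \<le> (1 + (l1 v) ^ 4) * Phi0_bound\<^sup>2 / (4 * P)"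
    proof (rule divide_right_mono)
      have "(quad v \<Phi>0)\<^sup>2 \<le> (l1 v) ^ 4 * (Phi0_bound + 0)\<^sup>2"
        by (rule near_quad_sq(2)) (simp_all add: near_def)
      also have "\<dots> \<le> (1 + (l1 v) ^ 4) * Phi0_bound\<^sup>2" by (simp add: mult_right_mono)
      finally show "(quad v \<Phi>0)\<^sup>2 \<le> (1 + (l1 v) ^ 4) * Phi0_bound\<^sup>2" .
    qed (use P in simp)
    moreover have "\<bar>rate v\<bar> \<le> cact * \<bar>quad v (b \<Phi>0)\<bar> / 2 + (quad v \<Phi>0)\<^sup>2 / (4 * P)"
    proof -
      have "\<bar>cact * quad v (b \<Phi>0) / 2\<bar> = cact * \<bar>quad v (b \<Phi>0)\<bar> / 2" using cact by (simp add: abs_mult)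
      moreover have "0 \<le> (quad v \<Phi>0)\<^sup>2 / (4 * P)" using P by simp
      ultimately show ?thesis unfolding rate_def by linarith
    qed
    ultimately show ?thesis by (simp add: C_def algebra_simps)
  qed
  moreover have "0 \<le> C" using cact K0 P by (simp add: C_def)
  ultimately show ?thesis by blast
qed

text \<open>The free parameter of \<open>gval_estimate\<close> is set to t^2, so that for fixed v
  both corrections in the lower bound are of order t^2 and disappear in the difference quotient. The
  constants depend on \<delta> but not on v or \<zeta>; \<open>gval_dominated\<close> relies on this
  uniformity.\<close>

lemma gval_expansion_bounds:
  assumes \<delta>: "0 < \<delta>"
    and \<eta>: "\<And>A a c. psd A \<Longrightarrow> near \<delta> A \<Longrightarrow> \<bar>b A a c - b \<Phi>0 a c\<bar> \<le> \<eta>"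
  shows "\<exists>C t0. 0 \<le> C \<and> 0 < t0 \<and> (\<forall>t v \<zeta>. 0 < t \<longrightarrow> t \<le> t0 \<longrightarrow>
     cact * (l1 v)\<^sup>2 * \<eta> / 2 + (l1 v)^4 * (\<delta> * (2 * Phi0_bound + \<delta>)) / (4 * P) < \<zeta> \<longrightarrow>
     gval t v \<le> gval 0 v * exp (t * (rate v + \<zeta>)) + C * t ^ 4 \<and>
     gval 0 v * exp (t * (rate v - \<zeta>)) *
        (1 - t\<^sup>2 / 2 * exp (t * ((l1 v)^4 * (Phi0_bound + \<delta>)\<^sup>2 / (2 * P))) - C * t\<^sup>2 / 2) \<le> gval t v)"
proof -
  obtain C t0 where C: "0 \<le> C" "0 < t0" "\<And>t. 0 < t \<Longrightarrow> t \<le> t0 \<Longrightarrow> prob (space M - good \<delta> t) \<le> C * t ^ 4"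
    using exit_order[OF \<delta>] by blast
  show ?thesis
  proof (rule exI[of _ C], rule exI[of _ t0], intro conjI C(1,2) allI impI)
    fix t :: real and v :: "'i \<Rightarrow> real" and \<zeta> :: real assume t: "0 < t" "t \<le> t0"
      and \<zeta>: "cact * (l1 v)\<^sup>2 * \<eta> / 2 + (l1 v)^4 * (\<delta> * (2 * Phi0_bound + \<delta>)) / (4 * P) < \<zeta>"
    have t2: "0 < t\<^sup>2" using t by simp
    have \<delta>': "0 \<le> \<delta>" using \<delta> by simp
    note est = gval_estimate[OF t(1) \<delta>' t2 \<eta> \<zeta>]
    show "gval t v \<le> gval 0 v * exp (t * (rate v + \<zeta>)) + C * t ^ 4"
      using est(1) C(3)[OF t] by linarith
    have "prob (space M - good \<delta> t) / (2 * t\<^sup>2) \<le> C * t ^ 4 / (2 * t\<^sup>2)"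
      using C(3)[OF t] by (intro divide_right_mono) auto
    also have "\<dots> = C * t\<^sup>2 / 2" using t by (simp add: power2_eq_square power4_eq_xxxx)
    finally have "gval 0 v * exp (t * (rate v - \<zeta>)) *
        (1 - t\<^sup>2 / 2 * exp (t * ((l1 v)^4 * (Phi0_bound + \<delta>)\<^sup>2 / (2 * P))) - C * t\<^sup>2 / 2)
      \<le> gval 0 v * exp (t * (rate v - \<zeta>)) *
        (1 - t\<^sup>2 / 2 * exp (t * ((l1 v)^4 * (Phi0_bound + \<delta>)\<^sup>2 / (2 * P))) - prob (space M - good \<delta> t) / (2 * t\<^sup>2))"
      using gval_bounds(1)[of 0 v] by (intro mult_left_mono) auto
    then show "gval 0 v * exp (t * (rate v - \<zeta>)) *
        (1 - t\<^sup>2 / 2 * exp (t * ((l1 v)^4 * (Phi0_bound + \<delta>)\<^sup>2 / (2 * P))) - C * t\<^sup>2 / 2) \<le> gval t v"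
      using est(2) by (rule order_trans)
  qed
qed

text \<open>Here v is fixed, so \<delta> may depend on it: continuity of the drift provides a radius
  for \<eta>, which is then shrunk for the bracket term.\<close>

lemma small_oscillation:
  assumes \<zeta>: "0 < \<zeta>"
  obtains \<delta> \<eta> where "0 < \<delta>" "\<And>A a c. psd A \<Longrightarrow> near \<delta> A \<Longrightarrow> \<bar>b A a c - b \<Phi>0 a c\<bar> \<le> \<eta>"
    "cact * (l1 v)\<^sup>2 * \<eta> / 2 + (l1 v)^4 * (\<delta> * (2 * Phi0_bound + \<delta>)) / (4 * P) < \<zeta>"
proof -
  define \<eta> where "\<eta> = \<zeta> / (cact * (l1 v)\<^sup>2 + 1)"
  have d1: "0 < cact * (l1 v)\<^sup>2 + 1" using cact by (simp add: add_nonneg_pos)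
  have \<eta>: "0 < \<eta>" using \<zeta> d1 by (simp add: \<eta>_def)
  have e1: "cact * (l1 v)\<^sup>2 * \<eta> / 2 < \<zeta> / 2"
    using \<zeta> d1 by (simp add: \<eta>_def field_simps)
  obtain \<delta>0 where \<delta>0: "\<delta>0 > 0" "\<And>A a c. psd A \<Longrightarrow> near \<delta>0 A \<Longrightarrow> \<bar>b A a c - b \<Phi>0 a c\<bar> \<le> \<eta>"
    using drift_continuous[OF \<eta>] unfolding near_def by auto
  have "((\<lambda>\<delta>. (l1 v)^4 * (\<delta> * (2 * Phi0_bound + \<delta>)) / (4 * P)) \<longlongrightarrow> (l1 v)^4 * (0 * (2 * Phi0_bound + 0)) / (4 * P)) (at_right 0)"
    using P by (intro tendsto_intros) auto
  then have "\<forall>\<^sub>F \<delta> in at_right 0. (l1 v)^4 * (\<delta> * (2 * Phi0_bound + \<delta>)) / (4 * P) < \<zeta> / 2"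
    using \<zeta> by (intro order_tendstoD) auto
  moreover have "\<forall>\<^sub>F \<delta> in at_right 0. 0 < \<delta> \<and> \<delta> < \<delta>0"
    using \<delta>0(1) by (auto simp: eventually_at_right_field)
  ultimately have "\<forall>\<^sub>F \<delta> in at_right (0::real). (l1 v)^4 * (\<delta> * (2 * Phi0_bound + \<delta>)) / (4 * P) < \<zeta> / 2 \<and> 0 < \<delta> \<and> \<delta> < \<delta>0"
    by (rule eventually_conj)
  then obtain \<delta> where \<delta>: "(l1 v)^4 * (\<delta> * (2 * Phi0_bound + \<delta>)) / (4 * P) < \<zeta> / 2" "0 < \<delta>" "\<delta> < \<delta>0"
    using eventually_happens trivial_limit_at_right_real by blast
  have "\<bar>b A a c - b \<Phi>0 a c\<bar> \<le> \<eta>" if "psd A" "near \<delta> A" for A a c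
    using that \<delta>(3) by (intro \<delta>0(2)) (auto simp: near_def intro: order_trans[OF _ less_imp_le])
  then show ?thesis using that[of \<delta> \<eta>] \<delta>(1,2) e1 by auto
qed

text \<open>The functional is squeezed between two smooth functions of t that share its value at 0
  and have slopes f0 (rate v + \<zeta>) and f0 (rate v - \<zeta>), with \<zeta> arbitrarily
  small.\<close>

lemma gval_right_derivative:
  "((\<lambda>t. (gval t v - gval 0 v) / t) \<longlongrightarrow> gval 0 v * rate v) (at_right 0)"
proof (rule tendstoI)
  fix e :: real assume e: "0 < e"
  define f0 where "f0 = gval 0 v"
  have f0: "0 \<le> f0" "f0 \<le> 1" using gval_bounds[of 0 v] by (auto simp: f0_def)
  define \<zeta> where "\<zeta> = e / 2"
  have \<zeta>: "0 < \<zeta>" using e by (simp add: \<zeta>_def)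
  obtain \<delta> \<eta> where \<delta>: "0 < \<delta>" "\<And>A a c. psd A \<Longrightarrow> near \<delta> A \<Longrightarrow> \<bar>b A a c - b \<Phi>0 a c\<bar> \<le> \<eta>"
    and small: "cact * (l1 v)\<^sup>2 * \<eta> / 2 + (l1 v)^4 * (\<delta> * (2 * Phi0_bound + \<delta>)) / (4 * P) < \<zeta>"
    using small_oscillation[OF \<zeta>] by blast
  define m where "m = (l1 v)^4 * (Phi0_bound + \<delta>)\<^sup>2 / (2 * P)"
  obtain C t0 where C: "0 < t0" "\<And>t. 0 < t \<Longrightarrow> t \<le> t0 \<Longrightarrow> gval t v \<le> f0 * exp (t * (rate v + \<zeta>)) + C * t ^ 4"
    "\<And>t. 0 < t \<Longrightarrow> t \<le> t0 \<Longrightarrow> f0 * exp (t * (rate v - \<zeta>)) * (1 - t\<^sup>2 / 2 * exp (t * m) - C * t\<^sup>2 / 2) \<le> gval t v"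
    using gval_expansion_bounds[OF \<delta>] small unfolding f0_def m_def by blast
  define U where "U t = f0 * exp (t * (rate v + \<zeta>)) + C * t ^ 4" for t
  define L where "L t = f0 * exp (t * (rate v - \<zeta>)) * (1 - t\<^sup>2 / 2 * exp (t * m) - C * t\<^sup>2 / 2)" for t
  have "(U has_real_derivative f0 * (rate v + \<zeta>)) (at 0)"
    unfolding U_def by (auto intro!: derivative_eq_intros)
  then have U: "((\<lambda>t. (U t - f0) / t) \<longlongrightarrow> f0 * (rate v + \<zeta>)) (at_right 0)"
    by (simp add: DERIV_def filterlim_at_split U_def)
  have "(L has_real_derivative f0 * (rate v - \<zeta>)) (at 0)"
    unfolding L_def by (auto intro!: derivative_eq_intros)
  then have L: "((\<lambda>t. (L t - f0) / t) \<longlongrightarrow> f0 * (rate v - \<zeta>)) (at_right 0)"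
    by (simp add: DERIV_def filterlim_at_split L_def)
  have fz: "f0 * \<zeta> \<le> e / 2" using mult_right_mono[OF f0(2), of \<zeta>] \<zeta> by (simp add: \<zeta>_def)
  have "f0 * (rate v + \<zeta>) < f0 * rate v + e" "f0 * rate v - e < f0 * (rate v - \<zeta>)"
    using fz e by (simp_all add: algebra_simps)
  then have "\<forall>\<^sub>F t in at_right 0. (U t - f0) / t < f0 * rate v + e" "\<forall>\<^sub>F t in at_right 0. f0 * rate v - e < (L t - f0) / t"
    using order_tendstoD(2)[OF U] order_tendstoD(1)[OF L] by blast+
  moreover have "\<forall>\<^sub>F t in at_right 0. 0 < t \<and> t < t0"
    using C(1) by (auto simp: eventually_at_right_field)
  ultimately show "\<forall>\<^sub>F t in at_right 0. dist ((gval t v - gval 0 v) / t) (gval 0 v * rate v) < e"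
  proof eventually_elim
    case (elim t)
    then have "(gval t v - f0) / t \<le> (U t - f0) / t" "(L t - f0) / t \<le> (gval t v - f0) / t"
      using C(2,3)[of t] by (auto simp: U_def L_def intro!: divide_right_mono)
    then show ?case using elim by (simp add: dist_real_def f0_def[symmetric])
  qed
qed

text \<open>One radius \<delta>, with drift oscillation 1, serves all v; the error \<zeta> is then
  of order 1 + |v|^4 instead of small, which is enough for domination. For small t the expansion is
  used only while t (1 + |v|^4) is small; otherwise the trivial bound 1 is itself at most a multiple
  of t (1 + |v|^4).\<close>

lemma gval_dominated:
  "\<exists>C\<ge>0. \<forall>t>0. \<forall>v. \<bar>gval t v - gval 0 v\<bar> \<le> C * (1 + (l1 v) ^ 4) * t"
proof -
  obtain \<delta> where \<delta>: "0 < \<delta>" "\<And>A a c. psd A \<Longrightarrow> near \<delta> A \<Longrightarrow> \<bar>b A a c - b \<Phi>0 a c\<bar> \<le> 1"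
    using drift_bounded_near by metis
  obtain Cr where Cr: "0 \<le> Cr" "\<And>v. \<bar>rate v\<bar> \<le> Cr * (1 + (l1 v) ^ 4)" using rate_bound by blast
  obtain C t0 where C: "0 \<le> C" "0 < t0"
    and est: "\<And>t v \<zeta>. 0 < t \<Longrightarrow> t \<le> t0 \<Longrightarrow>
     cact * (l1 v)\<^sup>2 * 1 / 2 + (l1 v)^4 * (\<delta> * (2 * Phi0_bound + \<delta>)) / (4 * P) < \<zeta> \<Longrightarrow>
     gval t v \<le> gval 0 v * exp (t * (rate v + \<zeta>)) + C * t ^ 4 \<and>
     gval 0 v * exp (t * (rate v - \<zeta>)) *
        (1 - t\<^sup>2 / 2 * exp (t * ((l1 v)^4 * (Phi0_bound + \<delta>)\<^sup>2 / (2 * P))) - C * t\<^sup>2 / 2) \<le> gval t v"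
    using gval_expansion_bounds[OF \<delta>] by blast
  \<comment> \<open>The final 1 makes the inequality required of \<zeta> strict.\<close>
  define Cz where "Cz = cact / 2 + \<delta> * (2 * Phi0_bound + \<delta>) / (4 * P) + 1"
  define Cm where "Cm = (Phi0_bound + \<delta>)\<^sup>2 / (2 * P)"
  have Cz: "0 \<le> Cz" using cact \<delta> P Phi0_bound_nonneg by (simp add: Cz_def)
  have Cm: "0 \<le> Cm" using P by (simp add: Cm_def)
  define C1 where "C1 = Cr + Cz + Cm"
  have C1: "0 \<le> C1" using Cr Cz Cm by (simp add: C1_def)
  define t1 where "t1 = min t0 1"
  have t1: "0 < t1" using C by (simp add: t1_def)
  \<comment> \<open>2 C1 and 2 + C cover the expansion, C1 alone covers the case C1 W t >= 1, and 1
    / t1 covers times beyond t1.\<close>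
  define D where "D = 2 * C1 + 2 + C + 1 / t1"
  have D: "0 \<le> D" using C1 C t1 by (simp add: D_def)
  have "\<bar>gval t v - gval 0 v\<bar> \<le> D * (1 + (l1 v) ^ 4) * t" if t: "0 < t" for t v
  proof -
    define W where "W = 1 + (l1 v) ^ 4"
    have W: "1 \<le> W" by (simp add: W_def)
    define f0 where "f0 = gval 0 v"
    have f0: "0 \<le> f0" "f0 \<le> 1" using gval_bounds[of 0 v] by (auto simp: f0_def)
    have ft: "0 \<le> gval t v" "gval t v \<le> 1" using gval_bounds[of t v] t by auto
    have triv: "\<bar>gval t v - f0\<bar> \<le> 1" using f0 ft by linarith
    have Dge: "1 / t1 * W * t \<le> D * W * t" "C1 * W * t \<le> D * W * t" "(2 * C1 * W + (2 + C)) * t \<le> D * W * t"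
    proof -
      have p: "0 \<le> C1 * W" "0 \<le> (2 + C) * W" "0 \<le> 1 / t1 * W" using C1 C t1 W by auto
      have "2 + C \<le> (2 + C) * W" using W C mult_left_mono[of 1 W "2 + C"] by simp
      moreover have "D * W = 2 * (C1 * W) + (2 + C) * W + 1 / t1 * W" by (simp add: D_def distrib_right)
      ultimately have "1 / t1 * W \<le> D * W" "C1 * W \<le> D * W" "2 * C1 * W + (2 + C) \<le> D * W"
        using p by linarith+
      then show "1 / t1 * W * t \<le> D * W * t" "C1 * W * t \<le> D * W * t" "(2 * C1 * W + (2 + C)) * t \<le> D * W * t"
        using t by (auto intro!: mult_right_mono simp del: divide_const_simps times_divide_eq_left)
    qed
    consider "t1 < t" | "t \<le> t1" "1 \<le> C1 * W * t" | "t \<le> t1" "C1 * W * t < 1" by linarith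
    then have "\<bar>gval t v - f0\<bar> \<le> D * W * t"
    proof cases
      case 1
      have "1 \<le> 1 / t1 * t" using 1 t1 by simp
      also have "\<dots> \<le> 1 / t1 * W * t" using W t t1 by (simp add: divide_right_mono)
      finally show ?thesis using triv Dge(1) by linarith
    next
      case 2
      then show ?thesis using triv Dge(2) by linarith
    next
      case 3
      define x where "x = C1 * W * t"
      have x: "0 \<le> x" "x < 1" using 3 C1 W t by (auto simp: x_def)
      have tt: "t \<le> t0" "t \<le> 1" using 3 by (auto simp: t1_def)
      have t4: "t ^ 4 \<le> t" "t\<^sup>2 \<le> t" using t tt power_decreasing[of 1 4 t] power_decreasing[of 1 2 t] by auto
      define \<zeta> where "\<zeta> = Cz * W"
      have small: "cact * (l1 v)\<^sup>2 * 1 / 2 + (l1 v)^4 * (\<delta> * (2 * Phi0_bound + \<delta>)) / (4 * P) < \<zeta>"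
      proof -
        have "cact * (l1 v)\<^sup>2 * 1 / 2 \<le> cact / 2 * W"
          using mult_left_mono[OF l1_pow_le(1)[of v] cact] by (simp add: W_def)
        moreover have "(l1 v)^4 * (\<delta> * (2 * Phi0_bound + \<delta>)) / (4 * P) \<le> \<delta> * (2 * Phi0_bound + \<delta>) / (4 * P) * W"
        proof -
          have "0 \<le> \<delta> * (2 * Phi0_bound + \<delta>) / (4 * P)" using \<delta> P Phi0_bound_nonneg by simp
          from mult_left_mono[OF l1_pow_le(3)[of v] this] show ?thesis by (simp add: W_def mult_ac)
        qed
        moreover have "\<zeta> = cact / 2 * W + \<delta> * (2 * Phi0_bound + \<delta>) / (4 * P) * W + W"
          by (simp add: \<zeta>_def Cz_def distrib_right)
        ultimately show ?thesis using W by linarith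
      qed
      note E = est[OF t tt(1) small, folded f0_def]
      have rz: "\<bar>rate v\<bar> + \<zeta> \<le> C1 * W"
      proof -
        have "0 \<le> Cm * W" using Cm W by simp
        then show ?thesis using Cr(2)[of v] by (simp add: C1_def \<zeta>_def W_def distrib_right)
      qed
      have "t * (\<bar>rate v\<bar> + \<zeta>) \<le> x" using mult_left_mono[OF rz, of t] t by (simp add: x_def mult_ac)
      then have tx: "t * (rate v + \<zeta>) \<le> x" "- x \<le> t * (rate v - \<zeta>)"
      proof -
        have "t * rate v \<le> t * \<bar>rate v\<bar>" "t * - rate v \<le> t * \<bar>rate v\<bar>"
          using t by (intro mult_left_mono; simp)+
        moreover assume "t * (\<bar>rate v\<bar> + \<zeta>) \<le> x"
        ultimately show "t * (rate v + \<zeta>) \<le> x" "- x \<le> t * (rate v - \<zeta>)"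
          unfolding distrib_left right_diff_distrib by linarith+
      qed
      have "gval t v - f0 \<le> 2 * x + C * t"
      proof -
        have "exp (t * (rate v + \<zeta>)) \<le> 1 + x + x\<^sup>2"
          using exp_bound[of x] x tx(1) by (meson exp_le_cancel_iff less_imp_le order_trans)
        also have "\<dots> \<le> 1 + 2 * x" using x mult_left_mono[of x 1 x] by (simp add: power2_eq_square)
        finally have "f0 * exp (t * (rate v + \<zeta>)) \<le> f0 * (1 + 2 * x)" using f0 by (intro mult_left_mono) auto
        moreover have "f0 * (2 * x) \<le> 2 * x" using f0 x mult_right_mono[of f0 1 "2 * x"] by simp
        moreover have "C * t ^ 4 \<le> C * t" using t4 C by (intro mult_left_mono) auto
        ultimately show ?thesis using E by (simp add: distrib_left)
      qed
      moreover have "f0 - gval t v \<le> x + (2 + C) * t"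
      proof -
        let ?e = "exp (t * ((l1 v)^4 * (Phi0_bound + \<delta>)\<^sup>2 / (2 * P)))"
        define B where "B = t\<^sup>2 / 2 * ?e + C * t\<^sup>2 / 2"
        have "(l1 v)^4 * (Phi0_bound + \<delta>)\<^sup>2 / (2 * P) \<le> C1 * W"
        proof -
          have "(l1 v)^4 * (Phi0_bound + \<delta>)\<^sup>2 / (2 * P) = Cm * (l1 v)^4" by (simp add: Cm_def)
          also have "\<dots> \<le> C1 * W" using Cr Cz Cm W by (intro mult_mono) (auto simp: C1_def W_def)
          finally show ?thesis .
        qed
        \<comment> \<open>This is where t |v|^4 must be small: the second moment of the stochastic
          exponential is then at most exp 1 <= 3.\<close>
        then have "t * ((l1 v)^4 * (Phi0_bound + \<delta>)\<^sup>2 / (2 * P)) \<le> 1"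
          using mult_left_mono[of _ "C1 * W" t] t x by (fastforce simp: x_def mult_ac)
        then have "?e \<le> 3" using exp_le exp_le_cancel_iff order_trans by blast
        then have "t\<^sup>2 / 2 * ?e \<le> t\<^sup>2 / 2 * 3" by (intro mult_left_mono) auto
        moreover have "C * t\<^sup>2 \<le> C * t" using t4 C by (intro mult_left_mono) auto
        moreover have "0 \<le> C * t" using C t by simp
        ultimately have B: "B \<le> (2 + C) * t" using t4 t unfolding B_def distrib_right by linarith
        have B0: "0 \<le> B" using C by (simp add: B_def)
        have low: "f0 * exp (t * (rate v - \<zeta>)) * (1 - B) \<le> gval t v" using E by (simp add: B_def algebra_simps)
        show ?thesis
        proof (cases "B \<le> 1")
          case True
          have "1 - x \<le> exp (t * (rate v - \<zeta>))"
            using exp_ge_add_one_self[of "t * (rate v - \<zeta>)"] tx(2) by linarith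
          then have "f0 * (1 - x) * (1 - B) \<le> f0 * exp (t * (rate v - \<zeta>)) * (1 - B)"
            using True f0 by (intro mult_right_mono mult_left_mono) auto
          moreover have "f0 * (1 - x) * (1 - B) = f0 - f0 * (x + B) + f0 * (x * B)" by (simp add: algebra_simps)
          moreover have "0 \<le> f0 * (x * B)" using f0 x B0 by simp
          moreover have "f0 * (x + B) \<le> x + B" using f0 x B0 mult_right_mono[of f0 1 "x + B"] by simp
          ultimately show ?thesis using low B by linarith
        next
          case False
          \<comment> \<open>Here the lower bound is void, but B > 1 already dominates the
            difference, which is at most 1.\<close>
          then show ?thesis using f0 ft B x by linarith
        qed
      qed
      ultimately have "\<bar>gval t v - f0\<bar> \<le> 2 * x + (2 + C) * t" using x t C by (simp add: distrib_right abs_le_iff)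
      also have "\<dots> = (2 * C1 * W + (2 + C)) * t" by (simp add: x_def algebra_simps)
      finally show ?thesis using Dge(3) by linarith
    qed
    then show ?thesis by (simp add: f0_def W_def)
  qed
  then show ?thesis using D by blast
qed

end

section \<open>Gaussian integrals\<close>

lemma integrable_gaussian:
  fixes c :: real
  assumes c: "0 < c"
  shows "integrable lborel (\<lambda>x::'a::euclidean_space. exp (- c * (x \<bullet> x)))"
proof (rule integrableI_nonneg)
  define \<sigma> where "\<sigma> = sqrt (1 / (2 * c))"
  have \<sigma>: "0 < \<sigma>" "2 * \<sigma>\<^sup>2 = 1 / c" using c by (auto simp: \<sigma>_def)
  have one: "(\<integral>\<^sup>+x. ennreal (exp (- c * x\<^sup>2)) \<partial>lborel) < \<infinity>"
  proof -
    have "exp (- c * x\<^sup>2) = sqrt (2 * pi * \<sigma>\<^sup>2) * normal_density 0 \<sigma> x" for x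
      using c \<sigma> by (simp add: normal_density_def)
    then have "integrable lborel (\<lambda>x. exp (- c * x\<^sup>2))"
      using \<sigma> by simp
    then show ?thesis by (auto simp: integrable_iff_bounded)
  qed
  have "(\<integral>\<^sup>+x. ennreal (exp (- c * (x \<bullet> x))) \<partial>(lborel :: 'a measure))
     = (\<integral>\<^sup>+x. (\<Prod>b\<in>Basis. ennreal (exp (- c * (x \<bullet> b)\<^sup>2))) \<partial>(lborel :: 'a measure))"
  proof (rule nn_integral_cong)
    fix x :: 'a
    have "exp (- c * (x \<bullet> x)) = (\<Prod>b\<in>Basis. exp (- c * (x \<bullet> b)\<^sup>2))"
      by (simp add: exp_sum[symmetric] sum_distrib_left[symmetric] sum_negf euclidean_inner[of x x] power2_eq_square)
    then show "ennreal (exp (- c * (x \<bullet> x))) = (\<Prod>b\<in>Basis. ennreal (exp (- c * (x \<bullet> b)\<^sup>2)))"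
      by (simp add: prod_ennreal)
  qed
  also have "\<dots> = (\<Prod>b\<in>(Basis::'a set). \<integral>\<^sup>+x. ennreal (exp (- c * x\<^sup>2)) \<partial>lborel)"
    by (rule nn_integral_lborel_prod) auto
  also have "\<dots> < \<infinity>" using one by (simp add: ennreal_prod_eq_top less_top[symmetric] power_eq_top_ennreal)
  finally show "(\<integral>\<^sup>+x. ennreal (exp (- c * (x \<bullet> x))) \<partial>(lborel :: 'a measure)) < \<infinity>" .
qed auto

lemma integral_lborel_shift:
  fixes f :: "'a::euclidean_space \<Rightarrow> 'b::{banach, second_countable_topology}"
  assumes "f \<in> borel_measurable borel"
  shows "(LINT x|lborel. f (x + c)) = (LINT x|lborel. f x)"
proof -
  have "(LINT x|lborel. f x) = (LINT x|distr lborel borel ((+) c). f x)" by (simp add: lborel_distr_plus)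
  also have "\<dots> = (LINT x|lborel. f (c + x))" using assms by (subst integral_distr) auto
  finally show ?thesis by (simp add: add.commute)
qed

lemma integral_lborel_scale:
  fixes f :: "'a::euclidean_space \<Rightarrow> 'b::{banach, second_countable_topology}"
  assumes "f \<in> borel_measurable borel" "0 < c"
  shows "(LINT x|lborel. f x) = c ^ DIM('a) *\<^sub>R (LINT x|lborel. f (c *\<^sub>R x))"
proof -
  have "(LINT x|lborel. f x) = (LINT x|density (distr lborel borel (\<lambda>x. 0 + c *\<^sub>R x)) (\<lambda>_. ennreal (\<bar>c\<bar> ^ DIM('a))). f x)"
    using assms(2) by (subst lborel_affine[of c 0, symmetric]) auto
  also have "\<dots> = (LINT x|distr lborel borel (\<lambda>x. 0 + c *\<^sub>R x). c ^ DIM('a) *\<^sub>R f x)"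
    using assms by (subst integral_density) auto
  also have "\<dots> = (LINT x|lborel. c ^ DIM('a) *\<^sub>R f (c *\<^sub>R x))"
    using assms by (subst integral_distr) auto
  finally show ?thesis by simp
qed

text \<open>Nonvanishing of a complex Gaussian integral without diagonalizing the form: with
  \<open>I(s)\<close> the integral with linear term scaled by \<open>s\<close>, completing the square in \<open>I(s)\<^sup>2\<close> gives
  \<open>I(s)\<^sup>2 = K I(sqrt 2 s)\<close>. A zero at \<open>s = 1\<close> would propagate to \<open>s = 2 powr (- k / 2)\<close> for all
  \<open>k\<close> and hence to \<open>s = 0\<close>, where the integral is positive.\<close>

locale gaussian_form =
  fixes Q :: "'a::euclidean_space \<Rightarrow> real" and c :: real
  assumes complete_square: "\<And>x z. Q x + Q (z - x) = 2 * Q (x - z /\<^sub>R 2) + Q z / 2"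
    and hom: "\<And>r x. Q (r *\<^sub>R x) = r\<^sup>2 * Q x"
    and coercive: "\<And>x. c * (x \<bullet> x) \<le> Q x" and c: "0 < c"
    and measurable_form [measurable]: "Q \<in> borel_measurable borel"
begin

definition gint :: "'a \<Rightarrow> 'a \<Rightarrow> real \<Rightarrow> 'a \<Rightarrow> complex" where
  "gint a y s x = exp (complex_of_real (- Q x + s * (a \<bullet> x)) + \<i> * complex_of_real (s * (y \<bullet> x)))"

lemma gint_measurable [measurable]: "gint a y s \<in> borel_measurable borel"
  unfolding gint_def[abs_def] by measurable

lemma norm_gint: "norm (gint a y s x) = exp (- Q x + s * (a \<bullet> x))"
  by (simp add: gint_def)

lemma norm_gint_le:
  assumes "\<bar>s\<bar> \<le> S"
  shows "norm (gint a y s x) \<le> exp (S\<^sup>2 * (a \<bullet> a) / (2 * c)) * exp (- (c / 2) * (x \<bullet> x))"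
proof -
  have "s * (a \<bullet> x) \<le> \<bar>s\<bar> * \<bar>a \<bullet> x\<bar>" by (simp add: abs_mult[symmetric])
  also have "\<dots> \<le> S * (norm a * norm x)"
    using assms by (intro mult_mono Cauchy_Schwarz_ineq2) auto
  also have "\<dots> \<le> S\<^sup>2 * (a \<bullet> a) / (2 * c) + c / 2 * (x \<bullet> x)"
  proof -
    have "0 \<le> (S * norm a - c * norm x)\<^sup>2 / (2 * c)" using c by simp
    also have "\<dots> = S\<^sup>2 * (a \<bullet> a) / (2 * c) + c / 2 * (x \<bullet> x) - S * (norm a * norm x)"
      using c by (simp add: power2_eq_square field_simps flip: norm_eq_sqrt_inner power2_norm_eq_inner)
    finally show ?thesis by simp
  qed
  finally have "- Q x + s * (a \<bullet> x) \<le> S\<^sup>2 * (a \<bullet> a) / (2 * c) + (- (c / 2) * (x \<bullet> x))"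
    using coercive[of x] by simp
  then show ?thesis unfolding norm_gint exp_add[symmetric] by simp
qed

lemma gint_integrable: "integrable lborel (gint a y s)"
proof (rule Bochner_Integration.integrable_bound)
  show "integrable lborel (\<lambda>x. exp (\<bar>s\<bar>\<^sup>2 * (a \<bullet> a) / (2 * c)) * exp (- (c / 2) * (x \<bullet> x)))"
    using c by (intro integrable_mult_right integrable_gaussian) simp
  show "AE x in lborel. norm (gint a y s x) \<le> norm (exp (\<bar>s\<bar>\<^sup>2 * (a \<bullet> a) / (2 * c)) * exp (- (c / 2) * (x \<bullet> x)))"
    using norm_gint_le[of s "\<bar>s\<bar>" a y] by (intro AE_I2) simp
qed simp

text \<open>Write the square as a double integral over x and z - x. The exponent splits into a
  square centred at z / 2 and a term in z alone; by translation the integral over x is the same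
  constant for every z. Since the z-part carries Q z / 2, rescaling z by sqrt 2 restores the form
  and multiplies the linear term by sqrt 2.\<close>

lemma gint_square:
  "\<exists>K. (LINT x|lborel. gint a y s x)\<^sup>2 = K * (LINT x|lborel. gint a y (sqrt 2 * s) x)"
proof -
  let ?I = "LINT x|lborel. gint a y s x"
  let ?f = "\<lambda>x z. gint a y s x * gint a y s (z - x)"
  define K where "K = (LINT x|lborel. complex_of_real (exp (- 2 * Q x)))"
  have "?I\<^sup>2 = (LINT x|lborel. gint a y s x * ?I)"
    by (simp add: power2_eq_square)
  also have "\<dots> = (LINT x|lborel. LINT z|lborel. ?f x z)"
  proof (intro Bochner_Integration.integral_cong refl)
    fix x
    have "?I = (LINT z|lborel. gint a y s (z - x))"
      using integral_lborel_shift[of "gint a y s" "- x"] by simp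
    then show "gint a y s x * ?I = (LINT z|lborel. ?f x z)" by simp
  qed
  also have "\<dots> = (LINT z|lborel. LINT x|lborel. ?f x z)"
  proof (rule lborel_pair.Fubini_integral[symmetric])
    have m: "(\<lambda>(x, z). ?f x z) \<in> borel_measurable (lborel \<Otimes>\<^sub>M lborel)" by measurable
    have shift_int: "integrable lborel (\<lambda>z. gint a y s (z - x))" for x
    proof -
      have "integrable (distr lborel borel ((+) (- x))) (gint a y s)"
        unfolding lborel_distr_plus by (rule gint_integrable)
      then show ?thesis by (subst (asm) integrable_distr_eq) auto
    qed
    show "integrable (lborel \<Otimes>\<^sub>M lborel) (\<lambda>(x, z). ?f x z)"
    proof (rule lborel_pair.Fubini_integrable[OF m])
      have "(LINT z|lborel. norm (?f x z)) = norm (gint a y s x) * (LINT z|lborel. norm (gint a y s z))" for x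
        using integral_lborel_shift[of "\<lambda>z. norm (gint a y s z)" "- x"] by (simp add: norm_mult)
      then show "integrable lborel (\<lambda>x. LINT z|lborel. norm (case (x, z) of (x, z) \<Rightarrow> ?f x z))"
        using gint_integrable[of a y s] by simp
      show "AE x in lborel. integrable lborel (\<lambda>z. case (x, z) of (x, z) \<Rightarrow> ?f x z)"
        using shift_int by simp
    qed
  qed
  also have "\<dots> = (LINT z|lborel. K * exp (complex_of_real (- Q z / 2 + s * (a \<bullet> z)) + \<i> * complex_of_real (s * (y \<bullet> z))))"
  proof (intro Bochner_Integration.integral_cong refl)
    fix z
    have "?f x z = complex_of_real (exp (- 2 * Q (x - z /\<^sub>R 2))) * exp (complex_of_real (- Q z / 2 + s * (a \<bullet> z)) + \<i> * complex_of_real (s * (y \<bullet> z)))" for x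
    proof -
      have q: "- Q x - Q (z - x) = - 2 * Q (x - z /\<^sub>R 2) - Q z / 2" using complete_square[of x z] by linarith
      have re: "(- Q x + s * (a \<bullet> x)) + (- Q (z - x) + s * (a \<bullet> (z - x))) = - 2 * Q (x - z /\<^sub>R 2) + (- Q z / 2 + s * (a \<bullet> z))"
        using q by (simp add: inner_diff_right algebra_simps)
      have im: "s * (y \<bullet> x) + s * (y \<bullet> (z - x)) = s * (y \<bullet> z)" by (simp add: inner_diff_right algebra_simps)
      have prod: "exp (complex_of_real u + \<i> * complex_of_real p) * exp (complex_of_real u' + \<i> * complex_of_real p')
          = exp (complex_of_real (u + u') + \<i> * complex_of_real (p + p'))" for u u' p p'
        by (simp add: exp_add[symmetric] algebra_simps)
      have "exp (complex_of_real (u + u') + \<i> * complex_of_real p)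
          = complex_of_real (exp u) * exp (complex_of_real u' + \<i> * complex_of_real p)" for u u' p
        by (simp add: exp_add exp_of_real)
      then show ?thesis unfolding gint_def prod re im .
    qed
    then have "(LINT x|lborel. ?f x z) = (LINT x|lborel. complex_of_real (exp (- 2 * Q (x - z /\<^sub>R 2)))) * exp (complex_of_real (- Q z / 2 + s * (a \<bullet> z)) + \<i> * complex_of_real (s * (y \<bullet> z)))"
      by simp
    also have "(LINT x|lborel. complex_of_real (exp (- 2 * Q (x - z /\<^sub>R 2)))) = K"
      unfolding K_def using integral_lborel_shift[of "\<lambda>x. complex_of_real (exp (- 2 * Q x))" "- (z /\<^sub>R 2)"] by simp
    finally show "(LINT x|lborel. ?f x z) = K * exp (complex_of_real (- Q z / 2 + s * (a \<bullet> z)) + \<i> * complex_of_real (s * (y \<bullet> z)))" .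
  qed
  also have "\<dots> = K * (LINT z|lborel. exp (complex_of_real (- Q z / 2 + s * (a \<bullet> z)) + \<i> * complex_of_real (s * (y \<bullet> z))))"
    by (rule integral_mult_right_zero)
  also have "(LINT z|lborel. exp (complex_of_real (- Q z / 2 + s * (a \<bullet> z)) + \<i> * complex_of_real (s * (y \<bullet> z))))
     = sqrt 2 ^ DIM('a) *\<^sub>R (LINT u|lborel. gint a y (sqrt 2 * s) u)"
    by (subst integral_lborel_scale[where c="sqrt 2"]) (simp_all add: gint_def[abs_def] hom mult_ac)
  finally show ?thesis by (intro exI[of _ "K * complex_of_real (sqrt 2 ^ DIM('a))"]) (simp add: scaleR_conv_of_real)
qed

lemma gint_at_zero: "(LINT x|lborel. gint a y 0 x) \<noteq> 0"
proof
  have e: "gint a y 0 = (\<lambda>x. complex_of_real (exp (- Q x)))"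
    by (simp add: gint_def[abs_def] flip: exp_of_real)
  have int: "integrable lborel (\<lambda>x. exp (- Q x))"
    using integrable_norm[OF gint_integrable[of a y 0]] by (simp add: norm_gint)
  assume "(LINT x|lborel. gint a y 0 x) = 0"
  then have "(LINT x|lborel. exp (- Q x)) = 0" by (simp add: e)
  then have "AE x in lborel. exp (- Q x) = 0"
    using int by (subst (asm) integral_nonneg_eq_0_iff_AE) auto
  then have "AE x in (lborel :: 'a measure). False" by simp
  then show False by (simp add: eventually_False ae_filter_eq_bot_iff)
qed

lemma gaussian_integral_nonzero:
  "(LINT x|lborel. exp (complex_of_real (- Q x + a \<bullet> x) + \<i> * complex_of_real (y \<bullet> x))) \<noteq> 0"
proof
  define I where "I s = (LINT x|lborel. gint a y s x)" for s
  define r where "r = 1 / sqrt (2::real)"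
  have r: "0 \<le> r" "r < 1" "sqrt 2 * r = 1" by (auto simp: r_def)
  assume "(LINT x|lborel. exp (complex_of_real (- Q x + a \<bullet> x) + \<i> * complex_of_real (y \<bullet> x))) = 0"
  then have "I 1 = 0" by (simp add: I_def gint_def)
  have zero: "I (r ^ k) = 0" for k
  proof (induction k)
    case (Suc k)
    obtain K where "(I (r ^ Suc k))\<^sup>2 = K * I (sqrt 2 * r ^ Suc k)" using gint_square unfolding I_def by blast
    also have "sqrt 2 * r ^ Suc k = r ^ k" using r by simp
    finally show ?case using Suc by simp
  qed (simp add: \<open>I 1 = 0\<close>)
  have "(\<lambda>k. I (r ^ k)) \<longlonglongrightarrow> I 0"
    unfolding I_def
  proof (rule integral_dominated_convergence)
    show "integrable lborel (\<lambda>x. exp (1\<^sup>2 * (a \<bullet> a) / (2 * c)) * exp (- (c / 2) * (x \<bullet> x)))"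
      using c by (intro integrable_mult_right integrable_gaussian) simp
    show "AE x in lborel. norm (gint a y (r ^ k) x) \<le> exp (1\<^sup>2 * (a \<bullet> a) / (2 * c)) * exp (- (c / 2) * (x \<bullet> x))" for k
      using r by (intro AE_I2 norm_gint_le) (simp add: power_le_one)
    show "AE x in lborel. (\<lambda>k. gint a y (r ^ k) x) \<longlonglongrightarrow> gint a y 0 x"
      unfolding gint_def using r by (intro AE_I2 tendsto_intros LIMSEQ_power_zero) auto
  qed auto
  then have "I 0 = 0" using zero by (simp add: LIMSEQ_const_iff)
  then show False using gint_at_zero by (simp add: I_def)
qed

end

section \<open>Continuity of the drifts\<close>

text \<open>Diagonal entries x, y and off-diagonal entry z of a semidefinite 2 x 2 matrix: the
  domain on which an entry of either drift is a continuous function.\<close>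

definition psd_triples :: "(real \<times> real \<times> real) set" where
  "psd_triples = {(x, y, z). 0 \<le> x \<and> 0 \<le> y \<and> z\<^sup>2 \<le> x * y}"

text \<open>Each drift entry depends only on the corresponding diagonal and off-diagonal entries;
  continuity on such triples gives a radius per entry, and the finitely many radii have a positive
  minimum.\<close>

lemma drift_continuous_from_entry:
  fixes b :: "('i::finite) mat \<Rightarrow> 'i mat"
  assumes eq: "\<And>A a c. psd A \<Longrightarrow> b A a c = g (A a a, A c c, A a c)"
    and cont: "continuous_on psd_triples g" and B: "psd B" and \<epsilon>: "0 < \<epsilon>"
  shows "\<exists>\<delta>>0. \<forall>A. psd A \<and> (\<forall>a c. \<bar>A a c - B a c\<bar> \<le> \<delta>) \<longrightarrow> (\<forall>a c. \<bar>b A a c - b B a c\<bar> \<le> \<epsilon>)"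
proof -
  have mem: "(A a a, A c c, A a c) \<in> psd_triples" if "psd A" for A :: "'i mat" and a c
    using psd_diag_nonneg[OF that] psd_offdiag[OF that] by (simp add: psd_triples_def)
  have "\<exists>d>0. \<forall>A. psd A \<and> (\<forall>a c. \<bar>A a c - B a c\<bar> < d) \<longrightarrow> \<bar>b A a c - b B a c\<bar> \<le> \<epsilon>" for a c
  proof -
    obtain d where d: "0 < d" "\<And>p. p \<in> psd_triples \<Longrightarrow> dist p (B a a, B c c, B a c) < d \<Longrightarrow> dist (g p) (g (B a a, B c c, B a c)) < \<epsilon>"
      using cont[unfolded continuous_on_iff, rule_format, OF mem[OF B] \<epsilon>] by metis
    have "\<bar>b A a c - b B a c\<bar> \<le> \<epsilon>" if A: "psd A" and near: "\<forall>a c. \<bar>A a c - B a c\<bar> < d / 3" for A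
    proof -
      have "dist (A a a, A c c, A a c) (B a a, B c c, B a c) \<le> \<bar>A a a - B a a\<bar> + (\<bar>A c c - B c c\<bar> + \<bar>A a c - B a c\<bar>)"
        unfolding dist_Pair_Pair dist_real_def
        by (intro order_trans[OF sqrt_sum_squares_le_sum_abs]) (auto intro!: add_mono sqrt_sum_squares_le_sum_abs)
      also have "\<dots> < d" using near[rule_format, of a a] near[rule_format, of c c] near[rule_format, of a c] by linarith
      finally show ?thesis using d(2)[OF mem[OF A, of a c]] by (simp add: eq[OF A] eq[OF B] dist_real_def)
    qed
    then show ?thesis using d(1) by (intro exI[of _ "d / 3"]) auto
  qed
  note ex = this
  define admits where "admits d a c \<longleftrightarrow> 0 < d \<and> (\<forall>A. psd A \<and> (\<forall>a c. \<bar>A a c - B a c\<bar> < d) \<longrightarrow> \<bar>b A a c - b B a c\<bar> \<le> \<epsilon>)"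
    for d a c
  have "\<exists>d. admits d a c" for a c using ex[of a c] unfolding admits_def by blast
  then obtain d where "\<And>a c. admits (d a c) a c" by metis
  then have d: "0 < d a c" "psd A \<Longrightarrow> \<forall>i j. \<bar>A i j - B i j\<bar> < d a c \<Longrightarrow> \<bar>b A a c - b B a c\<bar> \<le> \<epsilon>" for a c A
    unfolding admits_def by blast+
  define m where "m = Min (range (\<lambda>(a, c). d a c))"
  have m: "0 < m" "m \<le> d a c" for a c
    unfolding m_def using d(1) by (auto intro!: Min_le simp: Min_gr_iff)
  show ?thesis
  \<comment> \<open>Halving fits the closed ball of the conclusion into the open balls
    above.\<close>
  proof (intro exI[of _ "m / 2"] conjI allI impI)
    fix A a c assume A: "psd A \<and> (\<forall>a c. \<bar>A a c - B a c\<bar> \<le> m / 2)"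
    have "\<bar>A i j - B i j\<bar> < d a c" for i j
    proof -
      have "\<bar>A i j - B i j\<bar> \<le> m / 2" using A by blast
      then show ?thesis using m(1) m(2)[of a c] by linarith
    qed
    then show "\<bar>b A a c - b B a c\<bar> \<le> \<epsilon>" using d(2) A by blast
  qed (use m in simp)
qed

text \<open>On positive semidefinite matrices the ReLU drift has an expression without division by the
  diagonal, apart from the bounded factor given by the arccosine.\<close>

definition relu_entry :: "real \<Rightarrow> real \<Rightarrow> real \<times> real \<times> real \<Rightarrow> real" where
  "relu_entry cp cm = (\<lambda>(x, y, z). (cp - cm)\<^sup>2 / (2 * pi) * (sqrt (x * y - z\<^sup>2) - z * arccos (z / sqrt (x * y))))"

lemma relu_drift_entry:
  assumes A: "psd A"
  shows "relu_drift cp cm A a c = relu_entry cp cm (A a a, A c c, A a c)"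
proof -
  define s where "s = sqrt (A a a) * sqrt (A c c)"
  have s: "s = sqrt (A a a * A c c)" by (simp add: s_def real_sqrt_mult)
  have s2: "s\<^sup>2 = A a a * A c c" using psd_diag_nonneg[OF A] by (simp add: s)
  have s0: "0 \<le> s" using psd_diag_nonneg[OF A] by (simp add: s)
  have z: "(A a c)\<^sup>2 \<le> s\<^sup>2" using psd_offdiag[OF A] s2 by simp
  have "s * sqrt (1 - (A a c / s)\<^sup>2) = sqrt (s\<^sup>2 - (A a c)\<^sup>2)"
  \<comment> \<open>With s = 0 the ratio is a division by zero with value 0; the semidefinite bound
    forces A a c = 0, so both sides vanish.\<close>
  proof (cases "s = 0")
    case True
    then show ?thesis using z by simp
  next
    case False
    have "s * sqrt (1 - (A a c / s)\<^sup>2) = sqrt (s\<^sup>2 * (1 - (A a c / s)\<^sup>2))"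
      using s0 by (simp add: real_sqrt_mult)
    also have "s\<^sup>2 * (1 - (A a c / s)\<^sup>2) = s\<^sup>2 - (A a c)\<^sup>2" using False by (simp add: field_simps)
    finally show ?thesis .
  qed
  moreover have "s * (A a c / s) = A a c" using z by (cases "s = 0") auto
  moreover have "s * (k * (r - q * h)) = k * (s * r - s * q * h)" for k r q h :: real
    by (simp only: right_diff_distrib mult.assoc mult.left_commute)
  ultimately have "s * relu_rho cp cm (A a c / s) = relu_entry cp cm (A a a, A c c, A a c)"
    unfolding relu_rho_def relu_entry_def prod.case s2[symmetric] s[symmetric] real_sqrt_abs abs_of_nonneg[OF s0]
    by (simp only:)
  moreover have "relu_drift cp cm A a c = s * relu_rho cp cm (A a c / s)"
    unfolding relu_drift_def s_def by (simp only: mult.assoc mult.commute[of "relu_rho _ _ _"])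
  ultimately show ?thesis by (simp only:)
qed

lemma psd_triples_ratio:
  assumes "(x, y, z) \<in> psd_triples"
  shows "z / sqrt (x * y) \<in> {-1..1}"
proof -
  have "\<bar>z\<bar> \<le> sqrt (x * y)" using assms by (simp add: psd_triples_def real_le_rsqrt)
  then have "\<bar>z / sqrt (x * y)\<bar> \<le> 1"
    unfolding abs_divide by (intro divide_le_eq_1[THEN iffD2]) (auto simp del: abs_divide)
  then have "- 1 \<le> z / sqrt (x * y)" "z / sqrt (x * y) \<le> 1" by linarith+
  then show ?thesis unfolding atLeastAtMost_iff by (rule conjI)
qed

text \<open>The ratio z / sqrt (x y) need not have a limit where x y = 0. But there z = 0, and the
  factor z in front of the bounded arccosine forces the product to 0. Where z is nonzero, x y >= z^2
  > 0 and the formula is a composition of continuous functions.\<close>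

lemma continuous_relu_entry: "continuous_on psd_triples (relu_entry cp cm)"
proof -
  let ?h = "\<lambda>p :: real \<times> real \<times> real. snd (snd p) * arccos (snd (snd p) / sqrt (fst p * fst (snd p)))"
  have "continuous (at p within psd_triples) ?h" if p: "p \<in> psd_triples" for p
  proof (cases "snd (snd p) = 0")
    case True
    have le: "norm (?h q) \<le> \<bar>snd (snd q)\<bar> * pi" if "q \<in> psd_triples" for q
    proof -
      have "snd (snd q) / sqrt (fst q * fst (snd q)) \<in> {-1..1}"
        using psd_triples_ratio[of "fst q" "fst (snd q)" "snd (snd q)"] that by simp
      then have "0 \<le> arccos (snd (snd q) / sqrt (fst q * fst (snd q)))" "arccos (snd (snd q) / sqrt (fst q * fst (snd q))) \<le> pi"
        using arccos_bounded by auto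
      then show ?thesis unfolding real_norm_def abs_mult by (intro mult_left_mono) auto
    qed
    have "((\<lambda>q. \<bar>snd (snd q)\<bar> * pi) \<longlongrightarrow> \<bar>snd (snd p)\<bar> * pi) (at p within psd_triples)"
      by (intro tendsto_intros)
    then have "((\<lambda>q. \<bar>snd (snd q)\<bar> * pi) \<longlongrightarrow> 0) (at p within psd_triples)" using True by simp
    then have "(?h \<longlongrightarrow> 0) (at p within psd_triples)"
      by (rule Lim_null_comparison[rotated]) (unfold eventually_at_filter, intro always_eventually allI impI le)
    then show ?thesis using True by (simp add: continuous_within)
  next
    case False
    let ?U = "{q :: real \<times> real \<times> real. snd (snd q) \<noteq> 0}"
    have U: "open ?U" by (intro open_Collect_neq continuous_intros)
    have "continuous_on (psd_triples \<inter> ?U) ?h"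
    proof (intro continuous_intros)
      show "\<forall>q\<in>psd_triples \<inter> ?U. sqrt (fst q * fst (snd q)) \<noteq> 0"
        by (auto simp: psd_triples_def)
      show "\<forall>q\<in>psd_triples \<inter> ?U. - 1 \<le> snd (snd q) / sqrt (fst q * fst (snd q)) \<and> snd (snd q) / sqrt (fst q * fst (snd q)) \<le> 1"
        using psd_triples_ratio by fastforce
    qed
    then have "continuous (at p within psd_triples \<inter> ?U) ?h"
      using p False by (simp add: continuous_on_eq_continuous_within)
    moreover have "at p within psd_triples \<inter> ?U = at p within psd_triples"
      using False U by (intro at_within_nhd[of p ?U]) auto
    ultimately show ?thesis by simp
  qed
  then have h: "continuous_on psd_triples ?h" by (simp add: continuous_on_eq_continuous_within)
  have "continuous_on psd_triples (\<lambda>p. (cp - cm)\<^sup>2 / (2 * pi) * (sqrt (fst p * fst (snd p) - (snd (snd p))\<^sup>2) - ?h p))"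
    by (intro continuous_intros h)
  moreover have "relu_entry cp cm = (\<lambda>p. (cp - cm)\<^sup>2 / (2 * pi) * (sqrt (fst p * fst (snd p) - (snd (snd p))\<^sup>2) - ?h p))"
    unfolding relu_entry_def by (rule ext) (simp split: prod.split)
  ultimately show ?thesis by (simp only:)
qed

lemma admissible_drift_continuous:
  assumes b: "admissible_drift b" and B: "psd B" and \<epsilon>: "0 < \<epsilon>"
  shows "\<exists>\<delta>>0. \<forall>A. psd A \<and> (\<forall>a c. \<bar>A a c - B a c\<bar> \<le> \<delta>) \<longrightarrow> (\<forall>a c. \<bar>b A a c - b B a c\<bar> \<le> \<epsilon>)"
proof -
  consider cp cm where "b = relu_drift cp cm" | d2 d3 where "b = smooth_drift d2 d3"
    using b unfolding admissible_drift_def by blast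
  then show ?thesis
  proof cases
    case 1
    show ?thesis unfolding 1
      by (rule drift_continuous_from_entry[OF relu_drift_entry continuous_relu_entry B \<epsilon>])
  next
    case 2
    let ?g = "\<lambda>p. 1/4 * d2^2 * (fst p * fst (snd p) + snd (snd p) * (2 * snd (snd p) - 3))
     + 1/2 * d3 * snd (snd p) * (fst p + fst (snd p) - 2)"
    show ?thesis unfolding 2
      by (rule drift_continuous_from_entry[where g="?g", OF _ _ B \<epsilon>])
         (auto simp: smooth_drift_def intro!: continuous_intros)
  qed
qed

section \<open>Assembling the derivative\<close>

lemma quad_parallelogram:
  "quad u A + quad w A = 2 * quad (\<lambda>a. (u a - w a) / 2) A + quad (\<lambda>a. u a + w a) A / 2"
proof -
  have "u * a * u' + w * a * w' = 2 * ((u - w) / 2 * a * ((u' - w') / 2)) + (u + w) * a * (u' + w') / 2"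
    for u w u' w' a :: real
  proof -
    define h h' where "h = (u - w) / 2" and "h' = (u' - w') / 2"
    then have "u = 2 * h + w" "u' = 2 * h' + w'" by auto
    then show ?thesis unfolding h_def[symmetric] h'_def[symmetric] by (simp add: algebra_simps)
  qed
  note key = this
  show ?thesis
    unfolding quad_def sum_distrib_left sum_divide_distrib sum.distrib[symmetric] by (intro sum.cong refl key)
qed

lemma quad_scale: "quad (\<lambda>a. r * u a) A = r\<^sup>2 * quad u A"
  by (simp add: quad_def sum_distrib_left power2_eq_square mult_ac)

lemma sum_option: "(\<Sum>a\<in>(UNIV :: 'p::finite option set). f a) = f None + (\<Sum>i\<in>UNIV. f (Some i))"
  by (simp add: UNIV_option_conv sum.reindex)

lemma quad_vvec_split:
  assumes "psd A"
  shows "quad (vvec p \<kappa>) A = quad (vvec p 0) A + 2 * \<kappa> * (\<Sum>i\<in>UNIV. A (Some i) None * p $ i) + \<kappa>\<^sup>2 * A None None"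
proof -
  have v: "vvec p \<kappa> = (\<lambda>a. vvec p 0 a + \<kappa> * unit_at None a)"
    by (auto simp: vvec_def unit_at_def fun_eq_iff split: option.split)
  have "bil (vvec p 0) A (unit_at None) = (\<Sum>i\<in>UNIV. A (Some i) None * p $ i)"
    by (simp add: bil_def mvec_unit_at sum_option vvec_def mult.commute)
  then show ?thesis
    unfolding v quad_add_scaled[OF assms] by (simp add: quad_unit_at)
qed

lemma l1_vvec_le: "l1 (vvec p \<kappa>) \<le> \<bar>\<kappa>\<bar> + real CARD('p) * norm (p :: real^'p::finite)"
proof -
  have "l1 (vvec p \<kappa>) = \<bar>\<kappa>\<bar> + (\<Sum>i\<in>UNIV. \<bar>p $ i\<bar>)" by (simp add: l1_def sum_option vvec_def)
  also have "(\<Sum>i\<in>UNIV. \<bar>p $ i\<bar>) \<le> (\<Sum>i\<in>(UNIV :: 'p set). norm p)" by (intro sum_mono component_le_norm_cart)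
  finally show ?thesis by simp
qed

text \<open>Half of the Gaussian exponent pays for the polynomial: with y = |p|^2 / (4 \<beta>), the
  quartic is at most a multiple of exp y, and exp (- y) is left.\<close>

lemma integrable_gaussian_l1:
  assumes \<beta>: "0 < \<beta>"
  shows "integrable lborel (\<lambda>p::real^'p::finite. exp (- (p \<bullet> p) / (2 * \<beta>)) * (1 + (l1 (vvec p \<kappa>)) ^ 4))"
proof (rule Bochner_Integration.integrable_bound)
  define N where "N = real CARD('p)"
  \<comment> \<open>8 comes from (a + b)^4 <= 8 a^4 + 8 b^4, and 32 \<beta>^2 from |p|^4 = 16
    \<beta>^2 y^2 with y^2 <= 2 exp y.\<close>
  define C where "C = 1 + 8 * \<kappa> ^ 4 + 8 * N ^ 4 * (32 * \<beta>\<^sup>2)"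
  have "integrable lborel (\<lambda>p::real^'p. exp (- (1 / (4 * \<beta>)) * (p \<bullet> p)))"
    by (rule integrable_gaussian) (use \<beta> in simp)
  then show "integrable lborel (\<lambda>p::real^'p. C * exp (- (1 / (4 * \<beta>)) * (p \<bullet> p)))"
    by (rule integrable_mult_right)
  have "(\<lambda>p::real^'p. l1 (vvec p \<kappa>)) \<in> borel_measurable borel"
    unfolding l1_def sum_option by (simp add: vvec_def)
  then show "(\<lambda>p::real^'p. exp (- (p \<bullet> p) / (2 * \<beta>)) * (1 + (l1 (vvec p \<kappa>)) ^ 4)) \<in> borel_measurable lborel"
    by measurable
  have "exp (- (p \<bullet> p) / (2 * \<beta>)) * (1 + (l1 (vvec p \<kappa>)) ^ 4) \<le> C * exp (- (1 / (4 * \<beta>)) * (p \<bullet> p))" for p :: "real^'p"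
  proof -
    define y where "y = (p \<bullet> p) / (4 * \<beta>)"
    have y: "0 \<le> y" using \<beta> by (simp add: y_def)
    have n4: "norm p ^ 4 = 16 * \<beta>\<^sup>2 * y\<^sup>2"
    proof -
      have "norm p ^ 4 = ((norm p)\<^sup>2)\<^sup>2" by (simp flip: power_mult)
      then show ?thesis using \<beta> by (simp add: y_def power2_norm_eq_inner power_divide power_mult_distrib)
    qed
    have ey: "1 \<le> exp y" "y\<^sup>2 \<le> 2 * exp y" using exp_lower_Taylor_quadratic[OF y] y zero_le_power2[of y] by linarith+
    have p4: "(x + z) ^ 4 \<le> 8 * x ^ 4 + 8 * z ^ 4" for x z :: real
    proof -
      have "(x + z)\<^sup>2 \<le> 2 * (x\<^sup>2 + z\<^sup>2)" using zero_le_power2[of "x - z"] by (simp add: power2_eq_square algebra_simps)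
      then have "((x + z)\<^sup>2)\<^sup>2 \<le> (2 * (x\<^sup>2 + z\<^sup>2))\<^sup>2" by (rule power_mono) simp
      also have "\<dots> \<le> 8 * (x\<^sup>2)\<^sup>2 + 8 * (z\<^sup>2)\<^sup>2" using zero_le_power2[of "x\<^sup>2 - z\<^sup>2"] by (simp add: power2_eq_square algebra_simps)
      finally show ?thesis by (simp flip: power_mult)
    qed
    have "(l1 (vvec p \<kappa>)) ^ 4 \<le> (\<bar>\<kappa>\<bar> + N * norm p) ^ 4"
      unfolding N_def by (intro power_mono l1_vvec_le l1_nonneg)
    also have "\<dots> \<le> 8 * \<kappa> ^ 4 + 8 * N ^ 4 * (16 * \<beta>\<^sup>2 * y\<^sup>2)"
      using p4[of "\<bar>\<kappa>\<bar>" "N * norm p"] by (simp add: power_mult_distrib n4 power_even_abs mult.assoc)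
    also have "\<dots> \<le> 8 * \<kappa> ^ 4 * exp y + 8 * N ^ 4 * (32 * \<beta>\<^sup>2) * exp y"
    proof (rule add_mono)
      show "8 * \<kappa> ^ 4 \<le> 8 * \<kappa> ^ 4 * exp y" using mult_left_mono[OF ey(1), of "8 * \<kappa> ^ 4"] by simp
      show "8 * N ^ 4 * (16 * \<beta>\<^sup>2 * y\<^sup>2) \<le> 8 * N ^ 4 * (32 * \<beta>\<^sup>2) * exp y"
        using mult_left_mono[OF ey(2), of "8 * N ^ 4 * (16 * \<beta>\<^sup>2)"] by (simp add: mult_ac)
    qed
    finally have "1 + (l1 (vvec p \<kappa>)) ^ 4 \<le> C * exp y" using ey(1) unfolding C_def distrib_right by linarith
    then have "exp (- 2 * y) * (1 + (l1 (vvec p \<kappa>)) ^ 4) \<le> exp (- 2 * y) * (C * exp y)" by (rule mult_left_mono) simp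
    also have "\<dots> = C * exp (- y)" by (simp add: mult.left_commute flip: exp_add)
    finally show ?thesis by (simp add: y_def)
  qed
  note le = this
  show "AE p in lborel. norm (exp (- (p \<bullet> p) / (2 * \<beta>)) * (1 + (l1 (vvec (p::real^'p) \<kappa>)) ^ 4)) \<le> norm (C * exp (- (1 / (4 * \<beta>)) * (p \<bullet> p)))"
  proof (rule AE_I2)
    fix p :: "real^'p"
    have "norm (exp (- (p \<bullet> p) / (2 * \<beta>)) * (1 + (l1 (vvec p \<kappa>)) ^ 4)) = exp (- (p \<bullet> p) / (2 * \<beta>)) * (1 + (l1 (vvec p \<kappa>)) ^ 4)"
      by simp
    also note le[of p]
    finally show "norm (exp (- (p \<bullet> p) / (2 * \<beta>)) * (1 + (l1 (vvec p \<kappa>)) ^ 4)) \<le> norm (C * exp (- (1 / (4 * \<beta>)) * (p \<bullet> p)))"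
      unfolding real_norm_def by (rule order_trans[OF _ abs_ge_self])
  qed
qed

text \<open>The purely quadratic part of the exponent, with \<kappa> set to 0; the cross term in
  \<kappa> is linear in p and will form the linear part of the Gaussian. Coercivity comes from the
  \<beta> term.\<close>

lemma vvec_gaussian_form:
  assumes A: "psd A" and \<beta>: "0 < \<beta>"
  shows "gaussian_form (\<lambda>p::real^'p::finite. (p \<bullet> p) / (2 * \<beta>) + quad (vvec p 0) A / 2) (1 / (2 * \<beta>))"
proof
  fix x z :: "real^'p"
  have v1: "(\<lambda>a. (vvec x 0 a - vvec (z - x) 0 a) / 2) = vvec (x - z /\<^sub>R 2) 0"
    by (auto simp: vvec_def fun_eq_iff field_simps split: option.split)
  have v2: "(\<lambda>a. vvec x 0 a + vvec (z - x) 0 a) = vvec z 0"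
    by (auto simp: vvec_def fun_eq_iff split: option.split)
  have i: "x \<bullet> x + (z - x) \<bullet> (z - x) = 2 * ((x - z /\<^sub>R 2) \<bullet> (x - z /\<^sub>R 2)) + z \<bullet> z / 2"
    by (simp add: inner_diff_left inner_diff_right inner_commute field_simps)
  have q: "quad (vvec x 0) A + quad (vvec (z - x) 0) A = 2 * quad (vvec (x - z /\<^sub>R 2) 0) A + quad (vvec z 0) A / 2"
    using quad_parallelogram[of "vvec x 0" A "vvec (z - x) 0"] unfolding v1 v2 .
  have comb: "i1 / (2 * \<beta>) + q1 / 2 + (i2 / (2 * \<beta>) + q2 / 2) = 2 * (i3 / (2 * \<beta>) + q3 / 2) + (i4 / (2 * \<beta>) + q4 / 2) / 2"
    if "i1 + i2 = 2 * i3 + i4 / 2" "q1 + q2 = 2 * q3 + q4 / 2" for i1 i2 i3 i4 q1 q2 q3 q4 :: real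
  proof -
    have "(i1 + i2) / (2 * \<beta>) + (q1 + q2) / 2 = (2 * i3 + i4 / 2) / (2 * \<beta>) + (2 * q3 + q4 / 2) / 2"
      unfolding that ..
    then show ?thesis by (simp add: add_divide_distrib)
  qed
  show "x \<bullet> x / (2 * \<beta>) + quad (vvec x 0) A / 2 + ((z - x) \<bullet> (z - x) / (2 * \<beta>) + quad (vvec (z - x) 0) A / 2)
      = 2 * ((x - z /\<^sub>R 2) \<bullet> (x - z /\<^sub>R 2) / (2 * \<beta>) + quad (vvec (x - z /\<^sub>R 2) 0) A / 2)
        + (z \<bullet> z / (2 * \<beta>) + quad (vvec z 0) A / 2) / 2"
    by (rule comb[OF i q])
  fix r :: real
  have "vvec (r *\<^sub>R x) 0 = (\<lambda>a. r * vvec x 0 a)"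
    by (auto simp: vvec_def fun_eq_iff split: option.split)
  then show "r *\<^sub>R x \<bullet> r *\<^sub>R x / (2 * \<beta>) + quad (vvec (r *\<^sub>R x) 0) A / 2
      = r\<^sup>2 * (x \<bullet> x / (2 * \<beta>) + quad (vvec x 0) A / 2)"
    by (simp add: quad_scale power2_eq_square algebra_simps)
  show "1 / (2 * \<beta>) * (x \<bullet> x) \<le> x \<bullet> x / (2 * \<beta>) + quad (vvec x 0) A / 2"
    using psd_quad_nonneg[OF A] by simp
  show "0 < 1 / (2 * \<beta>)" using \<beta> by simp
  show "(\<lambda>p::real^'p. (p \<bullet> p) / (2 * \<beta>) + quad (vvec p 0) A / 2) \<in> borel_measurable borel"
    unfolding quad_def sum_option by (simp add: vvec_def)
qed

text \<open>Dominated convergence works along sequences, so the one-sided derivative is reduced to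
  sequences of positive times.\<close>

lemma has_vector_derivative_right_sequentially:
  fixes f :: "real \<Rightarrow> 'a::real_normed_vector"
  assumes "\<And>X. (\<And>n. 0 < X n) \<Longrightarrow> X \<longlonglongrightarrow> 0 \<Longrightarrow> (\<lambda>n. (f (X n) - f 0) /\<^sub>R X n) \<longlonglongrightarrow> D"
  shows "(f has_vector_derivative D) (at 0 within {0..})"
  unfolding has_vector_derivative_def has_derivative_iff_norm
proof (intro conjI bounded_linear_scaleR_left)
  have lim: "((\<lambda>t. (f t - f 0) /\<^sub>R t - D) \<longlongrightarrow> 0) (at 0 within {0..})"
    unfolding tendsto_at_iff_sequentially comp_def
  proof (intro allI impI)
    fix X :: "nat \<Rightarrow> real" assume "\<forall>i. X i \<in> {0..} - {0}" and X: "X \<longlonglongrightarrow> 0"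
    then have "0 < X n" for n by (metis DiffD1 DiffD2 atLeast_iff insertCI less_eq_real_def)
    from tendsto_diff[OF assms[OF this X] tendsto_const[of D]]
    show "(\<lambda>n. (f (X n) - f 0) /\<^sub>R X n - D) \<longlonglongrightarrow> 0" by simp
  qed
  show "((\<lambda>t. norm (f t - f 0 - (t - 0) *\<^sub>R D) / norm (t - 0)) \<longlongrightarrow> 0) (at 0 within {0..})"
  proof (rule Lim_transform_eventually[OF tendsto_norm_zero[OF lim]])
    have "norm ((f t - f 0) /\<^sub>R t - D) = norm (f t - f 0 - (t - 0) *\<^sub>R D) / norm (t - 0)" if "t \<noteq> 0" for t
    proof -
      have "(f t - f 0) /\<^sub>R t - D = (f t - f 0 - (t - 0) *\<^sub>R D) /\<^sub>R t" using that by (simp add: scaleR_diff_right)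
      then show ?thesis by (simp add: divide_inverse mult.commute)
    qed
    then show "\<forall>\<^sub>F t in at 0 within {0..}. norm ((f t - f 0) /\<^sub>R t - D) = norm (f t - f 0 - (t - 0) *\<^sub>R D) / norm (t - 0)"
      by (auto simp: eventually_at_filter)
  qed
qed

theorem mainTheorem7:
  fixes x :: "'p::finite \<Rightarrow> real^'n::finite" and x0 :: "real^'n" and Y :: "real^'p"
    and \<beta> \<kappa> cact :: real
    and b :: "('p option) mat \<Rightarrow> ('p option) mat"
    and M :: "'a measure" and F :: "real \<Rightarrow> 'a measure"
    and Bt :: "real \<Rightarrow> 'a \<Rightarrow> ('p option) mat"
    and \<Phi> :: "real \<Rightarrow> 'a \<Rightarrow> ('p option) mat"
  assumes "CARD('p) < CARD('n)"
    and "\<forall>u::'p \<Rightarrow> real. u \<noteq> (\<lambda>_. 0) \<longrightarrow>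
           (\<Sum>i\<in>UNIV. \<Sum>j\<in>UNIV. u i * gram x x0 (Some i) (Some j) * u j) > 0"
    and "0 < \<beta>" and "0 < cact"
    and "admissible_drift b"
    and "prob_space M" and "is_filtration M F" and "brownian_matrix M F Bt"
    and "ncsde_solution M F Bt (real CARD('p)) cact b (gram x x0) \<Phi>"
  shows "\<exists>D. (Zfun M \<Phi> \<beta> Y \<kappa> has_vector_derivative D) (at 0 within {0..})
           \<and> Zfun M \<Phi> \<beta> Y \<kappa> 0 \<noteq> 0
           \<and> D / Zfun M \<Phi> \<beta> Y \<kappa> 0 =
               complex_of_real cact
                 * gavg (\<lambda>p. complex_of_real (- quad (vvec p \<kappa>) (b (gram x x0)) / 2)) (gram x x0) \<beta> Y \<kappa>
               + gavg (\<lambda>p. complex_of_real ((quad (vvec p \<kappa>) (gram x x0))^2 / (4 * real CARD('p))))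
                   (gram x x0) \<beta> Y \<kappa>"
proof -
  note \<beta> = assms(3) and sol = assms(9)
  interpret prob_space M by (rule assms(6))
  interpret brownian_space M F Bt using assms(7,8) by unfold_locales
  let ?\<Phi>0 = "gram x x0"
  have psd0: "psd ?\<Phi>0"
  proof -
    obtain w where "w \<in> space M" using not_empty by blast
    then have "\<Phi> 0 w = ?\<Phi>0 \<and> psd (\<Phi> 0 w)" using sol order_refl[of "0::real"] unfolding ncsde_solution_def by blast
    then show ?thesis by metis
  qed
  interpret covariance_sde M F Bt "real CARD('p)" cact b ?\<Phi>0 \<Phi>
  proof unfold_locales
    show "ncsde_solution M F Bt (real CARD('p)) cact b ?\<Phi>0 \<Phi>" by (rule sol)
    show "0 < real CARD('p)" "0 \<le> cact" using assms(4) by simp_all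
  qed (rule admissible_drift_continuous[OF assms(5) psd0])
  let ?v = "\<lambda>p. vvec p \<kappa>"
  define W where "W p = exp (complex_of_real (- (p \<bullet> p) / (2*\<beta>)) + \<i> * complex_of_real (p \<bullet> Y))" for p :: "real^'p"
  have normW: "norm (W p) = exp (- (p \<bullet> p) / (2 * \<beta>))" for p by (simp add: W_def)
  have Wm [measurable]: "W \<in> borel_measurable borel" unfolding W_def[abs_def] by measurable
  have quad_m [measurable]: "(\<lambda>p::real^'p. quad (?v p) A) \<in> borel_measurable borel" for A
    unfolding quad_def sum_option by (simp add: vvec_def)
  have gval_m [measurable]: "(\<lambda>p. gval t (?v p)) \<in> borel_measurable borel" if "0 \<le> t" for t
  proof -
    have [measurable]: "(\<lambda>z. \<Phi> t (snd z) a c) \<in> borel_measurable ((borel :: (real^'p) measure) \<Otimes>\<^sub>M M)" for a c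
      by (rule measurable_compose[OF measurable_snd Phi_measurable[OF that]])
    have [measurable]: "(\<lambda>z. fst z $ i) \<in> borel_measurable ((borel :: (real^'p) measure) \<Otimes>\<^sub>M M)" for i :: 'p
      by (rule measurable_compose[OF measurable_fst borel_measurable_nth])
    have "(\<lambda>(p, w). exp (- quad (?v p) (\<Phi> t w) / 2)) \<in> borel_measurable (borel \<Otimes>\<^sub>M M)"
      unfolding quad_def sum_option vvec_def option.case split_beta' by measurable
    from borel_measurable_lebesgue_integral[OF this] show ?thesis unfolding gval_def .
  qed
  \<comment> \<open>The integrands of the averages and of Z are the weight times a function of at
    most quartic growth in the vector.\<close>
  have dom: "integrable lborel (\<lambda>p. W p * complex_of_real (h p))"
    if h: "h \<in> borel_measurable borel" and C: "\<And>p. \<bar>h p\<bar> \<le> C * (1 + (l1 (?v p)) ^ 4)" for h C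
  proof (rule Bochner_Integration.integrable_bound)
    show "integrable lborel (\<lambda>p::real^'p. C * (exp (- (p \<bullet> p) / (2 * \<beta>)) * (1 + (l1 (?v p)) ^ 4)))"
      by (intro integrable_mult_right integrable_gaussian_l1 \<beta>)
    show "AE p in lborel. norm (W p * complex_of_real (h p)) \<le> norm (C * (exp (- (p \<bullet> p) / (2 * \<beta>)) * (1 + (l1 (?v p)) ^ 4)))"
    proof (rule AE_I2)
      fix p
      have "norm (W p * complex_of_real (h p)) \<le> exp (- (p \<bullet> p) / (2 * \<beta>)) * (C * (1 + (l1 (?v p)) ^ 4))"
        unfolding norm_mult normW norm_of_real by (intro mult_left_mono C) simp
      also have "\<dots> = C * (exp (- (p \<bullet> p) / (2 * \<beta>)) * (1 + (l1 (?v p)) ^ 4))" by simp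
      also have "\<dots> \<le> norm \<dots>" by simp
      finally show "norm (W p * complex_of_real (h p)) \<le> norm (C * (exp (- (p \<bullet> p) / (2 * \<beta>)) * (1 + (l1 (?v p)) ^ 4)))" .
    qed
  qed (use h in measurable)
  have Zf: "Zfun M \<Phi> \<beta> Y \<kappa> t = (LINT p|lborel. W p * complex_of_real (gval t (?v p)))" for t
    unfolding Zfun_def W_def gval_def ..
  have int_gval: "integrable lborel (\<lambda>p. W p * complex_of_real (gval t (?v p)))" if "0 \<le> t" for t
    by (rule dom[of _ 1]) (use that gval_bounds[OF that] in \<open>auto simp: add_increasing2\<close>)
  have g0: "gval 0 v = exp (- quad v ?\<Phi>0 / 2)" for v by (rule gval_0)
  have g0_le: "gval 0 v \<le> 1" "0 \<le> gval 0 v" for v using gval_bounds[of 0 v] by auto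
  obtain Cr where Cr: "0 \<le> Cr" "\<And>v. \<bar>rate v\<bar> \<le> Cr * (1 + (l1 v) ^ 4)" using rate_bound by blast
  obtain Cd where Cd: "0 \<le> Cd" "\<And>t v. 0 < t \<Longrightarrow> \<bar>gval t v - gval 0 v\<bar> \<le> Cd * (1 + (l1 v) ^ 4) * t"
    using gval_dominated by blast
  define D where "D = (LINT p|lborel. W p * complex_of_real (gval 0 (?v p) * rate (?v p)))"
  have deriv: "(Zfun M \<Phi> \<beta> Y \<kappa> has_vector_derivative D) (at 0 within {0..})"
  proof (rule has_vector_derivative_right_sequentially)
    fix X :: "nat \<Rightarrow> real" assume X: "\<And>n. 0 < X n" "X \<longlonglongrightarrow> 0"
    have eq: "(Zfun M \<Phi> \<beta> Y \<kappa> (X n) - Zfun M \<Phi> \<beta> Y \<kappa> 0) /\<^sub>R X n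
       = (LINT p|lborel. W p * complex_of_real ((gval (X n) (?v p) - gval 0 (?v p)) / X n))" for n
    proof -
      have "Zfun M \<Phi> \<beta> Y \<kappa> (X n) - Zfun M \<Phi> \<beta> Y \<kappa> 0
         = (LINT p|lborel. W p * complex_of_real (gval (X n) (?v p)) - W p * complex_of_real (gval 0 (?v p)))"
        unfolding Zf using X(1)[of n] by (intro Bochner_Integration.integral_diff[symmetric] int_gval) auto
      also have "\<dots> /\<^sub>R X n = (LINT p|lborel. (W p * complex_of_real (gval (X n) (?v p)) - W p * complex_of_real (gval 0 (?v p))) /\<^sub>R X n)"
        by simp
      also have "\<dots> = (LINT p|lborel. W p * complex_of_real ((gval (X n) (?v p) - gval 0 (?v p)) / X n))"
        by (intro Bochner_Integration.integral_cong refl) (simp add: scaleR_conv_of_real diff_divide_distrib right_diff_distrib divide_inverse_commute)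
      finally show ?thesis .
    qed
    show "(\<lambda>n. (Zfun M \<Phi> \<beta> Y \<kappa> (X n) - Zfun M \<Phi> \<beta> Y \<kappa> 0) /\<^sub>R X n) \<longlonglongrightarrow> D"
      unfolding eq D_def
    proof (rule integral_dominated_convergence)
      show "integrable lborel (\<lambda>p::real^'p. Cd * (exp (- (p \<bullet> p) / (2 * \<beta>)) * (1 + (l1 (?v p)) ^ 4)))"
        by (intro integrable_mult_right integrable_gaussian_l1 \<beta>)
      show "AE p in lborel. norm (W p * complex_of_real ((gval (X n) (?v p) - gval 0 (?v p)) / X n))
          \<le> Cd * (exp (- (p \<bullet> p) / (2 * \<beta>)) * (1 + (l1 (?v p)) ^ 4))" for n
      proof (rule AE_I2)
        fix p
        have "\<bar>(gval (X n) (?v p) - gval 0 (?v p)) / X n\<bar> \<le> Cd * (1 + (l1 (?v p)) ^ 4)"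
          using Cd(2)[OF X(1)] X(1)[of n] by (simp add: abs_divide divide_le_eq)
        then have "exp (- (p \<bullet> p) / (2 * \<beta>)) * \<bar>(gval (X n) (?v p) - gval 0 (?v p)) / X n\<bar>
            \<le> exp (- (p \<bullet> p) / (2 * \<beta>)) * (Cd * (1 + (l1 (?v p)) ^ 4))" by (rule mult_left_mono) simp
        then show "norm (W p * complex_of_real ((gval (X n) (?v p) - gval 0 (?v p)) / X n))
          \<le> Cd * (exp (- (p \<bullet> p) / (2 * \<beta>)) * (1 + (l1 (?v p)) ^ 4))"
          unfolding norm_mult normW norm_of_real by (simp only: mult.left_commute)
      qed
      have "filterlim X (at_right 0) sequentially"
      proof -
        have "X n \<noteq> 0" for n using X(1)[of n] by simp
        then show ?thesis using X by (auto simp: filterlim_at)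
      qed
      then have "(\<lambda>n. (gval (X n) (?v p) - gval 0 (?v p)) / X n) \<longlonglongrightarrow> gval 0 (?v p) * rate (?v p)" for p
        by (rule filterlim_compose[OF gval_right_derivative])
      then show "AE p in lborel. (\<lambda>n. W p * complex_of_real ((gval (X n) (?v p) - gval 0 (?v p)) / X n))
          \<longlonglongrightarrow> W p * complex_of_real (gval 0 (?v p) * rate (?v p))"
        by (intro AE_I2 tendsto_mult tendsto_const tendsto_of_real)
      show "(\<lambda>p. W p * complex_of_real ((gval (X n) (?v p) - gval 0 (?v p)) / X n)) \<in> borel_measurable lborel" for n
        using gval_m[OF less_imp_le[OF X(1)[of n]]] gval_m[of 0] by measurable
      show "(\<lambda>p. W p * complex_of_real (gval 0 (?v p) * rate (?v p))) \<in> borel_measurable lborel"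
        using gval_m[of 0] unfolding rate_def by measurable
    qed
  qed
  have Z0: "Zfun M \<Phi> \<beta> Y \<kappa> 0 \<noteq> 0"
  proof -
    let ?Q = "\<lambda>p::real^'p. (p \<bullet> p) / (2 * \<beta>) + quad (vvec p 0) ?\<Phi>0 / 2"
    interpret gaussian_form ?Q "1 / (2 * \<beta>)" by (rule vvec_gaussian_form[OF psd0 \<beta>])
    \<comment> \<open>The mixed part of \<open>- quad (vvec p \<kappa>) ?\<Phi>0 / 2\<close>, which
      is linear in p; the part in \<kappa>^2 becomes a constant factor.\<close>
    define a :: "real^'p" where "a = (\<chi> i. - \<kappa> * ?\<Phi>0 (Some i) None)"
    have a: "a \<bullet> p = - \<kappa> * (\<Sum>i\<in>UNIV. ?\<Phi>0 (Some i) None * p $ i)" for p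
      unfolding a_def inner_vec_def sum_distrib_left by (intro sum.cong refl) simp
    have "W p * complex_of_real (gval 0 (?v p)) = complex_of_real (exp (- (\<kappa>\<^sup>2 * ?\<Phi>0 None None) / 2))
        * exp (complex_of_real (- ?Q p + a \<bullet> p) + \<i> * complex_of_real (Y \<bullet> p))" for p
    proof -
      have "- (p \<bullet> p) / (2 * \<beta>) + (- quad (?v p) ?\<Phi>0 / 2) = - (\<kappa>\<^sup>2 * ?\<Phi>0 None None) / 2 + (- ?Q p + a \<bullet> p)"
        unfolding quad_vvec_split[OF psd0, of p \<kappa>] a by (simp add: field_simps)
      then have "complex_of_real (- (p \<bullet> p) / (2 * \<beta>)) + complex_of_real (- quad (?v p) ?\<Phi>0 / 2)
         = complex_of_real (- (\<kappa>\<^sup>2 * ?\<Phi>0 None None) / 2) + complex_of_real (- ?Q p + a \<bullet> p)"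
        by (simp only: of_real_add[symmetric])
      then have "(complex_of_real (- (p \<bullet> p) / (2 * \<beta>)) + \<i> * complex_of_real (p \<bullet> Y)) + complex_of_real (- quad (?v p) ?\<Phi>0 / 2)
         = complex_of_real (- (\<kappa>\<^sup>2 * ?\<Phi>0 None None) / 2) + (complex_of_real (- ?Q p + a \<bullet> p) + \<i> * complex_of_real (Y \<bullet> p))"
        by (simp only: inner_commute[of p Y] add_ac)
      then show ?thesis unfolding W_def g0 exp_of_real[symmetric] exp_add[symmetric] by (rule arg_cong)
    qed
    then have "Zfun M \<Phi> \<beta> Y \<kappa> 0 = complex_of_real (exp (- (\<kappa>\<^sup>2 * ?\<Phi>0 None None) / 2))
        * (LINT p|lborel. exp (complex_of_real (- ?Q p + a \<bullet> p) + \<i> * complex_of_real (Y \<bullet> p)))"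
      unfolding Zf by simp
    then show ?thesis using gaussian_integral_nonzero[of a Y] by simp
  qed
  have gavg_eq: "gavg (\<lambda>p. complex_of_real (h p)) ?\<Phi>0 \<beta> Y \<kappa>
      = (LINT p|lborel. W p * complex_of_real (gval 0 (?v p) * h p)) / Zfun M \<Phi> \<beta> Y \<kappa> 0" for h
  proof -
    have "exp (complex_of_real (- (p \<bullet> p) / (2*\<beta>)) + \<i> * complex_of_real (p \<bullet> Y) - complex_of_real (quad (?v p) ?\<Phi>0 / 2))
       = W p * complex_of_real (gval 0 (?v p))" for p
      unfolding W_def g0 exp_of_real[symmetric] exp_add[symmetric] by simp
    then show ?thesis unfolding gavg_def Let_def Zf by (simp add: mult_ac)
  qed
  let ?h1 = "\<lambda>p. - quad (?v p) (b ?\<Phi>0) / 2" and ?h2 = "\<lambda>p. (quad (?v p) ?\<Phi>0)\<^sup>2 / (4 * real CARD('p))"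
  have split: "rate (?v p) = cact * ?h1 p + ?h2 p" for p by (simp add: rate_def)
  have h2: "integrable lborel (\<lambda>p. W p * complex_of_real (gval 0 (?v p) * ?h2 p))"
  proof (rule dom[of _ "Phi0_bound\<^sup>2 / (4 * real CARD('p))"])
    fix p
    have "(quad (?v p) ?\<Phi>0)\<^sup>2 \<le> (l1 (?v p)) ^ 4 * (Phi0_bound + 0)\<^sup>2"
      by (rule near_quad_sq(2)) (simp_all add: near_def)
    also have "\<dots> \<le> (1 + (l1 (?v p)) ^ 4) * Phi0_bound\<^sup>2" by (simp add: mult_right_mono)
    finally have "\<bar>?h2 p\<bar> \<le> Phi0_bound\<^sup>2 / (4 * real CARD('p)) * (1 + (l1 (?v p)) ^ 4)"
      by (simp add: divide_right_mono mult.commute)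
    moreover have "\<bar>gval 0 (?v p) * ?h2 p\<bar> \<le> 1 * \<bar>?h2 p\<bar>"
      unfolding abs_mult using g0_le by (intro mult_right_mono) auto
    ultimately show "\<bar>gval 0 (?v p) * ?h2 p\<bar> \<le> Phi0_bound\<^sup>2 / (4 * real CARD('p)) * (1 + (l1 (?v p)) ^ 4)" by linarith
  qed (use gval_m[of 0] in measurable)
  have hr: "integrable lborel (\<lambda>p. W p * complex_of_real (gval 0 (?v p) * rate (?v p)))"
  proof (rule dom[of _ Cr])
    fix p
    have "\<bar>gval 0 (?v p) * rate (?v p)\<bar> \<le> 1 * \<bar>rate (?v p)\<bar>"
      unfolding abs_mult using g0_le by (intro mult_right_mono) auto
    then show "\<bar>gval 0 (?v p) * rate (?v p)\<bar> \<le> Cr * (1 + (l1 (?v p)) ^ 4)" using Cr(2)[of "?v p"] by linarith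
  qed (use gval_m[of 0] in \<open>unfold rate_def, measurable\<close>)
  \<comment> \<open>The drift average is obtained by subtraction: integrability is known for the
    rate and for the quartic part, and what remains is the drift part.\<close>
  have "D - (LINT p|lborel. W p * complex_of_real (gval 0 (?v p) * ?h2 p))
     = (LINT p|lborel. W p * complex_of_real (gval 0 (?v p) * rate (?v p)) - W p * complex_of_real (gval 0 (?v p) * ?h2 p))"
    unfolding D_def by (rule Bochner_Integration.integral_diff[OF hr h2, symmetric])
  also have "\<dots> = (LINT p|lborel. complex_of_real cact * (W p * complex_of_real (gval 0 (?v p) * ?h1 p)))"
    by (intro Bochner_Integration.integral_cong refl) (simp add: split algebra_simps)
  also have "\<dots> = complex_of_real cact * (LINT p|lborel. W p * complex_of_real (gval 0 (?v p) * ?h1 p))"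
    by (rule integral_mult_right_zero)
  finally have D: "D = complex_of_real cact * (LINT p|lborel. W p * complex_of_real (gval 0 (?v p) * ?h1 p))
      + (LINT p|lborel. W p * complex_of_real (gval 0 (?v p) * ?h2 p))"
    by (simp only: diff_eq_eq)
  have "D / Zfun M \<Phi> \<beta> Y \<kappa> 0 = complex_of_real cact * gavg (\<lambda>p. complex_of_real (?h1 p)) ?\<Phi>0 \<beta> Y \<kappa>
      + gavg (\<lambda>p. complex_of_real (?h2 p)) ?\<Phi>0 \<beta> Y \<kappa>"
    unfolding gavg_eq D by (simp only: add_divide_distrib times_divide_eq_right)
  then show ?thesis using deriv Z0 by blast
qed

end
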